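(* Let $\Sigma_n(P_1,P_0,\mathcal H,\widetilde W_B,\widetilde W_C)$ be a hyperbolic boundary control system satisfying the standing assumptions (1)–(5) and the diagonalisability assumption. If the system is exponentially stable on the state space $\widetilde X=L^1([a,b],\mathbb K^n)$, then it is BIBO stable.
   Context: Let $\mathbb K\in\{\mathbb R,\mathbb C\}$, $a<b$, $n\ge1$, and let $\mathbb 1_k$ be the $k\times k$ identity matrix. **hBCS.** $\Sigma_n(P_1,P_0,\mathcal H,\widetilde W_B,\widetilde W_C)$ denotes the system on $[a,b]\times[0,\infty)$ with state $x(\xi,t)\in\mathbb K^n$, input $u(t)\in U=\mathbb K^n$, output $y(t)\in Y=\mathbb K^n$: $$\tfrac{\partial x}{\partial t}(\xi,t)=P_1\tfrac{\partial}{\partial\xi}(\mathcal H(\xi)x(\xi,t))+P_0(\xi)\mathcal H(\xi)x(\xi,t),\quad x(\xi,0)=x_0(\xi),$$ $$u(t)=\widetilde W_B\begin{bmatrix}(\mathcal Hx)(b,t)\\(\mathcal Hx)(a,t)\end{bmatrix},\qquad y(t)=\widetilde W_C\begin{bmatrix}(\mathcal Hx)(b,t)\\(\mathcal Hx)(a,t)\end{bmatrix}.$$ **Standing assumptions.** (1) $P_1\in\mathbb K^{n\times n}$ is invertible and self-adjoint. (2) $P_0\in L^\infty([a,b],\mathbb K^{n\times n})$. (3) $\mathcal H\in L^\infty([a,b],\mathbb K^{n\times n})$, $\mathcal H(\xi)$ is self-adjoint and $m_0\mathbb 1_n\le\mathcal H(\xi)\le M_0\mathbb 1_n$ for a.e.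 $\xi$, for some constants $m_0,M_0>0$. (4) $\widetilde W_B\in\mathbb K^{n\times2n}$ and $\begin{bmatrix}\widetilde W_B\\\widetilde W_C\end{bmatrix}\in\mathbb K^{2n\times2n}$ have full rank. (5) The operator $Ax_0=P_1\frac{\partial}{\partial\xi}(\mathcal Hx_0)+P_0\mathcal Hx_0$ with domain $\{x_0\in X:\mathcal Hx_0\in H^1([a,b],\mathbb K^n),\ \widetilde W_B\begin{bmatrix}(\mathcal Hx_0)(b)\\(\mathcal Hx_0)(a)\end{bmatrix}=0\}$ generates a $C_0$-semigroup on $X=L^2([a,b],\mathbb K^n)$ with inner product $\langle f,g\rangle_X=\frac12\int_a^bg^*\mathcal Hf\,d\xi$. **Diagonalisability assumption.** There exist $S,\mathcal H^D\in C^1([a,b],\mathbb K^{n\times n})$ with $S$ pointwise invertible, $\mathcal H^D$ diagonal and positive, such that $P_1\mathcal H=S^{-1}P_1^D\mathcal H^DS$, where $P_1^D=\begin{pmatrix}\mathbb 1_m&0\\0&-\mathbb 1_{n-m}\end{pmatrix}$ for some $0\le m\le n$. **BIBO stability.** A classical solution is a triple $(u,x,y)$ with $u\in C([0,\infty),U)$, $x\in C^1([0,\infty),X)$, $y\in C([0,\infty),Y)$ solving the system equations. The hBCS is BIBO stable if there is $c>0$ such that for every classical solution with $u\in C_c^\infty([0,\infty),U)$ and $x(0)=0$, and all $t>0$, $\|y\|_{L^\infty([0,t],Y)}\le c\|u\|_{L^\infty([0,t],U)}$. **Exponential stability on $L^1$.** Consider the operator given by the same expression as $A$ on $\widetilde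 X=L^1([a,b],\mathbb K^n)$ with domain $\{x_0\in\widetilde X:\mathcal Hx_0\in W^{1,1}([a,b],\mathbb K^n),\ \widetilde W_B\begin{bmatrix}(\mathcal Hx_0)(b)\\(\mathcal Hx_0)(a)\end{bmatrix}=0\}$. Under the assumptions above it generates a $C_0$-semigroup $(\mathbb T(t))_{t\ge0}$ on $\widetilde X$. The system is exponentially stable on $\widetilde X$ if this semigroup is, i.e. there are $C,\omega>0$ with $\|\mathbb T(t)\|\le Ce^{-\omega t}$ for all $t\ge0$. *)

theory Defs
  imports "HOL-Analysis.Analysis" "HOL-Probability.Essential_Supremum"
begin

section \<open>Scalars and matrices\<close>

text \<open>
  The scalar field is \<open>\<real>\<close> or \<open>\<complex>\<close>. The class below describes exactly these two: by
  Gelfand--Mazur a normed field extending \<open>\<real>\<close> is \<open>\<real>\<close> or \<open>\<complex>\<close>, and the axioms force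
  \<open>kcnj x = \<bar>x\<bar>\<^sup>2 / x\<close> for \<open>x \<noteq> 0\<close>, i.e. complex conjugation.
\<close>

class real_or_complex = real_normed_field + euclidean_space +
  fixes kcnj :: "'a \<Rightarrow> 'a"
  assumes kcnj_mult_self: "kcnj x * x = scaleR ((norm x)\<^sup>2) 1"
    and kcnj_zero: "kcnj 0 = 0"

instantiation real :: real_or_complex
begin
definition kcnj_real :: "real \<Rightarrow> real" where "kcnj_real x = x"
instance
  by standard (simp_all add: kcnj_real_def power2_eq_square)
end

instantiation complex :: real_or_complex
begin
definition kcnj_complex :: "complex \<Rightarrow> complex" where "kcnj_complex z = cnj z"
instance
proof
  fix z :: complex
  show "kcnj z * z = (norm z)\<^sup>2 *\<^sub>R 1"
    by (metis complex_norm_square kcnj_complex_def mult.commute of_real_def)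
qed (simp add: kcnj_complex_def)
end

type_synonym ('k, 'n) sq_mat = "(('k, 'n) vec, 'n) vec"
type_synonym ('k, 'n) boundary_mat = "(('k, 'n + 'n) vec, 'n) vec"

definition herm_prod :: "'k::real_or_complex^'n \<Rightarrow> 'k^'n \<Rightarrow> 'k"
  where "herm_prod u v = (\<Sum>i\<in>UNIV. kcnj (u $ i) * v $ i)"

definition self_adjoint :: "'k::real_or_complex^'n^'n \<Rightarrow> bool"
  where "self_adjoint A \<longleftrightarrow> (\<chi> i j. kcnj (A $ j $ i)) = A"

text \<open>The Loewner order: \<open>B - A\<close> has real nonnegative quadratic form.\<close>

definition loewner_le :: "'k::real_or_complex^'n^'n \<Rightarrow> 'k^'n^'n \<Rightarrow> bool"
  where "loewner_le A B \<longleftrightarrow> (\<forall>v. \<exists>r\<ge>0. herm_prod v ((B - A) *v v) = of_real r)"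

definition stack_vec :: "'k^'n \<Rightarrow> 'k^'n \<Rightarrow> 'k^('n + 'n)"
  where "stack_vec u v = (\<chi> i. case i of Inl j \<Rightarrow> u $ j | Inr j \<Rightarrow> v $ j)"

definition stack_rows :: "'k^'m^'n \<Rightarrow> 'k^'m^'n \<Rightarrow> 'k^'m^('n + 'n)"
  where "stack_rows A B = (\<chi> i. case i of Inl j \<Rightarrow> A $ j | Inr j \<Rightarrow> B $ j)"

text \<open>
  The matrix \<open>diag(1, \<dots>, 1, -1, \<dots>, -1)\<close> with \<open>m\<close> entries \<open>1\<close>; the position of an
  index \<open>i\<close> is the number of smaller indices.
\<close>

definition sign_matrix :: "nat \<Rightarrow> ('k::real_or_complex, 'n::{finite,linorder}) sq_mat"
  where "sign_matrix m =
    (\<chi> i j. if i \<noteq> j then 0 else if card {k. k < i} < m then 1 else - 1)"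

definition positive_diagonal :: "'k::real_or_complex^'n^'n \<Rightarrow> bool"
  where "positive_diagonal D \<longleftrightarrow>
    (\<forall>i j. i \<noteq> j \<longrightarrow> D $ i $ j = 0) \<and> (\<forall>i. \<exists>r>0. D $ i $ i = of_real r)"


section \<open>Function spaces on an interval\<close>

text \<open>
  Elements of \<open>L\<^sup>p([a,b])\<close> are represented by functions on the real line, of which only the
  values on \<open>[a,b]\<close> matter; two representatives are equal if they agree a.e. on \<open>[a,b]\<close>,
  i.e. if the (semi)norm of their difference vanishes.
\<close>

definition L1_space :: "real \<Rightarrow> real \<Rightarrow> (real \<Rightarrow> 'v::euclidean_space) set"
  where "L1_space a b = {f. integrable (lebesgue_on {a..b}) f}"

definition L1_norm :: "real \<Rightarrow> real \<Rightarrow> (real \<Rightarrow> 'v::euclidean_space) \<Rightarrow> real"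
  where "L1_norm a b f = (LINT \<xi>|lebesgue_on {a..b}. norm (f \<xi>))"

definition L2_space :: "real \<Rightarrow> real \<Rightarrow> (real \<Rightarrow> 'v::euclidean_space) set"
  where "L2_space a b = {f. f \<in> borel_measurable (lebesgue_on {a..b}) \<and>
    integrable (lebesgue_on {a..b}) (\<lambda>\<xi>. (norm (f \<xi>))\<^sup>2)}"

definition X_inner :: "real \<Rightarrow> real \<Rightarrow> (real \<Rightarrow> 'k::real_or_complex^'n^'n) \<Rightarrow>
    (real \<Rightarrow> 'k^'n) \<Rightarrow> (real \<Rightarrow> 'k^'n) \<Rightarrow> 'k"
  where "X_inner a b H f g = (LINT \<xi>|lebesgue_on {a..b}. herm_prod (g \<xi>) (H \<xi> *v f \<xi>)) / 2"

text \<open>\<open>X_inner a b H f f\<close> is a nonnegative real scalar, so its norm is its value.\<close>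

definition X_norm :: "real \<Rightarrow> real \<Rightarrow> (real \<Rightarrow> 'k::real_or_complex^'n^'n) \<Rightarrow>
    (real \<Rightarrow> 'k^'n) \<Rightarrow> real"
  where "X_norm a b H f = sqrt (norm (X_inner a b H f f))"

definition ess_bounded :: "real \<Rightarrow> real \<Rightarrow> (real \<Rightarrow> 'v::euclidean_space) \<Rightarrow> bool"
  where "ess_bounded a b F \<longleftrightarrow> F \<in> borel_measurable (lebesgue_on {a..b}) \<and>
    (\<exists>C. AE \<xi> in lebesgue_on {a..b}. norm (F \<xi>) \<le> C)"

definition Linf_norm :: "real \<Rightarrow> (real \<Rightarrow> 'v::euclidean_space) \<Rightarrow> ereal"
  where "Linf_norm t f = esssup (lebesgue_on {0..t}) (\<lambda>s. ereal (norm (f s)))"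

definition C1_interval :: "real \<Rightarrow> real \<Rightarrow> (real \<Rightarrow> 'v::real_normed_vector) \<Rightarrow> bool"
  where "C1_interval a b F \<longleftrightarrow> (\<exists>F'. continuous_on {a..b} F' \<and>
    (\<forall>\<xi>\<in>{a..b}. (F has_vector_derivative F' \<xi>) (at \<xi> within {a..b})))"

text \<open>
  For \<open>V\<close> the space \<open>L\<^sup>p([a,b])\<close>, the relation says that the class of \<open>f\<close> lies in
  \<open>W\<^sup>1\<^sup>,\<^sup>p([a,b])\<close>, with absolutely continuous representative \<open>w\<close> (the indefinite integral of
  its derivative) and derivative \<open>v\<close>. The boundary values of \<open>f\<close> are those of \<open>w\<close>.
\<close>

definition sobolev_W1 :: "real \<Rightarrow> real \<Rightarrow> (real \<Rightarrow> 'v::euclidean_space) set \<Rightarrow>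
    (real \<Rightarrow> 'v) \<Rightarrow> (real \<Rightarrow> 'v) \<Rightarrow> (real \<Rightarrow> 'v) \<Rightarrow> bool"
  where "sobolev_W1 a b V f w v \<longleftrightarrow>
    (AE \<xi> in lebesgue_on {a..b}. f \<xi> = w \<xi>) \<and> v \<in> V \<and>
    (\<forall>\<xi>\<in>{a..b}. w \<xi> = w a + (LINT s|lebesgue_on {a..\<xi>}. v s))"

text \<open>
  Smooth functions on the closed half-line (one-sided derivatives at \<open>0\<close>) with compact
  support in \<open>[0,\<infinity>)\<close>; the support may contain \<open>0\<close>.
\<close>

definition Cc_infinity :: "(real \<Rightarrow> 'v::real_normed_vector) \<Rightarrow> bool"
  where "Cc_infinity u \<longleftrightarrow>
    (\<exists>D :: nat \<Rightarrow> real \<Rightarrow> 'v. (\<forall>t\<ge>0. D 0 t = u t) \<and>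
      (\<forall>k. \<forall>t\<ge>0. (D k has_vector_derivative D (Suc k) t) (at t within {0..}))) \<and>
    compact (closure {t\<in>{0..}. u t \<noteq> 0})"


section \<open>Strongly continuous semigroups\<close>

text \<open>
  \<open>V\<close> is a space of representatives with seminorm \<open>N\<close>, equality being
  \<open>N (f - g) = 0\<close>. Linearity and boundedness make \<open>T t\<close> compatible with this equality.
\<close>

definition C0_semigroup :: "(real \<Rightarrow> 'k::real_or_complex^'n) set \<Rightarrow>
    ((real \<Rightarrow> 'k^'n) \<Rightarrow> real) \<Rightarrow> (real \<Rightarrow> (real \<Rightarrow> 'k^'n) \<Rightarrow> (real \<Rightarrow> 'k^'n)) \<Rightarrow> bool"
  where "C0_semigroup V N T \<longleftrightarrow>
    (\<forall>t\<ge>0.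
      (\<forall>f\<in>V. T t f \<in> V) \<and>
      (\<forall>f\<in>V. \<forall>g\<in>V. N (\<lambda>\<xi>. T t (\<lambda>\<eta>. f \<eta> + g \<eta>) \<xi> - (T t f \<xi> + T t g \<xi>)) = 0) \<and>
      (\<forall>c. \<forall>f\<in>V. N (\<lambda>\<xi>. T t (\<lambda>\<eta>. c *s f \<eta>) \<xi> - c *s T t f \<xi>) = 0) \<and>
      (\<exists>M. \<forall>f\<in>V. N (T t f) \<le> M * N f)) \<and>
    (\<forall>f\<in>V. N (\<lambda>\<xi>. T 0 f \<xi> - f \<xi>) = 0) \<and>
    (\<forall>s\<ge>0. \<forall>t\<ge>0. \<forall>f\<in>V. N (\<lambda>\<xi>. T (s + t) f \<xi> - T s (T t f) \<xi>) = 0) \<and>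
    (\<forall>f\<in>V. ((\<lambda>t. N (\<lambda>\<xi>. T t f \<xi> - f \<xi>)) \<longlongrightarrow> 0) (at_right 0))"

text \<open>Operators are given by their graphs, as sets of pairs of representatives.\<close>

definition generator :: "(real \<Rightarrow> 'k::real_or_complex^'n) set \<Rightarrow>
    ((real \<Rightarrow> 'k^'n) \<Rightarrow> real) \<Rightarrow> (real \<Rightarrow> (real \<Rightarrow> 'k^'n) \<Rightarrow> (real \<Rightarrow> 'k^'n)) \<Rightarrow>
    ((real \<Rightarrow> 'k^'n) \<times> (real \<Rightarrow> 'k^'n)) set"
  where "generator V N T = {(f, g). f \<in> V \<and> g \<in> V \<and>
    ((\<lambda>h. N (\<lambda>\<xi>. (1 / h) *\<^sub>R (T h f \<xi> - f \<xi>) - g \<xi>)) \<longlongrightarrow> 0) (at_right 0)}"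

definition generates :: "(real \<Rightarrow> 'k::real_or_complex^'n) set \<Rightarrow>
    ((real \<Rightarrow> 'k^'n) \<Rightarrow> real) \<Rightarrow> ((real \<Rightarrow> 'k^'n) \<times> (real \<Rightarrow> 'k^'n)) set \<Rightarrow>
    (real \<Rightarrow> (real \<Rightarrow> 'k^'n) \<Rightarrow> (real \<Rightarrow> 'k^'n)) \<Rightarrow> bool"
  where "generates V N A T \<longleftrightarrow> C0_semigroup V N T \<and> generator V N T = A"


section \<open>The boundary control system\<close>

text \<open>
  \<open>g = P\<^sub>1 (\<H>f)' + P\<^sub>0 \<H>f\<close> a.e., where \<open>\<H>f\<close> is a Sobolev function whose absolutely
  continuous representative is \<open>w\<close>; no boundary condition is imposed.
\<close>

definition hyp_op :: "real \<Rightarrow> real \<Rightarrow> (real \<Rightarrow> 'k::real_or_complex^'n) set \<Rightarrow> 'k^'n^'n \<Rightarrow>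
    (real \<Rightarrow> 'k^'n^'n) \<Rightarrow> (real \<Rightarrow> 'k^'n^'n) \<Rightarrow>
    (real \<Rightarrow> 'k^'n) \<Rightarrow> (real \<Rightarrow> 'k^'n) \<Rightarrow> (real \<Rightarrow> 'k^'n) \<Rightarrow> bool"
  where "hyp_op a b V P1 P0 H f w g \<longleftrightarrow> f \<in> V \<and> g \<in> V \<and>
    (\<exists>v. sobolev_W1 a b V (\<lambda>\<xi>. H \<xi> *v f \<xi>) w v \<and>
      (AE \<xi> in lebesgue_on {a..b}. g \<xi> = P1 *v v \<xi> + P0 \<xi> *v (H \<xi> *v f \<xi>)))"

definition hyp_graph :: "real \<Rightarrow> real \<Rightarrow> (real \<Rightarrow> 'k::real_or_complex^'n) set \<Rightarrow> 'k^'n^'n \<Rightarrow>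
    (real \<Rightarrow> 'k^'n^'n) \<Rightarrow> (real \<Rightarrow> 'k^'n^'n) \<Rightarrow> 'k^('n + 'n)^'n \<Rightarrow>
    ((real \<Rightarrow> 'k^'n) \<times> (real \<Rightarrow> 'k^'n)) set"
  where "hyp_graph a b V P1 P0 H WB =
    {(f, g). \<exists>w. hyp_op a b V P1 P0 H f w g \<and> WB *v stack_vec (w b) (w a) = 0}"

text \<open>
  In \<open>classical_solution\<close>, \<open>x t \<xi>\<close> is the state at time \<open>t\<close> and position \<open>\<xi>\<close>, and \<open>x'\<close> is the
  continuous time derivative of \<open>x\<close> in the norm of \<open>X\<close> (one-sided at \<open>t = 0\<close>).
\<close>

definition classical_solution :: "real \<Rightarrow> real \<Rightarrow> 'k::real_or_complex^'n^'n \<Rightarrow>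
    (real \<Rightarrow> 'k^'n^'n) \<Rightarrow> (real \<Rightarrow> 'k^'n^'n) \<Rightarrow> 'k^('n + 'n)^'n \<Rightarrow> 'k^('n + 'n)^'n \<Rightarrow>
    (real \<Rightarrow> 'k^'n) \<Rightarrow> (real \<Rightarrow> real \<Rightarrow> 'k^'n) \<Rightarrow> (real \<Rightarrow> 'k^'n) \<Rightarrow> bool"
  where "classical_solution a b P1 P0 H WB WC u x y \<longleftrightarrow>
    continuous_on {0..} u \<and> continuous_on {0..} y \<and>
    (\<exists>x'. (\<forall>t\<ge>0.
        x t \<in> L2_space a b \<and> x' t \<in> L2_space a b \<and>
        ((\<lambda>s. X_norm a b H (\<lambda>\<xi>. (1 / (s - t)) *\<^sub>R (x s \<xi> - x t \<xi>) - x' t \<xi>)) \<longlongrightarrow> 0)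
          (at t within {0..}) \<and>
        ((\<lambda>s. X_norm a b H (\<lambda>\<xi>. x' s \<xi> - x' t \<xi>)) \<longlongrightarrow> 0) (at t within {0..}) \<and>
        (\<exists>w. hyp_op a b (L2_space a b) P1 P0 H (x t) w (x' t) \<and>
          u t = WB *v stack_vec (w b) (w a) \<and>
          y t = WC *v stack_vec (w b) (w a))))"

definition BIBO_stable :: "real \<Rightarrow> real \<Rightarrow> 'k::real_or_complex^'n^'n \<Rightarrow>
    (real \<Rightarrow> 'k^'n^'n) \<Rightarrow> (real \<Rightarrow> 'k^'n^'n) \<Rightarrow> 'k^('n + 'n)^'n \<Rightarrow> 'k^('n + 'n)^'n \<Rightarrow> bool"
  where "BIBO_stable a b P1 P0 H WB WC \<longleftrightarrow>
    (\<exists>c>0. \<forall>u x y. classical_solution a b P1 P0 H WB WC u x y \<and> Cc_infinity u \<and>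
        (AE \<xi> in lebesgue_on {a..b}. x 0 \<xi> = 0) \<longrightarrow>
      (\<forall>t>0. Linf_norm t y \<le> ereal c * Linf_norm t u))"

text \<open>The generated semigroup is unique up to equality almost everywhere.\<close>

definition exp_stable_L1 :: "real \<Rightarrow> real \<Rightarrow> 'k::real_or_complex^'n^'n \<Rightarrow>
    (real \<Rightarrow> 'k^'n^'n) \<Rightarrow> (real \<Rightarrow> 'k^'n^'n) \<Rightarrow> 'k^('n + 'n)^'n \<Rightarrow> bool"
  where "exp_stable_L1 a b P1 P0 H WB \<longleftrightarrow>
    (\<exists>T. generates (L1_space a b) (L1_norm a b) (hyp_graph a b (L1_space a b) P1 P0 H WB) T \<and>
      (\<exists>C>0. \<exists>\<omega>>0. \<forall>t\<ge>0. \<forall>f\<in>L1_space a b.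
        L1_norm a b (T t f) \<le> C * exp (- \<omega> * t) * L1_norm a b f))"

definition diagonalisable :: "real \<Rightarrow> real \<Rightarrow> ('k::real_or_complex, 'n::{finite,linorder}) sq_mat \<Rightarrow>
    (real \<Rightarrow> ('k, 'n) sq_mat) \<Rightarrow> bool"
  where "diagonalisable a b P1 H \<longleftrightarrow>
    (\<exists>(S :: real \<Rightarrow> ('k, 'n) sq_mat) (HD :: real \<Rightarrow> ('k, 'n) sq_mat). \<exists>m\<le>CARD('n).
      C1_interval a b S \<and> C1_interval a b HD \<and>
      (\<forall>\<xi>\<in>{a..b}. invertible (S \<xi>) \<and> positive_diagonal (HD \<xi>)) \<and>
      (AE \<xi> in lebesgue_on {a..b}.
        P1 ** H \<xi> = matrix_inv (S \<xi>) ** sign_matrix m ** HD \<xi> ** S \<xi>))"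

end

theory Submission
  imports Defs
begin

text \<open>
  Let \<open>z\<close> be a curve with \<open>z' = A z + \<Sum>\<^sub>j \<alpha>\<^sub>j(t) g\<^sub>j\<close>, \<open>z(0) = 0\<close>, and let \<open>c\<close> be a linear functional of
  the boundary trace. By time invariance \<open>c(z) = \<Sum>\<^sub>j \<alpha>\<^sub>j * c(T(\<cdot>) g\<^sub>j)\<close>, a convolution, so \<open>\<bar>c(z(t))\<bar>\<close> is at
  most \<open>\<Sum>\<^sub>j sup \<bar>\<alpha>\<^sub>j\<bar> \<parallel>c(T(\<cdot>) g\<^sub>j)\<parallel>\<close> with the \<open>L\<^sup>1\<close> norm in time. Exponential stability on \<open>L\<^sup>1\<close> makes
  this norm at most \<open>M \<parallel>g\<^sub>j\<parallel>\<close>: testing the equation with multipliers that vanish at one end of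
  \<open>[a,b]\<close> and are transported along a characteristic leaves only the trace at the other end and
  terms bounded by \<open>\<integral> \<parallel>T(t) g\<^sub>j\<parallel> dt\<close>. The convolution formula is used in dual form, paired with
  test functions of time, so that no vector-valued integral is needed.

  The inputs are moved into the domain by lifts \<open>\<Phi>\<^sub>j\<close> of the boundary data that are steep near the
  boundary: \<open>\<parallel>\<Phi>\<^sub>j\<parallel>\<close> is arbitrarily small while \<open>\<parallel>\<AA> \<Phi>\<^sub>j\<parallel>\<close> stays bounded. Then
  \<open>z = x - \<Sum>\<^sub>j u\<^sub>j \<Phi>\<^sub>j\<close> has the sources \<open>u\<^sub>j \<AA> \<Phi>\<^sub>j - u\<^sub>j' \<Phi>\<^sub>j\<close>, and the contribution of \<open>u'\<close> disappears in
  the limit.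
\<close>

section \<open>Vectors and matrices over the scalar field\<close>

text \<open>The gain may depend on sup |u| alone, and this shapes every estimate. An L^1 bound in
  time is, dually, a bound for pairings with \<Psi> by sup |\<Psi>|. The kernel that occurs is
  \<Psi>(r) = \<integral> \<alpha>(s) \<psi>(s + r) ds: its sup is at most sup |\<alpha>| times the
  mass of \<psi>, but its derivative may be as large as that of \<psi>. Hence no derivative of
  \<Psi> may survive, which forces the multipliers to follow the characteristics.

  The sources lie in L^1 and not in the domain, so their orbits have no trace. They are replaced by
  domain elements close to them in L^1. For fixed \<psi> the replacement error is a multiple of that
  distance and can be made arbitrarily small; \<psi> is concentrated only afterwards. All bounds on
  initial states must therefore use the L^1 norm and not the graph norm.

  Decay beyond boundedness enters through \<integral> C exp(-\<omega> t) dt = C / \<omega>, which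
  makes the constants independent of the time horizon.\<close>

lemma norm_matrix_vector_mult_le:
  fixes A :: "'k::real_normed_field^'n^'m"
  shows "norm (A *v x) \<le> norm A * norm x"
proof -
  have "norm ((A *v x) $ i) \<le> norm (A $ i) * norm x" for i
  proof -
    have "norm ((A *v x) $ i) \<le> (\<Sum>j\<in>UNIV. \<bar>norm (A $ i $ j)\<bar> * \<bar>norm (x $ j)\<bar>)"
      unfolding matrix_vector_mult_def by (simp add: norm_mult sum_norm_le)
    also have "\<dots> \<le> norm (A $ i) * norm x"
      unfolding norm_vec_def by (rule L2_set_mult_ineq)
    finally show ?thesis .
  qed
  then have "norm (A *v x) \<le> L2_set (\<lambda>i. norm (A $ i) * norm x) UNIV"
    unfolding norm_vec_def[of "A *v x"] by (intro L2_set_mono) auto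
  also have "\<dots> = norm A * norm x"
    unfolding norm_vec_def[of A] by (simp add: L2_set_left_distrib)
  finally show ?thesis .
qed

lemma bounded_bilinear_matrix_vector_mult:
  "bounded_bilinear ((*v) :: 'k::real_normed_field^'n^'m \<Rightarrow> 'k^'n \<Rightarrow> 'k^'m)"
proof (unfold_locales)
  show "(a + a') *v b = a *v b + a' *v b" for a a' :: "'k^'n^'m" and b
    by (rule matrix_vector_mult_add_rdistrib)
  show "a *v (b + b') = a *v b + a *v b'" for a :: "'k^'n^'m" and b b'
    by (rule matrix_vector_right_distrib)
  show "(r *\<^sub>R a) *v b = r *\<^sub>R (a *v b)" "a *v (r *\<^sub>R b) = r *\<^sub>R (a *v b)" for r and a :: "'k^'n^'m" and b
    by (simp_all add: vec_eq_iff matrix_vector_mult_def scaleR_sum_right)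
  show "\<exists>K. \<forall>(a :: 'k^'n^'m) b. norm (a *v b) \<le> norm a * norm b * K"
    by (rule exI[of _ 1]) (simp add: norm_matrix_vector_mult_le)
qed

lemmas continuous_on_matrix_vector_mult =
  bounded_bilinear.continuous_on[OF bounded_bilinear_matrix_vector_mult]

text \<open>In finite dimension a bounded bilinear map is jointly continuous, so measurability
  passes through the pair of the two functions.\<close>

lemma borel_measurable_bilinear:
  fixes prod :: "'u::euclidean_space \<Rightarrow> 'v::euclidean_space \<Rightarrow> 'w::euclidean_space"
  assumes "bounded_bilinear prod" "f \<in> borel_measurable M" "g \<in> borel_measurable M"
  shows "(\<lambda>x. prod (f x) (g x)) \<in> borel_measurable M"
proof -
  have "continuous_on UNIV (\<lambda>p. prod (fst p) (snd p))"
    by (intro bounded_bilinear.continuous_on[OF assms(1)] continuous_intros)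
  from borel_measurable_continuous_on[OF this, of "\<lambda>x. (f x, g x)"] assms(2,3)
  show ?thesis by simp
qed

lemma norm_vector_scalar_mult:
  fixes c :: "'k::real_normed_field"
  shows "norm (c *s x) = norm c * norm (x :: 'k^'n)"
  unfolding norm_vec_def by (simp add: norm_mult L2_set_right_distrib)

lemma bounded_bilinear_vector_scalar_mult:
  "bounded_bilinear ((*s) :: 'k::real_normed_field \<Rightarrow> 'k^'n \<Rightarrow> 'k^'n)"
proof (unfold_locales)
  show "(a + a') *s b = a *s b + a' *s b" for a a' :: 'k and b :: "'k^'n"
    by (rule vector_sadd_rdistrib)
  show "a *s (b + b') = a *s b + a *s b'" for a :: 'k and b b' :: "'k^'n"
    by (rule vector_add_ldistrib)
  show "(r *\<^sub>R a) *s b = r *\<^sub>R (a *s b)" "a *s (r *\<^sub>R b) = r *\<^sub>R (a *s b)" for r and a :: 'k and b :: "'k^'n"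
    by (simp_all add: vec_eq_iff)
  show "\<exists>K. \<forall>(a :: 'k) (b :: 'k^'n). norm (a *s b) \<le> norm a * norm b * K"
    by (rule exI[of _ 1]) (simp add: norm_vector_scalar_mult)
qed

lemma stack_vec_add: "stack_vec (u + u') (v + v') = stack_vec u v + stack_vec u' v'"
  by (simp add: stack_vec_def vec_eq_iff split: sum.splits)

lemma stack_vec_diff: 
  fixes u v :: "'k::real_normed_field^'n"
  shows "stack_vec (u - u') (v - v') = stack_vec u v - stack_vec u' v'"
  by (simp add: stack_vec_def vec_eq_iff split: sum.splits)

lemma stack_vec_smult: 
  fixes u v :: "'k::real_normed_field^'n"
  shows "stack_vec (c *s u) (c *s v) = c *s stack_vec u v"
  by (simp add: stack_vec_def vec_eq_iff split: sum.splits)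

lemma stack_vec_0: "stack_vec (0 :: 'k::real_normed_field^'n::finite) 0 = 0"
  by (simp add: stack_vec_def vec_eq_iff split: sum.splits)

lemma stack_vec_surj: "\<exists>u v. p = stack_vec u v"
proof
  show "\<exists>v. p = stack_vec (\<chi> j. p $ Inl j) v"
    by (rule exI[of _ "\<chi> j. p $ Inr j"]) (auto simp: stack_vec_def vec_eq_iff split: sum.splits)
qed

lemma norm_stack_vec_le:
  fixes u v :: "'k::real_normed_field^'n"
  shows "norm (stack_vec u v) \<le> CARD('n) * (norm u + norm v)"
proof -
  have "norm (stack_vec u v) \<le> (\<Sum>i\<in>UNIV. norm (stack_vec u v $ i))"
    unfolding norm_vec_def by (rule L2_set_le_sum) auto
  also have "\<dots> = (\<Sum>i\<in>UNIV. norm (u $ i)) + (\<Sum>i\<in>UNIV. norm (v $ i))"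
    unfolding UNIV_Plus_UNIV[symmetric] Plus_def
    by (subst sum.union_disjoint) (auto simp: sum.reindex stack_vec_def)
  also have "\<dots> \<le> (\<Sum>i\<in>(UNIV::'n set). norm u) + (\<Sum>i\<in>(UNIV::'n set). norm v)"
    by (intro add_mono sum_mono Finite_Cartesian_Product.norm_nth_le)
  finally show ?thesis by (simp add: algebra_simps)
qed

section \<open>The space \<open>L\<^sup>1\<close>\<close>

lemma L1_norm_nonneg: "0 \<le> L1_norm a b f"
  unfolding L1_norm_def by (rule integral_nonneg_AE) auto

lemma L1_space_measurable: "f \<in> L1_space a b \<Longrightarrow> f \<in> borel_measurable (lebesgue_on {a..b})"
  unfolding L1_space_def by auto

lemma L1_space_bound:
  assumes "f \<in> L1_space a b" "g \<in> borel_measurable (lebesgue_on {a..b})"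
    and "AE \<xi> in lebesgue_on {a..b}. norm (g \<xi>) \<le> c * norm (f \<xi>)"
  shows "g \<in> L1_space a b" "L1_norm a b g \<le> c * L1_norm a b f"
proof -
  have *: "integrable (lebesgue_on {a..b}) (\<lambda>\<xi>. c * norm (f \<xi>))"
    using assms(1) unfolding L1_space_def by auto
  have "integrable (lebesgue_on {a..b}) g"
    by (rule Bochner_Integration.integrable_bound[OF * assms(2)]) (use assms(3) in \<open>auto intro: order_trans\<close>)
  then show "g \<in> L1_space a b" unfolding L1_space_def by simp
  have "L1_norm a b g \<le> (LINT \<xi>|lebesgue_on {a..b}. c * norm (f \<xi>))"
    unfolding L1_norm_def
    by (rule integral_mono_AE) (use * \<open>integrable _ g\<close> assms(3) in auto)
  then show "L1_norm a b g \<le> c * L1_norm a b f" by (simp add: L1_norm_def)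
qed

lemma L1_space_add: "f \<in> L1_space a b \<Longrightarrow> g \<in> L1_space a b \<Longrightarrow> (\<lambda>\<xi>. f \<xi> + g \<xi>) \<in> L1_space a b"
  and L1_space_diff: "f \<in> L1_space a b \<Longrightarrow> g \<in> L1_space a b \<Longrightarrow> (\<lambda>\<xi>. f \<xi> - g \<xi>) \<in> L1_space a b"
  and L1_space_scaleR: "f \<in> L1_space a b \<Longrightarrow> (\<lambda>\<xi>. r *\<^sub>R f \<xi>) \<in> L1_space a b"
  and L1_space_0: "(\<lambda>\<xi>. 0) \<in> L1_space a b"
  unfolding L1_space_def by auto

lemma L1_space_sum:
  assumes "\<And>i. i \<in> I \<Longrightarrow> f i \<in> L1_space a b"
  shows "(\<lambda>\<xi>. \<Sum>i\<in>I. f i \<xi>) \<in> L1_space a b"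
  using assms unfolding L1_space_def by auto

lemma L1_space_smult:
  fixes f :: "real \<Rightarrow> 'k::real_or_complex^'n"
  assumes "f \<in> L1_space a b"
  shows "(\<lambda>\<xi>. c *s f \<xi>) \<in> L1_space a b" "L1_norm a b (\<lambda>\<xi>. c *s f \<xi>) = norm c * L1_norm a b f"
proof -
  have "(\<lambda>\<xi>. c *s f \<xi>) \<in> borel_measurable (lebesgue_on {a..b})"
    by (rule borel_measurable_bilinear[OF bounded_bilinear_vector_scalar_mult])
       (use assms L1_space_measurable in auto)
  from L1_space_bound(1)[OF assms this, of "norm c"] show "(\<lambda>\<xi>. c *s f \<xi>) \<in> L1_space a b"
    by (simp add: norm_vector_scalar_mult)
  show "L1_norm a b (\<lambda>\<xi>. c *s f \<xi>) = norm c * L1_norm a b f"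
    by (simp add: L1_norm_def norm_vector_scalar_mult)
qed

lemma L1_norm_scaleR: "L1_norm a b (\<lambda>\<xi>. r *\<^sub>R f \<xi>) = \<bar>r\<bar> * L1_norm a b f"
  by (simp add: L1_norm_def)

lemma L1_norm_0: "L1_norm a b (\<lambda>\<xi>. 0) = 0"
  by (simp add: L1_norm_def)

lemma L1_norm_minus_commute: "L1_norm a b (\<lambda>\<xi>. f \<xi> - g \<xi>) = L1_norm a b (\<lambda>\<xi>. g \<xi> - f \<xi>)"
  by (simp add: L1_norm_def norm_minus_commute)

lemma L1_norm_triangle:
  assumes "f \<in> L1_space a b" "g \<in> L1_space a b"
  shows "L1_norm a b (\<lambda>\<xi>. f \<xi> + g \<xi>) \<le> L1_norm a b f + L1_norm a b g"
proof -
  have "L1_norm a b (\<lambda>\<xi>. f \<xi> + g \<xi>) \<le> (LINT \<xi>|lebesgue_on {a..b}. norm (f \<xi>) + norm (g \<xi>))"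
    unfolding L1_norm_def using assms unfolding L1_space_def
    by (intro integral_mono) (auto simp: norm_triangle_ineq)
  also have "\<dots> = L1_norm a b f + L1_norm a b g"
    using assms unfolding L1_norm_def L1_space_def by (subst Bochner_Integration.integral_add) auto
  finally show ?thesis .
qed

lemma L1_norm_triangle':
  assumes "f \<in> L1_space a b" "g \<in> L1_space a b" "\<And>\<xi>. h \<xi> = f \<xi> + g \<xi>"
  shows "L1_norm a b h \<le> L1_norm a b f + L1_norm a b g"
proof -
  have "h = (\<lambda>\<xi>. f \<xi> + g \<xi>)" using assms(3) by auto
  then show ?thesis using L1_norm_triangle[OF assms(1,2)] by simp
qed

lemma L1_norm_triangle_diff:
  assumes "f \<in> L1_space a b" "g \<in> L1_space a b"
  shows "L1_norm a b (\<lambda>\<xi>. f \<xi> - g \<xi>) \<le> L1_norm a b f + L1_norm a b g"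
  using L1_norm_triangle[OF assms(1) L1_space_scaleR[OF assms(2), of "-1"]]
    L1_norm_scaleR[of a b "-1" g] by simp

lemma L1_norm_triangle3:
  assumes "f \<in> L1_space a b" "g \<in> L1_space a b" "h \<in> L1_space a b"
  shows "L1_norm a b (\<lambda>\<xi>. f \<xi> - h \<xi>) \<le> L1_norm a b (\<lambda>\<xi>. f \<xi> - g \<xi>) + L1_norm a b (\<lambda>\<xi>. g \<xi> - h \<xi>)"
  using L1_norm_triangle'[OF L1_space_diff[OF assms(1,2)] L1_space_diff[OF assms(2,3)],
      of "\<lambda>\<xi>. f \<xi> - h \<xi>"] by simp

lemma L1_norm_sum:
  assumes "finite I" "\<And>i. i \<in> I \<Longrightarrow> f i \<in> L1_space a b"
  shows "L1_norm a b (\<lambda>\<xi>. \<Sum>i\<in>I. f i \<xi>) \<le> (\<Sum>i\<in>I. L1_norm a b (f i))"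
  using assms
proof (induction I)
  case (insert i I)
  have "L1_norm a b (\<lambda>\<xi>. \<Sum>i\<in>insert i I. f i \<xi>) \<le> L1_norm a b (f i) + L1_norm a b (\<lambda>\<xi>. \<Sum>i\<in>I. f i \<xi>)"
    using insert by (intro L1_norm_triangle') (auto intro: L1_space_sum)
  with insert show ?case by (auto intro: order_trans)
qed (simp add: L1_norm_0)

lemma L1_norm_eq_0_iff:
  assumes "f \<in> L1_space a b"
  shows "L1_norm a b f = 0 \<longleftrightarrow> (AE \<xi> in lebesgue_on {a..b}. f \<xi> = 0)"
  unfolding L1_norm_def using assms unfolding L1_space_def
  by (subst integral_nonneg_eq_0_iff_AE) auto

lemma L1_norm_cong_AE:
  assumes "AE \<xi> in lebesgue_on {a..b}. f \<xi> = g \<xi>" "f \<in> L1_space a b" "g \<in> L1_space a b"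
  shows "L1_norm a b f = L1_norm a b g"
  unfolding L1_norm_def
  using assms(1) L1_space_measurable[OF assms(2)] L1_space_measurable[OF assms(3)]
  by (intro integral_cong_AE) auto

lemma L1_integral_bound:
  assumes "f \<in> L1_space a b"
  shows "norm (LINT \<xi>|lebesgue_on {a..b}. f \<xi>) \<le> L1_norm a b f"
  unfolding L1_norm_def by (rule integral_norm_bound)

lemma bilinear_L1:
  fixes prod :: "'u::euclidean_space \<Rightarrow> 'v::euclidean_space \<Rightarrow> 'w::euclidean_space"
  assumes prod: "bounded_bilinear prod" and le: "\<And>x y. norm (prod x y) \<le> norm x * norm y"
    and m: "m \<in> borel_measurable (lebesgue_on {a..b})"
      "AE \<xi> in lebesgue_on {a..b}. norm (m \<xi>) \<le> c" and f: "f \<in> L1_space a b"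
  shows "(\<lambda>\<xi>. prod (m \<xi>) (f \<xi>)) \<in> L1_space a b"
    "L1_norm a b (\<lambda>\<xi>. prod (m \<xi>) (f \<xi>)) \<le> c * L1_norm a b f"
proof -
  have "AE \<xi> in lebesgue_on {a..b}. norm (prod (m \<xi>) (f \<xi>)) \<le> c * norm (f \<xi>)"
    using m(2) by eventually_elim (rule order_trans[OF le mult_right_mono[OF _ norm_ge_zero]])
  from L1_space_bound[OF f borel_measurable_bilinear[OF prod m(1) L1_space_measurable[OF f]] this]
  show "(\<lambda>\<xi>. prod (m \<xi>) (f \<xi>)) \<in> L1_space a b"
    "L1_norm a b (\<lambda>\<xi>. prod (m \<xi>) (f \<xi>)) \<le> c * L1_norm a b f" .
qed

lemma matrix_L1:
  fixes B :: "real \<Rightarrow> 'k::real_or_complex^'n^'m"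
  assumes "B \<in> borel_measurable (lebesgue_on {a..b})"
      "AE \<xi> in lebesgue_on {a..b}. norm (B \<xi>) \<le> c" and f: "f \<in> L1_space a b"
  shows "(\<lambda>\<xi>. B \<xi> *v f \<xi>) \<in> L1_space a b"
    "L1_norm a b (\<lambda>\<xi>. B \<xi> *v f \<xi>) \<le> c * L1_norm a b f"
  using bilinear_L1[OF bounded_bilinear_matrix_vector_mult norm_matrix_vector_mult_le assms] by auto

lemma const_matrix_L1:
  fixes B :: "'k::real_or_complex^'n^'m"
  assumes f: "f \<in> L1_space a b"
  shows "(\<lambda>\<xi>. B *v f \<xi>) \<in> L1_space a b"
    "L1_norm a b (\<lambda>\<xi>. B *v f \<xi>) \<le> norm B * L1_norm a b f"
  using matrix_L1[of "\<lambda>_. B", OF _ _ f, of "norm B"] by auto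

lemma continuous_on_imp_L1:
  assumes "continuous_on {a..b} f"
  shows "f \<in> L1_space a b"
  unfolding L1_space_def using assms by (auto intro: continuous_imp_integrable_real)

lemma L1_norm_le_sup:
  assumes "f \<in> borel_measurable (lebesgue_on {a..b})" "a \<le> b" 
    and "AE \<xi> in lebesgue_on {a..b}. norm (f \<xi>) \<le> c"
  shows "f \<in> L1_space a b" "L1_norm a b f \<le> (b - a) * c"
proof -
  have 1: "(\<lambda>_. 1::real) \<in> L1_space a b" by (rule continuous_on_imp_L1) auto
  have 2: "L1_norm a b (\<lambda>_. 1::real) = b - a"
    using assms(2) by (simp add: L1_norm_def measure_restrict_space)
  from L1_space_bound[OF 1 assms(1), of c] assms(3) 2
  show "f \<in> L1_space a b" "L1_norm a b f \<le> (b - a) * c" by (simp_all add: mult.commute)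
qed

lemma L1_norm_eq_integral:
  assumes "f \<in> L1_space a b"
  shows "L1_norm a b f = integral {a..b} (\<lambda>\<xi>. norm (f \<xi>))"
  unfolding L1_norm_def using assms unfolding L1_space_def
  by (intro lebesgue_integral_eq_integral) auto

text \<open>The radial retraction onto the ball of radius \<open>n\<close>, written with
  \<open>max\<close> so that continuity in \<open>v\<close> needs no case split.\<close>

definition trunc :: "real \<Rightarrow> 'v::real_normed_vector \<Rightarrow> 'v"
  where "trunc n v = inverse (max 1 (norm v / n)) *\<^sub>R v"

lemma trunc_le: "0 < n \<Longrightarrow> norm (trunc n v) \<le> n"
  unfolding trunc_def by (auto simp: field_simps max_def)

lemma trunc_le_norm: "norm (trunc n v) \<le> norm v"
proof -
  have "inverse (max 1 (norm v / n)) \<le> inverse 1"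
    by (intro le_imp_inverse_le) auto
  from mult_right_mono[OF this norm_ge_zero[of v]] show ?thesis
    by (simp add: trunc_def)
qed

lemma trunc_eq: "norm v \<le> n \<Longrightarrow> trunc n v = v"
proof -
  assume "norm v \<le> n"
  then have "norm v / n \<le> 1" using norm_ge_zero[of v] by (cases "n = 0") (auto simp: divide_le_eq_1 simp del: norm_ge_zero)
  then show "trunc n v = v" by (simp add: trunc_def max_def)
qed

lemma continuous_on_trunc:
  "0 < n \<Longrightarrow> continuous_on S g \<Longrightarrow> continuous_on S (\<lambda>x. trunc n (g x))"
  unfolding trunc_def by (intro continuous_intros) (auto simp: max_def)

lemma L1_dominated_convergence:
  fixes f :: "real \<Rightarrow> 'v::euclidean_space"
  assumes "\<And>n. g n \<in> borel_measurable (lebesgue_on {a..b})" "f \<in> borel_measurable (lebesgue_on {a..b})"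
    and "AE x in lebesgue_on {a..b}. (\<lambda>n. g n x) \<longlonglongrightarrow> f x"
    and "\<And>n. AE x in lebesgue_on {a..b}. norm (g n x - f x) \<le> h x"
    and "integrable (lebesgue_on {a..b}) h"
  shows "(\<lambda>n. L1_norm a b (\<lambda>x. g n x - f x)) \<longlonglongrightarrow> 0"
proof -
  have "(\<lambda>n. LINT x|lebesgue_on {a..b}. norm (g n x - f x)) \<longlonglongrightarrow> (LINT x|lebesgue_on {a..b}. 0)"
  proof (rule integral_dominated_convergence[OF _ _ assms(5)])
    show "AE x in lebesgue_on {a..b}. (\<lambda>n. norm (g n x - f x)) \<longlonglongrightarrow> 0"
      using assms(3) by eventually_elim (simp add: LIM_zero tendsto_norm_zero)
  qed (use assms in auto)
  then show ?thesis by (simp add: L1_norm_def)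
qed

text \<open>Three approximations of cost \<open>e/3\<close> each: truncation of the values, passage
  to continuous functions, and Stone-Weierstrass on the compact interval. The truncation supplies
  the dominating bound for the second one.\<close>

lemma L1_polynomial_dense:
  fixes f :: "real \<Rightarrow> 'v::euclidean_space"
  assumes f: "f \<in> L1_space a b" and "a < b" and e: "0 < e"
  shows "\<exists>p. polynomial_function p \<and> L1_norm a b (\<lambda>\<xi>. f \<xi> - p \<xi>) < e"
proof -
  let ?M = "lebesgue_on {a..b}"
  have fm [measurable]: "f \<in> borel_measurable ?M" using f by (rule L1_space_measurable)
  have trm: "(\<lambda>x. trunc n (f x)) \<in> borel_measurable ?M" if "0 < n" for n
    using borel_measurable_continuous_on[OF continuous_on_trunc[OF that continuous_on_id] fm] by simp
  have "(\<lambda>n. L1_norm a b (\<lambda>x. trunc (real (Suc n)) (f x) - f x)) \<longlonglongrightarrow> 0"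
  proof (rule L1_dominated_convergence[OF trm[OF of_nat_0_less_iff[THEN iffD2, OF zero_less_Suc]] fm])
    show "integrable ?M (\<lambda>x. 2 * norm (f x))" using f by (auto simp: L1_space_def)
    show "AE x in ?M. norm (trunc (real (Suc n)) (f x) - f x) \<le> 2 * norm (f x)" for n
    proof (intro AE_I2)
      fix x show "norm (trunc (real (Suc n)) (f x) - f x) \<le> 2 * norm (f x)"
        using norm_triangle_ineq4[of "trunc (real (Suc n)) (f x)" "f x"]
          trunc_le_norm[of "real (Suc n)" "f x"] by simp
    qed
    show "AE x in ?M. (\<lambda>n. trunc (real (Suc n)) (f x)) \<longlonglongrightarrow> f x"
    proof (intro AE_I2 tendsto_eventually)
      fix x
      obtain k where "norm (f x) \<le> real k" using real_arch_simple by blast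
      then have "\<forall>n\<ge>k. trunc (real (Suc n)) (f x) = f x" by (auto intro!: trunc_eq)
      then show "\<forall>\<^sub>F n in sequentially. trunc (real (Suc n)) (f x) = f x"
        unfolding eventually_sequentially by blast
    qed
  qed
  from order_tendstoD(2)[OF this, of "e/3"] e obtain n where
    n: "L1_norm a b (\<lambda>x. trunc (real (Suc n)) (f x) - f x) < e/3"
    unfolding eventually_sequentially by auto
  let ?t = "trunc (real (Suc n))"
  have n0: "0 < real (Suc n)" by simp
  \<comment> \<open>Gauge measurability provides continuous \<open>g k\<close> converging to
    \<open>f\<close> off a negligible set, but without a common bound. Composing with
    \<open>?t\<close> bounds both sides by \<open>Suc n\<close>.\<close>
  have "f measurable_on {a..b}" by (subst measurable_on_iff_borel_measurable) (use fm in auto)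
  then obtain N g where N: "negligible N" and g: "\<And>k. continuous_on UNIV (g k)"
    and lim: "\<And>x. x \<notin> N \<Longrightarrow> (\<lambda>k. g k x) \<longlonglongrightarrow> (if x \<in> {a..b} then f x else 0)"
    unfolding measurable_on_def by blast
  have gc: "continuous_on {a..b} (\<lambda>x. ?t (g k x))" for k
    by (rule continuous_on_trunc[OF n0 continuous_on_subset[OF g]]) auto
  have gL: "(\<lambda>x. ?t (g k x)) \<in> L1_space a b" for k by (rule continuous_on_imp_L1[OF gc])
  have "(\<lambda>k. L1_norm a b (\<lambda>x. ?t (g k x) - ?t (f x))) \<longlonglongrightarrow> 0"
  proof (rule L1_dominated_convergence[OF L1_space_measurable[OF gL] trm[OF n0]])
    show "integrable ?M (\<lambda>x. 2 * real (Suc n))" by (rule continuous_imp_integrable_real) auto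
    show "AE x in ?M. norm (?t (g k x) - ?t (f x)) \<le> 2 * real (Suc n)" for k
    proof (intro AE_I2)
      fix x show "norm (?t (g k x) - ?t (f x)) \<le> 2 * real (Suc n)"
        using norm_triangle_ineq4[of "?t (g k x)" "?t (f x)"]
          trunc_le[of "real (Suc n)" "g k x"] trunc_le[of "real (Suc n)" "f x"] by simp
    qed
    have "AE x in ?M. x \<notin> N"
      using N unfolding negligible_iff_null_sets
      by (auto simp: AE_restrict_space_iff dest: AE_not_in)
    then show "AE x in ?M. (\<lambda>k. ?t (g k x)) \<longlonglongrightarrow> ?t (f x)"
      using AE_space
    proof eventually_elim
      case (elim x)
      then have "(\<lambda>k. g k x) \<longlonglongrightarrow> f x" using lim[of x] by auto
      then show ?case
        using continuous_on_tendsto_compose[OF continuous_on_trunc[OF n0 continuous_on_id, of UNIV]] by auto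
    qed
  qed
  from order_tendstoD(2)[OF this, of "e/3"] e obtain k where
    k: "L1_norm a b (\<lambda>x. ?t (g k x) - ?t (f x)) < e/3"
    unfolding eventually_sequentially by auto
  \<comment> \<open>This uniform error integrates to e/6, strictly below the share
    \<open>e/3\<close>.\<close>
  have "0 < e / (6 * (b - a))" using e \<open>a < b\<close> by simp
  from Stone_Weierstrass_polynomial_function[OF _ gc this, of k]
  obtain p where p: "polynomial_function p"
      "\<And>x. x \<in> {a..b} \<Longrightarrow> norm (?t (g k x) - p x) < e / (6 * (b - a))" by auto
  have pL: "p \<in> L1_space a b"
    by (rule continuous_on_imp_L1[OF continuous_on_polymonial_function[OF p(1)]])
  have tfL: "(\<lambda>x. ?t (f x)) \<in> L1_space a b"
    by (rule L1_space_bound(1)[OF f trm[OF n0], of 1]) (simp add: trunc_le_norm)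
  have "L1_norm a b (\<lambda>x. ?t (g k x) - p x) \<le> (b - a) * (e / (6 * (b - a)))"
    by (rule L1_norm_le_sup(2)[OF L1_space_measurable[OF L1_space_diff[OF gL pL]]])
       (use \<open>a < b\<close> p(2) in \<open>auto intro!: AE_I2 less_imp_le\<close>)
  also have "\<dots> < e/3" using \<open>a < b\<close> e by (simp add: field_simps)
  finally have 3: "L1_norm a b (\<lambda>x. ?t (g k x) - p x) < e/3" .
  have "L1_norm a b (\<lambda>x. f x - p x) \<le> L1_norm a b (\<lambda>x. f x - ?t (f x)) + L1_norm a b (\<lambda>x. ?t (f x) - p x)"
    by (rule L1_norm_triangle3[OF f tfL pL])
  also have "L1_norm a b (\<lambda>x. ?t (f x) - p x)
      \<le> L1_norm a b (\<lambda>x. ?t (f x) - ?t (g k x)) + L1_norm a b (\<lambda>x. ?t (g k x) - p x)"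
    by (rule L1_norm_triangle3[OF tfL gL pL])
  finally have "L1_norm a b (\<lambda>x. f x - p x) < e"
    using n k 3 L1_norm_minus_commute[of a b f "\<lambda>x. ?t (f x)"]
      L1_norm_minus_commute[of a b "\<lambda>x. ?t (f x)" "\<lambda>x. ?t (g k x)"] by linarith
  with p(1) show ?thesis by blast
qed

section \<open>Sobolev functions\<close>

abbreviation sob :: "real \<Rightarrow> real \<Rightarrow> (real \<Rightarrow> 'v::euclidean_space) \<Rightarrow> (real \<Rightarrow> 'v) \<Rightarrow> (real \<Rightarrow> 'v) \<Rightarrow> bool"
  where "sob a b \<equiv> sobolev_W1 a b (L1_space a b)"

lemma L1_integrable_sub:
  assumes "v \<in> L1_space a b" "{c..d} \<subseteq> {a..b}"
  shows "integrable (lebesgue_on {c..d}) v" "v integrable_on {c..d}"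
    "norm (integral {c..d} v) \<le> L1_norm a b v"
proof -
  have "set_integrable lebesgue {a..b} v"
    using assms(1) by (simp add: L1_space_def set_integrable_def integrable_restrict_space)
  then have 1: "set_integrable lebesgue {c..d} v"
    by (rule set_integrable_subset) (use assms in auto)
  then show 2: "integrable (lebesgue_on {c..d}) v"
    by (simp add: set_integrable_def integrable_restrict_space)
  show 3: "v integrable_on {c..d}"
    using 1 by (rule set_lebesgue_integral_eq_integral(1))
  have n: "(\<lambda>x. norm (v x)) integrable_on {a..b}" "(\<lambda>x. norm (v x)) integrable_on {c..d}"
    using \<open>set_integrable lebesgue {a..b} v\<close> 1 absolutely_integrable_on_def by blast+
  have "norm (integral {c..d} v) \<le> integral {c..d} (\<lambda>x. norm (v x))"
    by (rule integral_norm_bound_integral[OF 3 n(2)]) auto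
  also have "\<dots> \<le> integral {a..b} (\<lambda>x. norm (v x))"
    by (rule integral_subset_le[OF assms(2) n(2,1)]) auto
  finally show "norm (integral {c..d} v) \<le> L1_norm a b v"
    by (simp add: L1_norm_eq_integral[OF assms(1)])
qed

lemma sobolev_W1_AE: "sobolev_W1 a b V f w v \<Longrightarrow> AE \<xi> in lebesgue_on {a..b}. f \<xi> = w \<xi>"
  and sobolev_W1_deriv: "sobolev_W1 a b V f w v \<Longrightarrow> v \<in> V"
  unfolding sobolev_W1_def by blast+

text \<open>Passes from the Lebesgue integral of the definition to the gauge integral, for which the
  fundamental theorem and the splitting of intervals are used below.\<close>

lemma sobolev_W1_eq_integral:
  assumes "sob a b f w v" "\<xi> \<in> {a..b}"
  shows "w \<xi> = w a + integral {a..\<xi>} v"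
proof -
  have v: "v \<in> L1_space a b" and w: "w \<xi> = w a + (LINT s|lebesgue_on {a..\<xi>}. v s)"
    using assms unfolding sobolev_W1_def by blast+
  have "integrable (lebesgue_on {a..\<xi>}) v"
    by (rule L1_integrable_sub(1)[OF v]) (use assms(2) in auto)
  from lebesgue_integral_eq_integral[OF this] w show ?thesis by auto
qed

lemma sobolev_W1_I:
  assumes "AE \<xi> in lebesgue_on {a..b}. f \<xi> = w \<xi>" "v \<in> L1_space a b"
    "\<And>\<xi>. \<xi> \<in> {a..b} \<Longrightarrow> w \<xi> = w a + integral {a..\<xi>} v"
  shows "sob a b f w v"
  unfolding sobolev_W1_def
proof (intro conjI ballI assms(1,2))
  fix \<xi> assume \<xi>: "\<xi> \<in> {a..b}"
  have "integrable (lebesgue_on {a..\<xi>}) v"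
    by (rule L1_integrable_sub(1)[OF assms(2)]) (use \<xi> in auto)
  from lebesgue_integral_eq_integral[OF this] assms(3)[OF \<xi>]
  show "w \<xi> = w a + (LINT s|lebesgue_on {a..\<xi>}. v s)" by auto
qed

lemma sobolev_W1_C1:
  assumes "AE \<xi> in lebesgue_on {a..b}. f \<xi> = w \<xi>" "continuous_on {a..b} v"
    "\<And>\<xi>. \<xi> \<in> {a..b} \<Longrightarrow> (w has_vector_derivative v \<xi>) (at \<xi> within {a..b})"
  shows "sob a b f w v"
proof (rule sobolev_W1_I[OF assms(1) continuous_on_imp_L1[OF assms(2)]])
  fix \<xi> assume "\<xi> \<in> {a..b}"
  then have "(v has_integral w \<xi> - w a) {a..\<xi>}"
    by (intro fundamental_theorem_of_calculus)
       (auto intro: has_vector_derivative_within_subset[OF assms(3)])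
  then show "w \<xi> = w a + integral {a..\<xi>} v" by (simp add: integral_unique)
qed

lemma sobolev_W1_continuous:
  assumes "sob a b f w v"
  shows "continuous_on {a..b} w"
proof -
  have "v \<in> L1_space a b" using assms sobolev_W1_deriv by blast
  from indefinite_integral_continuous_1[OF L1_integrable_sub(2)[OF this order_refl]]
  have "continuous_on {a..b} (\<lambda>\<xi>. w a + integral {a..\<xi>} v)" by (intro continuous_intros)
  then show ?thesis
    by (rule continuous_on_eq) (rule sobolev_W1_eq_integral[OF assms, symmetric])
qed

lemma sobolev_W1_diff_le:
  assumes "sob a b f w v" "\<xi> \<in> {a..b}" "\<eta> \<in> {a..b}"
  shows "norm (w \<xi> - w \<eta>) \<le> L1_norm a b v"
proof -
  have *: "norm (w \<xi> - w \<eta>) \<le> L1_norm a b v" if "\<eta> \<le> \<xi>" "\<xi> \<in> {a..b}" "\<eta> \<in> {a..b}" for \<xi> \<eta>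
  proof -
    have v: "v \<in> L1_space a b" using assms sobolev_W1_deriv by blast
    have "integral {a..\<xi>} v = integral {a..\<eta>} v + integral {\<eta>..\<xi>} v"
      using that L1_integrable_sub(2)[OF v, of a \<xi>]
      by (intro Henstock_Kurzweil_Integration.integral_combine[symmetric]) auto
    with sobolev_W1_eq_integral[OF assms(1) that(2)] sobolev_W1_eq_integral[OF assms(1) that(3)] have "w \<xi> - w \<eta> = integral {\<eta>..\<xi>} v" by simp
    then show ?thesis using L1_integrable_sub(3)[OF v, of \<eta> \<xi>] that by auto
  qed
  show ?thesis
    using *[of \<eta> \<xi>] *[of \<xi> \<eta>] assms by (cases "\<eta> \<le> \<xi>") (auto simp: norm_minus_commute)
qed

text \<open>The embedding of W^{1,1} into the continuous functions: \<open>w \<xi>\<close> differs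
  from each \<open>w \<eta>\<close> by at most the L^1 norm of the derivative, and averaging over
  \<eta> replaces \<open>w \<eta>\<close> by the mean of |f|.\<close>

lemma sobolev_W1_sup_le:
  assumes "sob a b f w v" "f \<in> L1_space a b" "\<xi> \<in> {a..b}" "a < b"
  shows "norm (w \<xi>) \<le> L1_norm a b f / (b - a) + L1_norm a b v"
proof -
  have w: "w \<in> L1_space a b" by (rule continuous_on_imp_L1[OF sobolev_W1_continuous[OF assms(1)]])
  have "AE \<xi> in lebesgue_on {a..b}. f \<xi> = w \<xi>" using assms(1) by (rule sobolev_W1_AE)
  from L1_norm_cong_AE[OF this assms(2) w] have N: "L1_norm a b f = L1_norm a b w" .
  have "integral {a..b} (\<lambda>\<eta>. norm (w \<xi>)) \<le> integral {a..b} (\<lambda>\<eta>. norm (w \<eta>) + L1_norm a b v)"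
  proof (rule integral_le)
    show "(\<lambda>\<eta>. norm (w \<eta>) + L1_norm a b v) integrable_on {a..b}"
      by (intro integrable_continuous_real continuous_intros sobolev_W1_continuous[OF assms(1)])
    fix \<eta> assume "\<eta> \<in> {a..b}"
    with sobolev_W1_diff_le[OF assms(1,3) this] norm_triangle_sub[of "w \<xi>" "w \<eta>"]
    show "norm (w \<xi>) \<le> norm (w \<eta>) + L1_norm a b v" by simp
  qed auto
  also have "\<dots> = L1_norm a b w + (b - a) * L1_norm a b v"
    using assms(4)
    by (subst Henstock_Kurzweil_Integration.integral_add)
       (auto simp: L1_norm_eq_integral[OF w]
         intro!: integrable_continuous_real continuous_intros sobolev_W1_continuous[OF assms(1)])
  finally show ?thesis using assms(4) N by (simp add: field_simps)
qed

lemma continuous_AE_0_imp_0: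
  fixes w :: "real \<Rightarrow> 'v::euclidean_space"
  assumes "continuous_on {a..b} w" "AE \<xi> in lebesgue_on {a..b}. w \<xi> = 0" "a < b" "\<xi> \<in> {a..b}"
  shows "w \<xi> = 0"
proof -
  have w: "w \<in> L1_space a b" by (rule continuous_on_imp_L1[OF assms(1)])
  have "integral {a..b} (\<lambda>\<xi>. norm (w \<xi>)) = 0"
    using L1_norm_eq_0_iff[OF w] L1_norm_eq_integral[OF w] assms(2) by simp
  then show ?thesis
    using integral_eq_0_iff[OF continuous_on_norm[OF assms(1)] assms(3)] assms(4) by auto
qed

text \<open>Makes boundary values well defined: continuous representatives of one class agree
  everywhere on a nondegenerate interval.\<close>

lemma sobolev_W1_unique:
  assumes "sob a b f w v" "sob a b g w' v'" "AE \<xi> in lebesgue_on {a..b}. f \<xi> = g \<xi>"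
    and "a < b" "\<xi> \<in> {a..b}"
  shows "w \<xi> = w' \<xi>"
proof -
  have "AE \<xi> in lebesgue_on {a..b}. w \<xi> - w' \<xi> = 0"
  proof -
    have "AE \<xi> in lebesgue_on {a..b}. f \<xi> = w \<xi>" "AE \<xi> in lebesgue_on {a..b}. g \<xi> = w' \<xi>"
      using assms sobolev_W1_AE by blast+
    with assms(3) show ?thesis by eventually_elim simp
  qed
  from continuous_AE_0_imp_0[OF _ this assms(4,5)] show ?thesis
    using sobolev_W1_continuous[OF assms(1)] sobolev_W1_continuous[OF assms(2)]
    by (auto intro: continuous_intros)
qed

lemma sobolev_W1_add:
  assumes "sob a b f w v" "sob a b g w' v'"
  shows "sob a b (\<lambda>\<xi>. f \<xi> + g \<xi>) (\<lambda>\<xi>. w \<xi> + w' \<xi>) (\<lambda>\<xi>. v \<xi> + v' \<xi>)"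
proof (rule sobolev_W1_I)
  have v: "v \<in> L1_space a b" "v' \<in> L1_space a b" using assms sobolev_W1_deriv by blast+
  then show "(\<lambda>\<xi>. v \<xi> + v' \<xi>) \<in> L1_space a b" by (rule L1_space_add)
  have "AE \<xi> in lebesgue_on {a..b}. f \<xi> = w \<xi>" "AE \<xi> in lebesgue_on {a..b}. g \<xi> = w' \<xi>"
    using assms sobolev_W1_AE by blast+
  then show "AE \<xi> in lebesgue_on {a..b}. f \<xi> + g \<xi> = w \<xi> + w' \<xi>" by eventually_elim simp
  fix \<xi> assume x: "\<xi> \<in> {a..b}"
  have "v integrable_on {a..\<xi>}" "v' integrable_on {a..\<xi>}" using v x by (auto intro: L1_integrable_sub(2))
  then show "w \<xi> + w' \<xi> = w a + w' a + integral {a..\<xi>} (\<lambda>\<xi>. v \<xi> + v' \<xi>)"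
    using sobolev_W1_eq_integral[OF assms(1) x] sobolev_W1_eq_integral[OF assms(2) x]
    by (simp add: Henstock_Kurzweil_Integration.integral_add)
qed

lemma sobolev_W1_smult:
  fixes f :: "real \<Rightarrow> 'k::real_or_complex^'n"
  assumes "sob a b f w v"
  shows "sob a b (\<lambda>\<xi>. c *s f \<xi>) (\<lambda>\<xi>. c *s w \<xi>) (\<lambda>\<xi>. c *s v \<xi>)"
proof (rule sobolev_W1_I)
  have v: "v \<in> L1_space a b" using assms sobolev_W1_deriv by blast+
  then show "(\<lambda>\<xi>. c *s v \<xi>) \<in> L1_space a b" by (rule L1_space_smult(1))
  have "AE \<xi> in lebesgue_on {a..b}. f \<xi> = w \<xi>"
    using assms by (rule sobolev_W1_AE)
  then show "AE \<xi> in lebesgue_on {a..b}. c *s f \<xi> = c *s w \<xi>" by eventually_elim simp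
  fix \<xi> assume x: "\<xi> \<in> {a..b}"
  have "v integrable_on {a..\<xi>}" using v x by (auto intro: L1_integrable_sub(2))
  then have "integral {a..\<xi>} (\<lambda>\<xi>. c *s v \<xi>) = c *s integral {a..\<xi>} v"
    using integral_linear[OF _ bounded_bilinear.bounded_linear_right[OF bounded_bilinear_vector_scalar_mult], of v "{a..\<xi>}" c]
    by (simp add: o_def)
  then show "c *s w \<xi> = c *s w a + integral {a..\<xi>} (\<lambda>\<xi>. c *s v \<xi>)"
    using sobolev_W1_eq_integral[OF assms(1) x] by (simp add: vector_add_ldistrib)
qed

lemma continuous_on_Icc_bounded:
  fixes m :: "real \<Rightarrow> 'v::real_normed_vector"
  assumes "continuous_on {a..b} m"
  shows "\<exists>K>0. \<forall>\<xi>\<in>{a..b}. norm (m \<xi>) \<le> K"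
  using compact_imp_bounded[OF compact_continuous_image[OF assms compact_Icc]]
  by (auto simp: bounded_pos)

text \<open>The derivative \<open>v\<close> is only integrable, so it is replaced by a polynomial
  \<open>p\<close>, for which the classical product rule holds. Both sides change by at most a
  constant times the L^1 distance of \<open>v\<close> and \<open>p\<close>.\<close>

lemma sobolev_W1_by_parts:
  fixes prod :: "'u::euclidean_space \<Rightarrow> 'v::euclidean_space \<Rightarrow> 'w::euclidean_space"
  assumes prod: "bounded_bilinear prod" and le: "\<And>x y. norm (prod x y) \<le> norm x * norm y"
    and sob: "sob a b f w v" and "a < b" and m'c: "continuous_on {a..b} m'"
    and m: "\<And>\<xi>. \<xi> \<in> {a..b} \<Longrightarrow> (m has_vector_derivative m' \<xi>) (at \<xi> within {a..b})"
  shows "(LINT \<xi>|lebesgue_on {a..b}. prod (m \<xi>) (v \<xi>))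
    = prod (m b) (w b) - prod (m a) (w a) - (LINT \<xi>|lebesgue_on {a..b}. prod (m' \<xi>) (w \<xi>))" (is "?l = ?r")
proof -
  interpret bounded_bilinear prod by fact
  have mc: "continuous_on {a..b} m"
    unfolding continuous_on_eq_continuous_within
    by (blast intro: has_vector_derivative_continuous m)
  obtain K where K: "\<And>\<xi>. \<xi> \<in> {a..b} \<Longrightarrow> norm (m \<xi>) \<le> K" "0 < K"
    using continuous_on_Icc_bounded[OF mc] by blast
  obtain K' where K': "\<And>\<xi>. \<xi> \<in> {a..b} \<Longrightarrow> norm (m' \<xi>) \<le> K'" "0 < K'"
    using continuous_on_Icc_bounded[OF m'c] by blast
  have mm: "m \<in> borel_measurable (lebesgue_on {a..b})" "m' \<in> borel_measurable (lebesgue_on {a..b})"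
    by (intro L1_space_measurable continuous_on_imp_L1 mc m'c)+
  have v: "v \<in> L1_space a b" using sob by (rule sobolev_W1_deriv)
  have wc: "continuous_on {a..b} w" by (rule sobolev_W1_continuous[OF sob])
  have mK: "AE \<xi> in lebesgue_on {a..b}. norm (m \<xi>) \<le> K" "AE \<xi> in lebesgue_on {a..b}. norm (m' \<xi>) \<le> K'"
    by (auto intro!: AE_I2 K(1) K'(1))
  have *: "norm (?l - ?r) \<le> (2 * K + K' * (b - a)) * e" if e: "0 < e" for e
  proof -
    obtain p where p: "polynomial_function p" "L1_norm a b (\<lambda>\<xi>. v \<xi> - p \<xi>) < e"
      using L1_polynomial_dense[OF v \<open>a < b\<close> e] by blast
    \<comment> \<open>Starting the antiderivative at \<open>w a\<close> removes the boundary error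
      at \<open>a\<close>. The one at \<open>b\<close>, together with the error in \<open>v\<close>,
      gives the coefficient \<open>2 * K\<close>.\<close>
    define q where "q \<xi> = w a + integral {a..\<xi>} p" for \<xi>
    have pc: "continuous_on {a..b} p" using p(1) by (rule continuous_on_polymonial_function)
    have q': "(q has_vector_derivative p \<xi>) (at \<xi> within {a..b})" if "\<xi> \<in> {a..b}" for \<xi>
      unfolding q_def using integral_has_vector_derivative[OF pc that]
      by (auto intro!: derivative_eq_intros)
    have qc: "continuous_on {a..b} q"
      unfolding continuous_on_eq_continuous_within
      by (blast intro: has_vector_derivative_continuous q')
    have pL: "p \<in> L1_space a b" by (rule continuous_on_imp_L1[OF pc])
    have qw: "norm (q \<xi> - w \<xi>) \<le> e" if "\<xi> \<in> {a..b}" for \<xi>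
    proof -
      have "integral {a..\<xi>} p - integral {a..\<xi>} v = integral {a..\<xi>} (\<lambda>\<xi>. p \<xi> - v \<xi>)"
        using that L1_integrable_sub(2)[OF pL] L1_integrable_sub(2)[OF v]
        by (intro Henstock_Kurzweil_Integration.integral_diff[symmetric]) auto
      moreover have "norm (integral {a..\<xi>} (\<lambda>\<xi>. p \<xi> - v \<xi>)) \<le> L1_norm a b (\<lambda>\<xi>. p \<xi> - v \<xi>)"
        using that by (intro L1_integrable_sub(3)[OF L1_space_diff[OF pL v]]) auto
      ultimately show ?thesis
        using p(2) L1_norm_minus_commute[of a b p v] sobolev_W1_eq_integral[OF sob that]
        by (simp add: q_def)
    qed
    have "((\<lambda>\<xi>. prod (m \<xi>) (p \<xi>) + prod (m' \<xi>) (q \<xi>)) has_integral prod (m b) (q b) - prod (m a) (q a)) {a..b}"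
      by (intro fundamental_theorem_of_calculus has_vector_derivative m q') (use \<open>a < b\<close> in auto)
    moreover have "(\<lambda>\<xi>. prod (m \<xi>) (p \<xi>) + prod (m' \<xi>) (q \<xi>)) \<in> L1_space a b"
      by (intro continuous_on_imp_L1 continuous_intros continuous_on mc m'c pc qc)
    ultimately have eq: "(LINT \<xi>|lebesgue_on {a..b}. prod (m \<xi>) (p \<xi>) + prod (m' \<xi>) (q \<xi>))
        = prod (m b) (q b) - prod (m a) (q a)"
      by (simp add: L1_space_def lebesgue_integral_eq_integral integral_unique)
    have mp: "(\<lambda>\<xi>. prod (m \<xi>) (p \<xi>)) \<in> L1_space a b" "(\<lambda>\<xi>. prod (m' \<xi>) (q \<xi>)) \<in> L1_space a b"
        "(\<lambda>\<xi>. prod (m' \<xi>) (w \<xi>)) \<in> L1_space a b"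
      by (intro continuous_on_imp_L1 continuous_on mc m'c pc qc wc)+
    have mv: "(\<lambda>\<xi>. prod (m \<xi>) (v \<xi>)) \<in> L1_space a b"
      by (rule bilinear_L1(1)[OF prod le mm(1) mK(1) v])
    have "?l - ?r = (LINT \<xi>|lebesgue_on {a..b}. prod (m \<xi>) (v \<xi> - p \<xi>))
        - (LINT \<xi>|lebesgue_on {a..b}. prod (m' \<xi>) (q \<xi> - w \<xi>)) + prod (m b) (q b - w b)"
    proof -
      have "(LINT \<xi>|lebesgue_on {a..b}. prod (m \<xi>) (v \<xi> - p \<xi>))
        = ?l - (LINT \<xi>|lebesgue_on {a..b}. prod (m \<xi>) (p \<xi>))"
        unfolding diff_right using mv mp unfolding L1_space_def
        by (intro Bochner_Integration.integral_diff) auto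
      moreover have "(LINT \<xi>|lebesgue_on {a..b}. prod (m' \<xi>) (q \<xi> - w \<xi>))
        = (LINT \<xi>|lebesgue_on {a..b}. prod (m' \<xi>) (q \<xi>)) - (LINT \<xi>|lebesgue_on {a..b}. prod (m' \<xi>) (w \<xi>))"
        unfolding diff_right using mp unfolding L1_space_def
        by (intro Bochner_Integration.integral_diff) auto
      moreover have "(LINT \<xi>|lebesgue_on {a..b}. prod (m \<xi>) (p \<xi>) + prod (m' \<xi>) (q \<xi>))
        = (LINT \<xi>|lebesgue_on {a..b}. prod (m \<xi>) (p \<xi>)) + (LINT \<xi>|lebesgue_on {a..b}. prod (m' \<xi>) (q \<xi>))"
        using mp unfolding L1_space_def by (intro Bochner_Integration.integral_add) auto
      moreover have "q a = w a" by (simp add: q_def)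
      moreover from calculation eq have "prod (m b) (q b) = (LINT \<xi>|lebesgue_on {a..b}. prod (m \<xi>) (p \<xi>))
          + (LINT \<xi>|lebesgue_on {a..b}. prod (m' \<xi>) (q \<xi>)) + prod (m a) (w a)"
        by (metis diff_add_cancel)
      ultimately show ?thesis by (simp only: diff_right) simp
    qed
    also have "norm \<dots> \<le> K * e + K' * ((b - a) * e) + K * e"
    proof (rule order_trans[OF norm_triangle_ineq add_mono[OF order_trans[OF norm_triangle_ineq4 add_mono]]])
      have d: "(\<lambda>\<xi>. v \<xi> - p \<xi>) \<in> L1_space a b" by (rule L1_space_diff[OF v pL])
      have "norm (LINT \<xi>|lebesgue_on {a..b}. prod (m \<xi>) (v \<xi> - p \<xi>)) \<le> K * L1_norm a b (\<lambda>\<xi>. v \<xi> - p \<xi>)"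
        by (rule order_trans[OF L1_integral_bound[OF bilinear_L1(1)[OF prod le mm(1) mK(1) d]]
              bilinear_L1(2)[OF prod le mm(1) mK(1) d]])
      also have "\<dots> \<le> K * e" using K(2) p(2) by simp
      finally show "norm (LINT \<xi>|lebesgue_on {a..b}. prod (m \<xi>) (v \<xi> - p \<xi>)) \<le> K * e" .
      have d: "(\<lambda>\<xi>. q \<xi> - w \<xi>) \<in> L1_space a b"
        by (intro continuous_on_imp_L1 continuous_intros qc wc)
      have "norm (LINT \<xi>|lebesgue_on {a..b}. prod (m' \<xi>) (q \<xi> - w \<xi>)) \<le> K' * L1_norm a b (\<lambda>\<xi>. q \<xi> - w \<xi>)"
        by (rule order_trans[OF L1_integral_bound[OF bilinear_L1(1)[OF prod le mm(2) mK(2) d]]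
              bilinear_L1(2)[OF prod le mm(2) mK(2) d]])
      also have "\<dots> \<le> K' * ((b - a) * e)"
        using K'(2) qw \<open>a < b\<close>
        by (intro mult_left_mono L1_norm_le_sup(2)[OF L1_space_measurable[OF d]] AE_I2) auto
      finally show "norm (LINT \<xi>|lebesgue_on {a..b}. prod (m' \<xi>) (q \<xi> - w \<xi>)) \<le> K' * ((b - a) * e)" .
      show "norm (prod (m b) (q b - w b)) \<le> K * e"
        using K qw[of b] \<open>a < b\<close> by (intro order_trans[OF le mult_mono]) auto
    qed
    finally show ?thesis by (simp add: algebra_simps)
  qed
  have "norm (?l - ?r) \<le> 0"
  proof (rule field_le_epsilon)
    fix e :: real assume "0 < e"
    have c: "0 < 2 * K + K' * (b - a)" using K K' \<open>a < b\<close> by (simp add: add_pos_pos)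
    show "norm (?l - ?r) \<le> 0 + e"
      using *[of "e / (2 * K + K' * (b - a))"] \<open>0 < e\<close> c by simp
  qed
  then show ?thesis by simp
qed

section \<open>The Hermitian form\<close>

text \<open>The class describes \<open>kcnj\<close> through its product with the argument. Solved
  for \<open>kcnj\<close>, this yields its norm and, by division of measurable functions, its
  measurability.\<close>

lemma kcnj_eq_divide: "kcnj (x :: 'k::real_or_complex) = of_real ((norm x)\<^sup>2) / x"
proof (cases "x = 0")
  case False
  then show ?thesis
    using kcnj_mult_self[of x] by (simp add: nonzero_eq_divide_eq scaleR_conv_of_real)
qed (simp add: kcnj_zero)

lemma norm_kcnj: "norm (kcnj (x :: 'k::real_or_complex)) = norm x"
  by (simp add: kcnj_eq_divide norm_divide norm_mult power2_eq_square)

lemma norm_herm_prod_le: "norm (herm_prod u v) \<le> norm u * norm v"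
proof -
  have "norm (herm_prod u v) \<le> (\<Sum>j\<in>UNIV. \<bar>norm (u $ j)\<bar> * \<bar>norm (v $ j)\<bar>)"
    unfolding herm_prod_def by (simp add: norm_mult norm_kcnj sum_norm_le)
  also have "\<dots> \<le> norm u * norm v" unfolding norm_vec_def by (rule L2_set_mult_ineq)
  finally show ?thesis .
qed

lemma herm_prod_self: "herm_prod v v = of_real ((norm v)\<^sup>2)"
proof -
  have "(norm v)\<^sup>2 = (\<Sum>i\<in>UNIV. (norm (v $ i))\<^sup>2)"
    unfolding norm_vec_def L2_set_def by (simp add: sum_nonneg)
  then show ?thesis
    unfolding herm_prod_def by (simp add: kcnj_mult_self scaleR_conv_of_real del: of_real_power)
qed

lemma mat_mult_vec: "mat c *v v = c *s (v :: 'k::comm_ring_1^'n)"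
  by (simp add: vec_eq_iff matrix_vector_mult_def mat_def if_distrib if_distribR cong: if_cong)

lemma loewner_le_mat_herm_prod:
  fixes H :: "'k::real_or_complex^'n^'n"
  assumes "loewner_le (mat (of_real c)) H"
  shows "\<exists>r\<ge>c * (norm v)\<^sup>2. herm_prod v (H *v v) = of_real r"
proof -
  obtain r where r: "r \<ge> 0" "herm_prod v ((H - mat (of_real c)) *v v) = of_real r"
    using assms unfolding loewner_le_def by blast
  have "herm_prod v ((H - mat (of_real c)) *v v)
      = herm_prod v (H *v v) - of_real c * herm_prod v v"
    by (simp add: herm_prod_def matrix_vector_mult_diff_rdistrib mat_mult_vec right_diff_distrib
        sum_subtractf sum_distrib_left mult.left_commute)
  with r(2) have "herm_prod v (H *v v) = of_real (r + c * (norm v)\<^sup>2)"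
    by (simp add: herm_prod_self algebra_simps)
  with r(1) show ?thesis by (intro exI[of _ "r + c * (norm v)\<^sup>2"]) simp
qed

text \<open>Coercivity of the form combined with Cauchy-Schwarz. The lower bound gives invertibility
  of \<open>H\<close> and an estimate for solutions of \<open>H *v f = w\<close>.\<close>

lemma loewner_le_mat_norm:
  fixes H :: "'k::real_or_complex^'n^'n"
  assumes "loewner_le (mat (of_real c)) H" "0 < c"
  shows "c * norm v \<le> norm (H *v v)"
proof (cases "v = 0")
  case False
  obtain r where r: "r \<ge> c * (norm v)\<^sup>2" "herm_prod v (H *v v) = of_real r"
    using loewner_le_mat_herm_prod[OF assms(1)] by blast
  have "c * (norm v)\<^sup>2 \<le> norm (herm_prod v (H *v v))" using r by simp
  also have "\<dots> \<le> norm v * norm (H *v v)" by (rule norm_herm_prod_le)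
  finally show ?thesis using False by (simp add: power2_eq_square)
qed simp

section \<open>Measurable solution of linear systems\<close>

lemma det_measurable:
  fixes A :: "'x \<Rightarrow> 'k::real_or_complex^'n^'n"
  assumes "\<And>i j. (\<lambda>x. A x $ i $ j) \<in> borel_measurable M"
  shows "(\<lambda>x. det (A x)) \<in> borel_measurable M"
  unfolding det_def
  by (intro borel_measurable_sum borel_measurable_times borel_measurable_const borel_measurable_prod assms)

lemma measurable_vec_nth:
  fixes f :: "'x \<Rightarrow> 'v::euclidean_space^'n"
  assumes "f \<in> borel_measurable M"
  shows "(\<lambda>x. f x $ i) \<in> borel_measurable M"
  by (rule borel_measurable_continuous_on[OF _ assms]) (intro continuous_intros)

lemma measurable_vec_lambda:
  fixes f :: "'x \<Rightarrow> 'n::finite \<Rightarrow> 'v::euclidean_space"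
  assumes "\<And>i. (\<lambda>x. f x i) \<in> borel_measurable M"
  shows "(\<lambda>x. \<chi> i. f x i) \<in> borel_measurable M"
proof (subst borel_measurable_euclidean_space, intro ballI)
  fix b :: "'v^'n" assume "b \<in> Basis"
  then obtain i e where "b = axis i e" "e \<in> Basis" by (auto simp: Basis_vec_def)
  then show "(\<lambda>x. (\<chi> i. f x i) \<bullet> b) \<in> borel_measurable M"
    using assms by (simp add: inner_axis)
qed

text \<open>Cramer's rule writes the solution as quotients of determinants, hence measurably in
  \<open>x\<close>. Where the matrix is singular, division by zero yields some value about which
  nothing is claimed.\<close>

lemma measurable_linear_solution:
  fixes A :: "'x \<Rightarrow> 'k::real_or_complex^'n^'n"
  assumes A: "A \<in> borel_measurable M" and w: "w \<in> borel_measurable M"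
  obtains f where "f \<in> borel_measurable M" "\<And>x. invertible (A x) \<Longrightarrow> A x *v f x = w x"
proof
  let ?f = "\<lambda>x. \<chi> k. det (\<chi> i j. if j = k then w x $ i else A x $ i $ j) / det (A x)"
  show "?f \<in> borel_measurable M"
    by (intro measurable_vec_lambda borel_measurable_divide det_measurable)
       (simp_all add: measurable_vec_nth A w measurable_If)
  show "A x *v ?f x = w x" if "invertible (A x)" for x
    using cramer[of "A x" "?f x" "w x"] that by (simp add: invertible_det_nz)
qed

section \<open>The hyperbolic operator\<close>

lemma L2_space_scaleR: "f \<in> L2_space a b \<Longrightarrow> (\<lambda>\<xi>. r *\<^sub>R f \<xi>) \<in> L2_space a b"
  by (auto simp: L2_space_def power_mult_distrib)

lemma L2_space_diff:
  assumes "f \<in> L2_space a b" "g \<in> L2_space a b"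
  shows "(\<lambda>\<xi>. f \<xi> - g \<xi>) \<in> L2_space a b"
proof -
  have fg: "f \<in> borel_measurable (lebesgue_on {a..b})" "g \<in> borel_measurable (lebesgue_on {a..b})"
    and i: "integrable (lebesgue_on {a..b}) (\<lambda>\<xi>. 2 * (norm (f \<xi>))\<^sup>2 + 2 * (norm (g \<xi>))\<^sup>2)"
    using assms by (auto simp: L2_space_def)
  have "(norm (f \<xi> - g \<xi>))\<^sup>2 \<le> 2 * (norm (f \<xi>))\<^sup>2 + 2 * (norm (g \<xi>))\<^sup>2" for \<xi>
  proof -
    have "(norm (f \<xi> - g \<xi>))\<^sup>2 \<le> (norm (f \<xi>) + norm (g \<xi>))\<^sup>2"
      by (intro power_mono norm_triangle_ineq4) simp
    moreover have "0 \<le> (norm (f \<xi>) - norm (g \<xi>))\<^sup>2" by simp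
    ultimately show ?thesis by (simp add: power2_sum power2_diff)
  qed
  then have "integrable (lebesgue_on {a..b}) (\<lambda>\<xi>. (norm (f \<xi> - g \<xi>))\<^sup>2)"
    by (intro Bochner_Integration.integrable_bound[OF i]) (use fg in auto)
  with fg show ?thesis by (simp add: L2_space_def)
qed

text \<open>Classical solutions live in L^2, the stable semigroup in L^1; on a bounded interval |f|
  \<le> 1 + |f|^2 embeds the first space into the second.\<close>

lemma L2_imp_L1:
  assumes "f \<in> L2_space a b" "a \<le> b"
  shows "f \<in> L1_space a b"
proof -
  have f: "f \<in> borel_measurable (lebesgue_on {a..b})" "integrable (lebesgue_on {a..b}) (\<lambda>\<xi>. (norm (f \<xi>))\<^sup>2)"
    using assms by (auto simp: L2_space_def)
  have 1: "integrable (lebesgue_on {a..b}) (\<lambda>\<xi>. 1::real)"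
    by (rule continuous_imp_integrable_real) auto
  have "norm (f \<xi>) \<le> norm (1 + (norm (f \<xi>))\<^sup>2)" for \<xi>
  proof -
    have "0 \<le> (norm (f \<xi>) - 1)\<^sup>2 + (norm (f \<xi>))\<^sup>2" by simp
    then have "2 * norm (f \<xi>) \<le> 1 + 2 * (norm (f \<xi>))\<^sup>2" by (simp add: power2_diff)
    then show ?thesis using zero_le_power2[of "norm (f \<xi>)"] by auto
  qed
  then show ?thesis unfolding L1_space_def
    using Bochner_Integration.integrable_bound[OF Bochner_Integration.integrable_add[OF 1 f(2)] f(1)] by auto
qed

lemma sobolev_W1_mono: "sobolev_W1 a b V f w v \<Longrightarrow> V \<subseteq> V' \<Longrightarrow> sobolev_W1 a b V' f w v"
  unfolding sobolev_W1_def by blast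

lemma hyp_op_mono: "hyp_op a b V P1 P0 H f w g \<Longrightarrow> V \<subseteq> V' \<Longrightarrow> hyp_op a b V' P1 P0 H f w g"
  unfolding hyp_op_def using sobolev_W1_mono by blast

section \<open>Powers of affine ramps\<close>

lemma ramp_deriv:
  assumes "a < (b::real)"
  shows "((\<lambda>\<xi>. ((\<xi> - a) / (b - a)) ^ Suc k) has_real_derivative
      real (Suc k) / (b - a) * ((\<xi> - a) / (b - a)) ^ k) (at \<xi> within S)"
    "((\<lambda>\<xi>. ((b - \<xi>) / (b - a)) ^ Suc k) has_real_derivative
      - (real (Suc k) / (b - a)) * ((b - \<xi>) / (b - a)) ^ k) (at \<xi> within S)"
proof -
  have d: "((\<lambda>\<xi>. (\<xi> - a) / (b - a)) has_real_derivative 1 / (b - a)) (at \<xi> within S)"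
    "((\<lambda>\<xi>. (b - \<xi>) / (b - a)) has_real_derivative - 1 / (b - a)) (at \<xi> within S)"
    using DERIV_cdivide[OF DERIV_diff[OF DERIV_ident DERIV_const]]
      DERIV_cdivide[OF DERIV_diff[OF DERIV_const DERIV_ident]] by fastforce+
  from DERIV_power[OF d(1), of "Suc k"]
  show "((\<lambda>\<xi>. ((\<xi> - a) / (b - a)) ^ Suc k) has_real_derivative
      real (Suc k) / (b - a) * ((\<xi> - a) / (b - a)) ^ k) (at \<xi> within S)"
    by (rule DERIV_cong) simp
  from DERIV_power[OF d(2), of "Suc k"]
  show "((\<lambda>\<xi>. ((b - \<xi>) / (b - a)) ^ Suc k) has_real_derivative
      - (real (Suc k) / (b - a)) * ((b - \<xi>) / (b - a)) ^ k) (at \<xi> within S)"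
    by (rule DERIV_cong) simp
qed

lemma has_integral_power_affine:
  assumes "a < b"
  shows "((\<lambda>\<xi>. ((\<xi> - a) / (b - a)) ^ k) has_integral (b - a) / real (Suc k)) {a..b}"
    "((\<lambda>\<xi>. ((b - \<xi>) / (b - a)) ^ k) has_integral (b - a) / real (Suc k)) {a..b}"
proof -
  have "((\<lambda>\<xi>. ((\<xi> - a) / (b - a)) ^ k) has_integral
      (b - a) / real (Suc k) * ((b - a) / (b - a)) ^ Suc k - (b - a) / real (Suc k) * ((a - a) / (b - a)) ^ Suc k) {a..b}"
    using assms ramp_deriv(1)[OF assms, of k, THEN DERIV_cmult, of "(b - a) / real (Suc k)"]
    by (intro fundamental_theorem_of_calculus)
       (auto simp: has_real_derivative_iff_has_vector_derivative[symmetric] simp del: power_Suc of_nat_Suc)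
  then show "((\<lambda>\<xi>. ((\<xi> - a) / (b - a)) ^ k) has_integral (b - a) / real (Suc k)) {a..b}"
    using assms by simp
  have "((\<lambda>\<xi>. ((b - \<xi>) / (b - a)) ^ k) has_integral
      - ((b - a) / real (Suc k)) * ((b - b) / (b - a)) ^ Suc k - - ((b - a) / real (Suc k)) * ((b - a) / (b - a)) ^ Suc k) {a..b}"
    using assms ramp_deriv(2)[OF assms, of k, THEN DERIV_cmult, of "- ((b - a) / real (Suc k))"]
    by (intro fundamental_theorem_of_calculus)
       (auto simp: has_real_derivative_iff_has_vector_derivative[symmetric] simp del: power_Suc of_nat_Suc)
  then show "((\<lambda>\<xi>. ((b - \<xi>) / (b - a)) ^ k) has_integral (b - a) / real (Suc k)) {a..b}"
    using assms by simp
qed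

lemma L1_norm_power_affine:
  fixes p :: "'v::euclidean_space"
  assumes "a < b"
  shows "L1_norm a b (\<lambda>\<xi>. ((\<xi> - a) / (b - a)) ^ k *\<^sub>R p) = (b - a) / real (Suc k) * norm p"
    "L1_norm a b (\<lambda>\<xi>. ((b - \<xi>) / (b - a)) ^ k *\<^sub>R p) = (b - a) / real (Suc k) * norm p"
proof -
  have "integral {a..b} (\<lambda>\<xi>. norm (((\<xi> - a) / (b - a)) ^ k *\<^sub>R p)) = (b - a) / real (Suc k) * norm p"
    using has_integral_mult_left[OF has_integral_power_affine(1)[OF assms], of k "norm p"] assms
    by (intro integral_unique) (auto intro: has_integral_eq[rotated])
  then show "L1_norm a b (\<lambda>\<xi>. ((\<xi> - a) / (b - a)) ^ k *\<^sub>R p) = (b - a) / real (Suc k) * norm p"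
    using assms by (subst L1_norm_eq_integral) (auto intro!: continuous_on_imp_L1 continuous_intros)
  have "integral {a..b} (\<lambda>\<xi>. norm (((b - \<xi>) / (b - a)) ^ k *\<^sub>R p)) = (b - a) / real (Suc k) * norm p"
    using has_integral_mult_left[OF has_integral_power_affine(2)[OF assms], of k "norm p"] assms
    by (intro integral_unique) (auto intro: has_integral_eq[rotated])
  then show "L1_norm a b (\<lambda>\<xi>. ((b - \<xi>) / (b - a)) ^ k *\<^sub>R p) = (b - a) / real (Suc k) * norm p"
    using assms by (subst L1_norm_eq_integral) (auto intro!: continuous_on_imp_L1 continuous_intros)
qed

text \<open>The data of the differential expression without boundary matrix and semigroup; traces,
  lifts and density depend on these alone. Invertibility of \<open>P1\<close> recovers the spatial
  derivative from the equation, coercivity of \<open>H\<close> recovers the state from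
  \<open>H *v f\<close>.\<close>

locale hyperbolic =
  fixes a b :: real and P1 :: "'k::real_or_complex^'n^'n" and P0 H :: "real \<Rightarrow> 'k^'n^'n"
  assumes ab: "a < b" and P1_inv: "invertible P1"
    and P0: "ess_bounded a b P0" and H: "ess_bounded a b H"
    and coercive: "\<exists>m0>0. AE \<xi> in lebesgue_on {a..b}. loewner_le (mat (of_real m0)) (H \<xi>)"
begin

abbreviation "V \<equiv> L1_space a b"
abbreviation "N \<equiv> L1_norm a b"
abbreviation "hyp \<equiv> hyp_op a b V P1 P0 H"

text \<open>A class \<open>f\<close> has no point values; the trace is that of the continuous
  representative \<open>w\<close> of \<open>H *v f\<close>. By \<open>hyp_btrace\<close> the choice
  is immaterial. If \<open>f\<close> admits no such \<open>w\<close>, the value is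
  unspecified.\<close>

definition btrace :: "(real \<Rightarrow> 'k^'n) \<Rightarrow> 'k^('n + 'n)"
  where "btrace f = (SOME p. \<exists>w g. hyp f w g \<and> p = stack_vec (w b) (w a))"

lemma H_measurable: "H \<in> borel_measurable (lebesgue_on {a..b})"
  and P0_measurable: "P0 \<in> borel_measurable (lebesgue_on {a..b})"
  using H P0 by (auto simp: ess_bounded_def)

lemma bounds:
  obtains c where "c > 0" "AE \<xi> in lebesgue_on {a..b}. norm (H \<xi>) \<le> c"
    "AE \<xi> in lebesgue_on {a..b}. norm (P0 \<xi>) \<le> c"
proof -
  obtain c1 c2 where c: "AE \<xi> in lebesgue_on {a..b}. norm (H \<xi>) \<le> c1"
    "AE \<xi> in lebesgue_on {a..b}. norm (P0 \<xi>) \<le> c2"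
    using H P0 unfolding ess_bounded_def by blast
  show thesis
  proof (rule that[of "max 1 (max c1 c2)"])
    show "AE \<xi> in lebesgue_on {a..b}. norm (H \<xi>) \<le> max 1 (max c1 c2)"
      using c(1) by eventually_elim simp
    show "AE \<xi> in lebesgue_on {a..b}. norm (P0 \<xi>) \<le> max 1 (max c1 c2)"
      using c(2) by eventually_elim simp
  qed simp
qed

lemma coercive_norm:
  obtains m where "m > 0" "AE \<xi> in lebesgue_on {a..b}. \<forall>v. m * norm v \<le> norm (H \<xi> *v v)"
proof -
  obtain m where m: "m > 0" "AE \<xi> in lebesgue_on {a..b}. loewner_le (mat (of_real m)) (H \<xi>)"
    using coercive by blast
  show thesis
    by (rule that[OF m(1)]) (use m(2) in eventually_elim, simp add: loewner_le_mat_norm m(1))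
qed

lemma hyp_add:
  assumes "hyp f w g" "hyp f' w' g'"
  shows "hyp (\<lambda>\<xi>. f \<xi> + f' \<xi>) (\<lambda>\<xi>. w \<xi> + w' \<xi>) (\<lambda>\<xi>. g \<xi> + g' \<xi>)"
proof -
  obtain v v' where v: "sob a b (\<lambda>\<xi>. H \<xi> *v f \<xi>) w v"
      "AE \<xi> in lebesgue_on {a..b}. g \<xi> = P1 *v v \<xi> + P0 \<xi> *v (H \<xi> *v f \<xi>)"
    and v': "sob a b (\<lambda>\<xi>. H \<xi> *v f' \<xi>) w' v'"
      "AE \<xi> in lebesgue_on {a..b}. g' \<xi> = P1 *v v' \<xi> + P0 \<xi> *v (H \<xi> *v f' \<xi>)"
    and L: "f \<in> V" "g \<in> V" "f' \<in> V" "g' \<in> V"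
    using assms unfolding hyp_op_def by blast
  have "AE \<xi> in lebesgue_on {a..b}. g \<xi> + g' \<xi> = P1 *v (v \<xi> + v' \<xi>) + P0 \<xi> *v (H \<xi> *v (f \<xi> + f' \<xi>))"
    using v(2) v'(2) by eventually_elim (simp add: matrix_vector_right_distrib)
  then show ?thesis unfolding hyp_op_def
    using sobolev_W1_add[OF v(1) v'(1)] L
    by (auto simp: matrix_vector_right_distrib intro!: L1_space_add)
qed

lemma hyp_smult:
  assumes "hyp f w g"
  shows "hyp (\<lambda>\<xi>. c *s f \<xi>) (\<lambda>\<xi>. c *s w \<xi>) (\<lambda>\<xi>. c *s g \<xi>)"
proof -
  obtain v where v: "sob a b (\<lambda>\<xi>. H \<xi> *v f \<xi>) w v"
      "AE \<xi> in lebesgue_on {a..b}. g \<xi> = P1 *v v \<xi> + P0 \<xi> *v (H \<xi> *v f \<xi>)"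
    and L: "f \<in> V" "g \<in> V"
    using assms unfolding hyp_op_def by blast
  have "AE \<xi> in lebesgue_on {a..b}. c *s g \<xi> = P1 *v (c *s v \<xi>) + P0 \<xi> *v (H \<xi> *v (c *s f \<xi>))"
    using v(2) by eventually_elim (simp add: vector_scalar_commute vector_add_ldistrib)
  then show ?thesis unfolding hyp_op_def
    using sobolev_W1_smult[OF v(1), of c] L
    by (auto simp: vector_scalar_commute intro!: L1_space_smult)
qed

lemma hyp_diff:
  assumes "hyp f w g" "hyp f' w' g'"
  shows "hyp (\<lambda>\<xi>. f \<xi> - f' \<xi>) (\<lambda>\<xi>. w \<xi> - w' \<xi>) (\<lambda>\<xi>. g \<xi> - g' \<xi>)"
  using hyp_add[OF assms(1) hyp_smult[OF assms(2), of "-1"]] by simp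

lemma hyp_0: "hyp (\<lambda>\<xi>. 0) (\<lambda>\<xi>. 0) (\<lambda>\<xi>. 0)"
  unfolding hyp_op_def by (auto simp: sobolev_W1_def L1_space_0 intro!: exI[of _ "\<lambda>_. 0"])

lemma hyp_sum:
  assumes "finite I" "\<And>i. i \<in> I \<Longrightarrow> hyp (f i) (w i) (g i)"
  shows "hyp (\<lambda>\<xi>. \<Sum>i\<in>I. f i \<xi>) (\<lambda>\<xi>. \<Sum>i\<in>I. w i \<xi>) (\<lambda>\<xi>. \<Sum>i\<in>I. g i \<xi>)"
  using assms by (induction I) (auto simp: hyp_0 intro: hyp_add)

lemma hyp_btrace:
  assumes "hyp f w g"
  shows "btrace f = stack_vec (w b) (w a)"
proof -
  have "\<exists>p w g. hyp f w g \<and> p = stack_vec (w b) (w a)" using assms by blast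
  from someI_ex[OF this] obtain w' g' where
    w': "hyp f w' g'" "btrace f = stack_vec (w' b) (w' a)"
    unfolding btrace_def by blast
  obtain v v' where v: "sob a b (\<lambda>\<xi>. H \<xi> *v f \<xi>) w v" "sob a b (\<lambda>\<xi>. H \<xi> *v f \<xi>) w' v'"
    using assms w'(1) unfolding hyp_op_def by blast
  have "w' \<xi> = w \<xi>" if "\<xi> \<in> {a..b}" for \<xi>
    by (rule sobolev_W1_unique[OF v(2,1) _ ab that]) simp
  then show ?thesis using w'(2) ab by simp
qed

text \<open>The trace is continuous in the graph norm: inverting \<open>P1\<close> in g = P1 v + P0
  H f bounds the derivative \<open>v\<close>, and the Sobolev embedding then bounds
  \<open>w\<close>.\<close>

lemma hyp_trace_bound:
  obtains c where "c > 0" "\<And>f w g \<xi>. hyp f w g \<Longrightarrow> \<xi> \<in> {a..b} \<Longrightarrow> norm (w \<xi>) \<le> c * (N f + N g)"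
proof -
  obtain c where c: "c > 0" "AE \<xi> in lebesgue_on {a..b}. norm (H \<xi>) \<le> c"
    "AE \<xi> in lebesgue_on {a..b}. norm (P0 \<xi>) \<le> c" by (rule bounds)
  obtain Q where Q: "Q ** P1 = mat 1" using P1_inv unfolding invertible_def by blast
  \<comment> \<open>\<open>c / (b - a)\<close> stems from the mean of H f, \<open>norm Q\<close>
    from \<open>g\<close>, and \<open>norm Q * (c * c)\<close> from the term P0 H f moved to the
    other side.\<close>
  define C where "C = c / (b - a) + norm Q * (1 + c * c) + 1"
  have C: "C > 0" using c(1) ab by (simp add: C_def add_nonneg_pos)
  have "norm (w \<xi>) \<le> C * (N f + N g)" if h: "hyp f w g" and \<xi>: "\<xi> \<in> {a..b}" for f w g \<xi>
  proof -
    obtain v where v: "sob a b (\<lambda>\<xi>. H \<xi> *v f \<xi>) w v"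
        "AE \<xi> in lebesgue_on {a..b}. g \<xi> = P1 *v v \<xi> + P0 \<xi> *v (H \<xi> *v f \<xi>)"
      and L: "f \<in> V" "g \<in> V"
      using h unfolding hyp_op_def by blast
    note Hf = matrix_L1[OF H_measurable c(2) L(1)]
    note P0Hf = matrix_L1[OF P0_measurable c(3) Hf(1)]
    have "N (\<lambda>\<xi>. P0 \<xi> *v (H \<xi> *v f \<xi>)) \<le> c * (c * N f)"
      using P0Hf(2) mult_left_mono[OF Hf(2), of c] c(1) by linarith
    have "N v = N (\<lambda>\<xi>. Q *v (g \<xi> - P0 \<xi> *v (H \<xi> *v f \<xi>)))"
    proof (rule L1_norm_cong_AE[OF _ sobolev_W1_deriv[OF v(1)] const_matrix_L1(1)[OF L1_space_diff[OF L(2) P0Hf(1)]]])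
      show "AE \<xi> in lebesgue_on {a..b}. v \<xi> = Q *v (g \<xi> - P0 \<xi> *v (H \<xi> *v f \<xi>))"
        using v(2) by eventually_elim (simp add: matrix_vector_mul_assoc Q)
    qed
    also have "\<dots> \<le> norm Q * N (\<lambda>\<xi>. g \<xi> - P0 \<xi> *v (H \<xi> *v f \<xi>))"
      by (rule const_matrix_L1(2)[OF L1_space_diff[OF L(2) P0Hf(1)]])
    also have "\<dots> \<le> norm Q * (N g + c * (c * N f))"
      using L1_norm_triangle_diff[OF L(2) P0Hf(1)] \<open>N (\<lambda>\<xi>. P0 \<xi> *v (H \<xi> *v f \<xi>)) \<le> c * (c * N f)\<close>
      by (intro mult_left_mono) auto
    finally have Nv: "N v \<le> norm Q * (N g + c * (c * N f))" .
    have "norm (w \<xi>) \<le> N (\<lambda>\<xi>. H \<xi> *v f \<xi>) / (b - a) + N v"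
      by (rule sobolev_W1_sup_le[OF v(1) Hf(1) \<xi> ab])
    also have "\<dots> \<le> c * N f / (b - a) + norm Q * (N g + c * (c * N f))"
      using Hf(2) Nv ab by (intro add_mono divide_right_mono) auto
    also have "\<dots> \<le> C * (N f + N g)"
    proof -
      define x where "x = c / (b - a)"
      have "0 \<le> x" using c(1) ab by (simp add: x_def)
      then have "0 \<le> x * N g + norm Q * N f + norm Q * (c * (c * N g)) + (N f + N g)"
        using c(1) by (simp add: L1_norm_nonneg)
      then have "x * N f + norm Q * (N g + c * (c * N f)) \<le> C * (N f + N g)"
        unfolding C_def x_def[symmetric] by (simp add: algebra_simps)
      then show ?thesis by (simp add: x_def)
    qed
    finally show ?thesis .
  qed
  with C show thesis by (rule that)
qed

text \<open>\<open>H\<close> is merely measurable, so smoothness is prescribed for \<open>w\<close>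
  = H f and not for \<open>f\<close>, which is then found by solving pointwise. The bounds are
  linear in the L^1 norms of \<open>w\<close> and \<open>v\<close>, as steep ramps require.\<close>

lemma hyp_of_C1:
  obtains c where "c > 0" "\<And>w v. continuous_on {a..b} v \<Longrightarrow>
      (\<And>\<xi>. \<xi> \<in> {a..b} \<Longrightarrow> (w has_vector_derivative v \<xi>) (at \<xi> within {a..b})) \<Longrightarrow>
      \<exists>f g. hyp f w g \<and> N f \<le> c * N w \<and> N g \<le> c * (N w + N v) \<and>
        (AE \<xi> in lebesgue_on {a..b}. H \<xi> *v f \<xi> = w \<xi>)"
proof -
  obtain c where c: "c > 0" "AE \<xi> in lebesgue_on {a..b}. norm (H \<xi>) \<le> c"
    "AE \<xi> in lebesgue_on {a..b}. norm (P0 \<xi>) \<le> c" by (rule bounds)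
  obtain m where m: "m > 0" "AE \<xi> in lebesgue_on {a..b}. \<forall>v. m * norm v \<le> norm (H \<xi> *v v)"
    by (rule coercive_norm)
  define C where "C = 1 / m + norm P1 + c"
  have C: "C > 0" "1 / m \<le> C" "norm P1 \<le> C" "c \<le> C"
    using m(1) c(1) by (simp_all add: C_def add_pos_nonneg add_nonneg_nonneg)
  have "\<exists>f g. hyp f w g \<and> N f \<le> C * N w \<and> N g \<le> C * (N w + N v) \<and>
        (AE \<xi> in lebesgue_on {a..b}. H \<xi> *v f \<xi> = w \<xi>)"
    if vc: "continuous_on {a..b} v" and
      wv: "\<And>\<xi>. \<xi> \<in> {a..b} \<Longrightarrow> (w has_vector_derivative v \<xi>) (at \<xi> within {a..b})" for w v
  proof -
    have wc: "continuous_on {a..b} w"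
      unfolding continuous_on_eq_continuous_within
      by (blast intro: has_vector_derivative_continuous wv)
    have wL: "w \<in> V" and vL: "v \<in> V" by (intro continuous_on_imp_L1 wc vc)+
    obtain f where f: "f \<in> borel_measurable (lebesgue_on {a..b})"
      "\<And>\<xi>. invertible (H \<xi>) \<Longrightarrow> H \<xi> *v f \<xi> = w \<xi>"
      using measurable_linear_solution[OF H_measurable L1_space_measurable[OF wL]] by blast
    have Hf: "AE \<xi> in lebesgue_on {a..b}. H \<xi> *v f \<xi> = w \<xi> \<and> norm (f \<xi>) \<le> 1 / m * norm (w \<xi>)"
      using m(2)
    proof eventually_elim
      case (elim \<xi>)
      have "\<forall>x. H \<xi> *v x = 0 \<longrightarrow> x = 0"
      proof (intro allI impI)
        fix x assume "H \<xi> *v x = 0"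
        with elim[rule_format, of x] m(1) show "x = 0" by (simp add: mult_le_0_iff)
      qed
      then have "invertible (H \<xi>)"
        by (simp add: matrix_left_invertible_ker[symmetric] invertible_left_inverse)
      then have "H \<xi> *v f \<xi> = w \<xi>" by (rule f(2))
      with elim[rule_format, of "f \<xi>"] m(1) show ?case by (simp add: field_simps)
    qed
    then have Hf1: "AE \<xi> in lebesgue_on {a..b}. H \<xi> *v f \<xi> = w \<xi>"
      and Hf2: "AE \<xi> in lebesgue_on {a..b}. norm (f \<xi>) \<le> 1 / m * norm (w \<xi>)" by auto
    note fL = L1_space_bound[OF wL f(1) Hf2]
    define g where "g \<xi> = P1 *v v \<xi> + P0 \<xi> *v (H \<xi> *v f \<xi>)" for \<xi>
    have HfL: "(\<lambda>\<xi>. H \<xi> *v f \<xi>) \<in> V" by (rule matrix_L1(1)[OF H_measurable c(2) fL(1)])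
    note P0Hf = matrix_L1[OF P0_measurable c(3) HfL]
    note P1v = const_matrix_L1[OF vL, of P1]
    have gL: "g \<in> V" unfolding g_def by (rule L1_space_add[OF P1v(1) P0Hf(1)])
    have "hyp f w g" unfolding hyp_op_def
    proof (intro conjI fL(1) gL exI[of _ v])
      show "sob a b (\<lambda>\<xi>. H \<xi> *v f \<xi>) w v" by (rule sobolev_W1_C1[OF Hf1 vc wv])
    qed (simp add: g_def)
    moreover have "N f \<le> C * N w"
      by (rule order_trans[OF fL(2) mult_right_mono[OF C(2) L1_norm_nonneg]])
    moreover have "N g \<le> C * (N w + N v)"
    proof -
      have "N g \<le> norm P1 * N v + c * N w"
        using L1_norm_triangle[OF P1v(1) P0Hf(1)] P1v(2) P0Hf(2) L1_norm_cong_AE[OF Hf1 HfL wL]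
        unfolding g_def by simp
      also have "\<dots> \<le> C * N v + C * N w"
        using C by (intro add_mono mult_right_mono L1_norm_nonneg)
      finally show ?thesis by (simp add: algebra_simps)
    qed
    ultimately show ?thesis using Hf1 by blast
  qed
  with C(1) show thesis by (rule that)
qed

text \<open>
  The boundary values are carried by ramps \<open>((\<xi> - a) / (b - a))\<^sup>k\<close>: as \<open>k \<rightarrow> \<infinity>\<close> they vanish in
  \<open>L\<^sup>1\<close> while their total variation stays \<open>1\<close>.
\<close>

lemma hyp_lift:
  "\<exists>G\<ge>0. \<forall>e>0. \<exists>f w g. hyp f w g \<and> w b = pb \<and> w a = pa \<and> N f < e \<and> N g \<le> G"
proof -
  obtain c where c: "c > 0" "\<And>w v. continuous_on {a..b} v \<Longrightarrow>
      (\<And>\<xi>. \<xi> \<in> {a..b} \<Longrightarrow> (w has_vector_derivative v \<xi>) (at \<xi> within {a..b})) \<Longrightarrow>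
      \<exists>f g. hyp f w g \<and> N f \<le> c * N w \<and> N g \<le> c * (N w + N v) \<and>
        (AE \<xi> in lebesgue_on {a..b}. H \<xi> *v f \<xi> = w \<xi>)"
    by (rule hyp_of_C1) blast
  define s where "s = norm pb + norm pa"
  \<comment> \<open>Independent of the steepness: only \<open>N w \<le> (b - a) * s\<close> and
    \<open>N v \<le> s\<close> enter, and these hold for every exponent. Hence \<open>G\<close> can
    be fixed before \<open>e\<close>.\<close>
  define G where "G = c * ((b - a) * s + s)"
  have s: "s \<ge> 0" by (simp add: s_def)
  have "\<exists>f w g. hyp f w g \<and> w b = pb \<and> w a = pa \<and> N f < e \<and> N g \<le> G" if e: "e > 0" for e
  proof -
    \<comment> \<open>The L^1 norm of \<open>w\<close> is at most (b - a) s / (k + 2); this exponent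
      brings \<open>c\<close> times that quantity below \<open>e\<close>.\<close>
    obtain k where k: "c * ((b - a) * s) / e < real k" using reals_Archimedean2 by blast
    define w where "w \<xi> = ((\<xi> - a) / (b - a)) ^ Suc k *\<^sub>R pb + ((b - \<xi>) / (b - a)) ^ Suc k *\<^sub>R pa" for \<xi>
    define v where "v \<xi> = (Suc k / (b - a)) *\<^sub>R
        (((\<xi> - a) / (b - a)) ^ k *\<^sub>R pb - ((b - \<xi>) / (b - a)) ^ k *\<^sub>R pa)" for \<xi>
    have d1: "((\<lambda>\<xi>. ((\<xi> - a) / (b - a)) ^ Suc k *\<^sub>R pb) has_vector_derivative
        ((Suc k / (b - a)) * ((\<xi> - a) / (b - a)) ^ k) *\<^sub>R pb) (at \<xi> within {a..b})" for \<xi>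
      using has_vector_derivative_scaleR[OF ramp_deriv(1)[OF ab, of k] has_vector_derivative_const] by simp
    have d2: "((\<lambda>\<xi>. ((b - \<xi>) / (b - a)) ^ Suc k *\<^sub>R pa) has_vector_derivative
        (- (Suc k / (b - a)) * ((b - \<xi>) / (b - a)) ^ k) *\<^sub>R pa) (at \<xi> within {a..b})" for \<xi>
      using has_vector_derivative_scaleR[OF ramp_deriv(2)[OF ab, of k] has_vector_derivative_const] by simp
    have wv: "(w has_vector_derivative v \<xi>) (at \<xi> within {a..b})" for \<xi>
      unfolding w_def v_def using has_vector_derivative_add[OF d1 d2]
      by (simp add: scaleR_diff_right)
    have vc: "continuous_on {a..b} v"
      unfolding v_def using ab by (intro continuous_intros) auto
    have L: "(\<lambda>\<xi>. ((\<xi> - a) / (b - a)) ^ j *\<^sub>R pb) \<in> V" "(\<lambda>\<xi>. ((b - \<xi>) / (b - a)) ^ j *\<^sub>R pa) \<in> V" for j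
      using ab by (auto intro!: continuous_on_imp_L1 continuous_intros)
    have Nw: "N w \<le> (b - a) * s / real (Suc (Suc k))"
      unfolding w_def using L1_norm_triangle[OF L(1)[of "Suc k"] L(2)[of "Suc k"]]
      unfolding L1_norm_power_affine[OF ab] s_def
      by (simp add: distrib_left add_divide_distrib del: power_Suc of_nat_Suc)
    have Nv: "N v \<le> s"
    proof -
      have "N v = Suc k / (b - a) * N (\<lambda>\<xi>. ((\<xi> - a) / (b - a)) ^ k *\<^sub>R pb - ((b - \<xi>) / (b - a)) ^ k *\<^sub>R pa)"
        unfolding v_def using ab by (subst L1_norm_scaleR) simp
      also have "\<dots> \<le> Suc k / (b - a) * ((b - a) / real (Suc k) * norm pb + (b - a) / real (Suc k) * norm pa)"
        using L1_norm_triangle_diff[OF L(1)[of k] L(2)[of k]] ab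
        unfolding L1_norm_power_affine[OF ab] by (intro mult_left_mono) auto
      also have "\<dots> = s" using ab by (simp add: s_def field_simps del: of_nat_Suc)
      finally show ?thesis .
    qed
    obtain f g where fg: "hyp f w g" "N f \<le> c * N w" "N g \<le> c * (N w + N v)"
      using c(2)[OF vc wv] by blast
    have "N f < e"
    proof -
      have "c * ((b - a) * s) < e * real (Suc (Suc k))"
      proof -
        have "c * ((b - a) * s) < e * real k" using k e by (simp add: field_simps)
        also have "\<dots> \<le> e * real (Suc (Suc k))" using e by simp
        finally show ?thesis .
      qed
      then have "c * ((b - a) * s / real (Suc (Suc k))) < e" by (simp add: field_simps)
      with fg(2) mult_left_mono[OF Nw, of c] c(1) show ?thesis by linarith
    qed
    moreover have "N g \<le> G"
    proof -
      have "(b - a) * s / real (Suc (Suc k)) \<le> (b - a) * s / 1"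
        using ab s by (intro divide_left_mono) auto
      with Nw Nv have "N w + N v \<le> (b - a) * s + s" by simp
      from mult_left_mono[OF this, of c] c(1) fg(3) show ?thesis unfolding G_def by linarith
    qed
    moreover have "w b = pb" "w a = pa" using ab by (simp_all add: w_def)
    ultimately show ?thesis using fg(1) by blast
  qed
  moreover have "G \<ge> 0" using c(1) ab s by (simp add: G_def)
  ultimately show ?thesis by blast
qed

text \<open>A polynomial approximates H f in L^1, and coercivity transfers the error to
  \<open>f\<close>. The boundary values of the polynomial are removed by a lift of small L^1 norm.
  With both traces zero, the result satisfies every homogeneous linear boundary condition.\<close>

lemma hyp_dense:
  assumes f: "f \<in> V" and e: "0 < e"
  shows "\<exists>f' w g. hyp f' w g \<and> w b = 0 \<and> w a = 0 \<and> N (\<lambda>\<xi>. f \<xi> - f' \<xi>) < e"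
proof -
  obtain c where c: "c > 0" "AE \<xi> in lebesgue_on {a..b}. norm (H \<xi>) \<le> c"
    "AE \<xi> in lebesgue_on {a..b}. norm (P0 \<xi>) \<le> c" by (rule bounds)
  obtain m where m: "m > 0" "AE \<xi> in lebesgue_on {a..b}. \<forall>v. m * norm v \<le> norm (H \<xi> *v v)"
    by (rule coercive_norm)
  have Hf: "(\<lambda>\<xi>. H \<xi> *v f \<xi>) \<in> V" by (rule matrix_L1(1)[OF H_measurable c(2) f])
  \<comment> \<open>The factor \<open>m\<close> compensates the \<open>1 / m\<close> lost in
    dividing by \<open>H\<close>; the other half of \<open>e\<close> is reserved for the
    lift.\<close>
  have "0 < m * (e / 2)" using e m(1) by simp
  from L1_polynomial_dense[OF Hf ab this] obtain p where
    p: "polynomial_function p" "N (\<lambda>\<xi>. H \<xi> *v f \<xi> - p \<xi>) < m * (e / 2)" by blast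
  obtain p' where p': "polynomial_function p'" "\<And>\<xi>. (p has_vector_derivative p' \<xi>) (at \<xi>)"
    using has_vector_derivative_polynomial_function[OF p(1)] by blast
  obtain h g where h: "hyp h p g" "AE \<xi> in lebesgue_on {a..b}. H \<xi> *v h \<xi> = p \<xi>"
  proof (rule hyp_of_C1)
    fix c :: real
    assume "\<And>w v. continuous_on {a..b} v \<Longrightarrow>
      (\<And>\<xi>. \<xi> \<in> {a..b} \<Longrightarrow> (w has_vector_derivative v \<xi>) (at \<xi> within {a..b})) \<Longrightarrow>
      \<exists>f g. hyp f w g \<and> N f \<le> c * N w \<and> N g \<le> c * (N w + N v) \<and>
        (AE \<xi> in lebesgue_on {a..b}. H \<xi> *v f \<xi> = w \<xi>)"
    from this[OF continuous_on_polymonial_function[OF p'(1)] has_vector_derivative_at_within[OF p'(2)]]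
    show thesis using that by blast
  qed
  obtain l w k where l: "hyp l w k" "w b = p b" "w a = p a" "N l < e / 2"
    using hyp_lift[of "p b" "p a"] e half_gt_zero by blast
  have hL: "h \<in> V" "l \<in> V" using h(1) l(1) by (auto simp: hyp_op_def)
  have Hd: "(\<lambda>\<xi>. H \<xi> *v f \<xi> - p \<xi>) \<in> V"
    by (rule L1_space_diff[OF Hf continuous_on_imp_L1[OF continuous_on_polymonial_function[OF p(1)]]])
  have "AE \<xi> in lebesgue_on {a..b}. norm (f \<xi> - h \<xi>) \<le> 1 / m * norm (H \<xi> *v f \<xi> - p \<xi>)"
    using m(2) h(2)
  proof eventually_elim
    case (elim \<xi>)
    from elim(1)[rule_format, of "f \<xi> - h \<xi>"] elim(2) m(1) show ?case
      by (simp add: matrix_vector_mult_diff_distrib field_simps)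
  qed
  from L1_space_bound(2)[OF Hd L1_space_measurable[OF L1_space_diff[OF f hL(1)]] this]
  have "N (\<lambda>\<xi>. f \<xi> - h \<xi>) \<le> 1 / m * N (\<lambda>\<xi>. H \<xi> *v f \<xi> - p \<xi>)" .
  also have "\<dots> < e / 2" using p(2) m(1) by (simp add: field_simps)
  finally have "N (\<lambda>\<xi>. f \<xi> - (h \<xi> - l \<xi>)) < e"
    using L1_norm_triangle'[OF L1_space_diff[OF f hL(1)] hL(2), of "\<lambda>\<xi>. f \<xi> - (h \<xi> - l \<xi>)"] l(4) by simp
  with hyp_diff[OF h(1) l(1)] l(2,3) show ?thesis
    by (intro exI[of _ "\<lambda>\<xi>. h \<xi> - l \<xi>"] exI[of _ "\<lambda>\<xi>. p \<xi> - w \<xi>"] exI) auto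
qed

text \<open>Coercivity compares the weighted norm with that of L^2, Cauchy-Schwarz compares L^2 with
  L^1. This carries time derivatives taken in \<open>X\<close> over to L^1.\<close>

lemma L1_norm_le_X_norm:
  obtains c where "c > 0" "\<And>f. f \<in> L2_space a b \<Longrightarrow> N f \<le> c * X_norm a b H f"
proof -
  let ?M = "lebesgue_on {a..b}"
  obtain m where m: "m > 0" "AE \<xi> in ?M. loewner_le (mat (of_real m)) (H \<xi>)"
    using coercive by blast
  obtain c where c: "c > 0" "AE \<xi> in ?M. norm (H \<xi>) \<le> c" by (rule bounds)
  \<comment> \<open>The 2 undoes the factor 1/2 of the inner product, \<open>b - a\<close> comes
    from Cauchy-Schwarz and \<open>1 / m\<close> from coercivity.\<close>
  define C where "C = sqrt (2 * (b - a) / m)"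
  have "N f \<le> C * X_norm a b H f" if f: "f \<in> L2_space a b" for f
  proof -
    have fL: "f \<in> V" using L2_imp_L1[OF f] ab by simp
    have fm: "f \<in> borel_measurable ?M" and f2: "integrable ?M (\<lambda>\<xi>. (norm (f \<xi>))\<^sup>2)"
      using f by (auto simp: L2_space_def)
    define \<rho> where "\<rho> \<xi> = herm_prod (f \<xi>) (H \<xi> *v f \<xi>)" for \<xi>
    have Hfm: "(\<lambda>\<xi>. H \<xi> *v f \<xi>) \<in> borel_measurable ?M"
      by (rule borel_measurable_bilinear[OF bounded_bilinear_matrix_vector_mult H_measurable fm])
    have \<rho>m: "\<rho> \<in> borel_measurable ?M"
      unfolding \<rho>_def herm_prod_def kcnj_eq_divide
      using measurable_vec_nth[OF fm] measurable_vec_nth[OF Hfm]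
      by (intro borel_measurable_sum borel_measurable_times borel_measurable_divide) auto
    have \<rho>i: "integrable ?M \<rho>"
    proof (rule Bochner_Integration.integrable_bound[OF _ \<rho>m])
      show "integrable ?M (\<lambda>\<xi>. c * (norm (f \<xi>))\<^sup>2)" using f2 by simp
      show "AE \<xi> in ?M. norm (\<rho> \<xi>) \<le> norm (c * (norm (f \<xi>))\<^sup>2)"
        using c(2)
      proof eventually_elim
        case (elim \<xi>)
        have "norm (\<rho> \<xi>) \<le> norm (f \<xi>) * (norm (H \<xi>) * norm (f \<xi>))"
          unfolding \<rho>_def
          by (rule order_trans[OF norm_herm_prod_le mult_left_mono[OF norm_matrix_vector_mult_le norm_ge_zero]])
        also have "\<dots> \<le> norm (f \<xi>) * (c * norm (f \<xi>))"
          using elim by (intro mult_left_mono mult_right_mono) auto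
        finally show ?case using c(1) by (simp add: power2_eq_square mult_ac)
      qed
    qed
    \<comment> \<open>The integrand is almost everywhere a nonnegative real scalar, so nothing
      cancels when the norm of the integral is taken.\<close>
    have \<rho>r: "AE \<xi> in ?M. \<rho> \<xi> = of_real (norm (\<rho> \<xi>)) \<and> m * (norm (f \<xi>))\<^sup>2 \<le> norm (\<rho> \<xi>)"
      using m(2)
    proof eventually_elim
      case (elim \<xi>)
      obtain r where r: "r \<ge> m * (norm (f \<xi>))\<^sup>2" "\<rho> \<xi> = of_real r"
        using loewner_le_mat_herm_prod[OF elim] unfolding \<rho>_def by blast
      have "0 \<le> m * (norm (f \<xi>))\<^sup>2" using m(1) by simp
      with r show ?case by auto
    qed
    have "(LINT \<xi>|?M. \<rho> \<xi>) = (LINT \<xi>|?M. norm (\<rho> \<xi>) *\<^sub>R 1)"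
      using \<rho>r \<rho>m by (intro integral_cong_AE) (auto simp: scaleR_conv_of_real)
    also have "\<dots> = (LINT \<xi>|?M. norm (\<rho> \<xi>)) *\<^sub>R 1"
      using \<rho>i by (intro integral_scaleR_left) auto
    finally have "norm (X_inner a b H f f) = (LINT \<xi>|?M. norm (\<rho> \<xi>)) / 2"
      unfolding X_inner_def \<rho>_def[symmetric]
      by (simp add: norm_divide integral_nonneg_AE)
    moreover have "(LINT \<xi>|?M. m * (norm (f \<xi>))\<^sup>2) \<le> (LINT \<xi>|?M. norm (\<rho> \<xi>))"
      using f2 \<rho>i \<rho>r by (intro integral_mono_AE) auto
    ultimately have 1: "m * (LINT \<xi>|?M. (norm (f \<xi>))\<^sup>2) \<le> 2 * norm (X_inner a b H f f)"
      by simp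
    have 2: "(N f)\<^sup>2 \<le> (b - a) * (LINT \<xi>|?M. (norm (f \<xi>))\<^sup>2)"
    proof -
      \<comment> \<open>The mean of |f|: expanding the integral of (|f| - t)^2 gives Cauchy-Schwarz
        against a constant function.\<close>
      define t where "t = N f / (b - a)"
      have i: "integrable ?M (\<lambda>\<xi>. norm (f \<xi>))" "integrable ?M (\<lambda>\<xi>. t\<^sup>2)"
        using fL by (auto simp: L1_space_def intro!: continuous_imp_integrable_real)
      have "0 \<le> (LINT \<xi>|?M. (norm (f \<xi>) - t)\<^sup>2)" by (rule integral_nonneg_AE) simp
      also have "\<dots> = (LINT \<xi>|?M. (norm (f \<xi>))\<^sup>2 + t\<^sup>2 - 2 * t * norm (f \<xi>))"
        by (simp add: power2_diff mult_ac)
      also have "\<dots> = (LINT \<xi>|?M. (norm (f \<xi>))\<^sup>2) + (b - a) * t\<^sup>2 - 2 * t * N f"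
        using i f2 ab by (simp add: L1_norm_def measure_restrict_space)
      finally have *: "0 \<le> (LINT \<xi>|?M. (norm (f \<xi>))\<^sup>2) + (b - a) * t\<^sup>2 - 2 * t * N f" .
      have Nt: "N f = (b - a) * t" using ab by (simp add: t_def)
      have "(b - a) * t\<^sup>2 \<le> (LINT \<xi>|?M. (norm (f \<xi>))\<^sup>2)"
        using * unfolding Nt by (simp add: power2_eq_square algebra_simps)
      from mult_left_mono[OF this, of "b - a"] ab show ?thesis
        unfolding Nt by (simp add: power2_eq_square mult_ac)
    qed
    have "(N f)\<^sup>2 \<le> (b - a) * (2 * norm (X_inner a b H f f) / m)"
      using 1 m(1) ab by (intro order_trans[OF 2] mult_left_mono) (auto simp: field_simps)
    then have "sqrt ((N f)\<^sup>2) \<le> sqrt (2 * (b - a) / m * norm (X_inner a b H f f))"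
      by (intro real_sqrt_le_mono) (simp add: algebra_simps)
    then show ?thesis unfolding C_def X_norm_def real_sqrt_mult[symmetric] by (simp add: L1_norm_nonneg)
  qed
  moreover have "C > 0" using ab m(1) by (simp add: C_def)
  ultimately show thesis by (rule that[rotated])
qed

end

section \<open>Right increments and test functions\<close>

text \<open>Semigroup orbits are differentiated from the right, so monotonicity has to follow from
  right increments and continuity. Continuity carries the bound to the supremum of the good initial
  intervals, and the right increment carries it beyond.\<close>

lemma right_nonincreasing_imp_le:
  fixes \<phi> :: "real \<Rightarrow> real"
  assumes R: "0 \<le> R" and cont: "continuous_on {0..R} \<phi>"
    and ev: "\<And>s. 0 \<le> s \<Longrightarrow> s < R \<Longrightarrow> \<forall>\<^sub>F h in at_right 0. \<phi> (s + h) \<le> \<phi> s"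
  shows "\<phi> R \<le> \<phi> 0"
proof -
  define S where "S = {s \<in> {0..R}. \<forall>r\<in>{0..s}. \<phi> r \<le> \<phi> 0}"
  have S0: "0 \<in> S" using R by (auto simp: S_def)
  have bdd: "bdd_above S" by (auto simp: S_def intro!: bdd_aboveI[of _ R])
  define m where "m = Sup S"
  have m: "0 \<le> m" "m \<le> R"
    unfolding m_def using S0 bdd by (auto intro!: cSup_upper cSup_least simp: S_def)
  have lt: "\<phi> r \<le> \<phi> 0" if r: "0 \<le> r" "r < m" for r
  proof -
    obtain s where "s \<in> S" "r < s" using less_cSupD[of S r] S0 r(2) unfolding m_def by auto
    then show ?thesis using r by (auto simp: S_def)
  qed
  have at_m: "\<phi> m \<le> \<phi> 0"
  proof (rule ccontr)
    assume "\<not> \<phi> m \<le> \<phi> 0"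
    then have g: "\<phi> m > \<phi> 0" "m > 0" using m by (auto simp: not_le intro!: le_neq_trans)
    have "(\<phi> \<longlongrightarrow> \<phi> m) (at m within {0..R})" using cont m by (auto simp: continuous_on_def)
    from order_tendstoD(1)[OF this g(1)] obtain d where
      d: "d > 0" "\<And>x. x \<in> {0..R} \<Longrightarrow> x \<noteq> m \<Longrightarrow> dist x m < d \<Longrightarrow> \<phi> 0 < \<phi> x"
      unfolding eventually_at by blast
    define x where "x = max 0 (m - d/2)"
    have "x \<in> {0..R}" "x < m" "dist x m < d" using d(1) m g(2) by (auto simp: x_def dist_real_def)
    with d(2)[of x] lt[of x] show False by auto
  qed
  have "m = R"
  proof (rule ccontr)
    assume "m \<noteq> R"
    with m have "m < R" by simp
    from ev[OF m(1) this] obtain d where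
      d: "d > 0" "\<And>h. 0 < h \<Longrightarrow> h < d \<Longrightarrow> \<phi> (m + h) \<le> \<phi> m"
      unfolding eventually_at_right_field by auto
    define h where "h = min (d/2) (R - m)"
    have h: "0 < h" "h < d" "m + h \<le> R" using d(1) \<open>m < R\<close> by (auto simp: h_def)
    have "m + h \<in> S" unfolding S_def
    proof (intro CollectI conjI ballI)
      show "m + h \<in> {0..R}" using h m by auto
      fix r assume r: "r \<in> {0..m + h}"
      show "\<phi> r \<le> \<phi> 0"
      proof (cases "r \<le> m")
        case True
        then show ?thesis using lt[of r] at_m r by (cases "r = m") auto
      next
        case False
        then have "\<phi> (m + (r - m)) \<le> \<phi> m" using r h by (intro d(2)) auto
        then show ?thesis using at_m by simp
      qed
    qed
    then have "m + h \<le> m" unfolding m_def using bdd by (intro cSup_upper)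
    with h(1) show False by simp
  qed
  with at_m show ?thesis by simp
qed

lemma has_vector_derivative_right_increment:
  assumes "(f has_vector_derivative f') (at s within {0..R})" "0 \<le> s" "s < R" "0 < e"
  shows "\<forall>\<^sub>F h in at_right 0. norm (f (s + h) - f s - h *\<^sub>R f') \<le> e * h"
proof -
  obtain d where d: "d > 0" "\<And>y. y \<in> {0..R} \<Longrightarrow> norm (y - s) < d \<Longrightarrow>
      norm (f y - f s - (y - s) *\<^sub>R f') \<le> e * norm (y - s)"
    using assms(1,4) unfolding has_vector_derivative_def has_derivative_within_alt by blast
  have "norm (f (s + h) - f s - h *\<^sub>R f') \<le> e * h" if "0 < h" "h < min d (R - s)" for h
    using d(2)[of "s + h"] that assms by auto
  then show ?thesis
    unfolding eventually_at_right_field using d(1) assms(3)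
    by (intro exI[of _ "min d (R - s)"]) auto
qed

text \<open>A mean value inequality in which \<open>D\<close> is a right derivative of
  \<open>F\<close> up to a defect \<open>B\<close>. The quantity |F - F 0 - \<integral> D| -
  \<integral> B - e s does not increase to the right, so the preceding criterion applies for every
  slack \<open>e\<close>.\<close>

lemma right_increment_bound:
  fixes F D :: "real \<Rightarrow> 'v::euclidean_space" and B :: "real \<Rightarrow> real"
  assumes R: "0 \<le> R" and F: "continuous_on {0..R} F" and D: "continuous_on {0..R} D"
    and B: "continuous_on {0..R} B"
    and ev: "\<And>s e. 0 \<le> s \<Longrightarrow> s < R \<Longrightarrow> 0 < e \<Longrightarrow>
      \<forall>\<^sub>F h in at_right 0. norm (F (s + h) - F s - h *\<^sub>R D s) \<le> (B s + e) * h"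
  shows "norm (F R - F 0 - integral {0..R} D) \<le> integral {0..R} B"
proof (rule field_le_epsilon)
  fix \<epsilon> :: real assume \<epsilon>: "0 < \<epsilon>"
  define e where "e = \<epsilon> / (R + 1)"
  have e: "e > 0" using \<epsilon> R by (simp add: e_def)
  define I where "I s = integral {0..s} D" for s
  define J where "J s = integral {0..s} B" for s
  have I': "(I has_vector_derivative D s) (at s within {0..R})" if "s \<in> {0..R}" for s
    unfolding I_def by (rule integral_has_vector_derivative[OF D that])
  have J': "(J has_vector_derivative B s) (at s within {0..R})" if "s \<in> {0..R}" for s
    unfolding J_def by (rule integral_has_vector_derivative[OF B that])
  have IJc: "continuous_on {0..R} I" "continuous_on {0..R} J"
    unfolding continuous_on_eq_continuous_within
    by (blast intro: has_vector_derivative_continuous I' J')+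
  define G where "G s = F s - F 0 - I s" for s
  define \<phi> where "\<phi> s = norm (G s) - J s - e * s" for s
  have "\<phi> R \<le> \<phi> 0"
  proof (rule right_nonincreasing_imp_le[OF R])
    show "continuous_on {0..R} \<phi>"
      unfolding \<phi>_def G_def by (intro continuous_intros F IJc)
    fix s assume s: "0 \<le> s" "s < R"
    \<comment> \<open>One third each for the increments of \<open>F\<close>, \<open>I\<close> and
      \<open>J\<close>.\<close>
    have e3: "e / 3 > 0" using e by simp
    have sI: "s \<in> {0..R}" using s by simp
    show "\<forall>\<^sub>F h in at_right 0. \<phi> (s + h) \<le> \<phi> s"
      using ev[OF s e3] has_vector_derivative_right_increment[OF I'[OF sI] s e3]
        has_vector_derivative_right_increment[OF J'[OF sI] s e3]
    proof eventually_elim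
      case (elim h)
      have "norm (G (s + h)) \<le> norm (G s) + norm (G (s + h) - G s)"
        using norm_triangle_ineq[of "G s" "G (s + h) - G s"] by simp
      also have "G (s + h) - G s = (F (s + h) - F s - h *\<^sub>R D s) - (I (s + h) - I s - h *\<^sub>R D s)"
        by (simp add: G_def)
      also have "norm \<dots> \<le> (B s + e / 3) * h + e / 3 * h"
        by (rule order_trans[OF norm_triangle_ineq4 add_mono[OF elim(1,2)]])
      finally have "norm (G (s + h)) \<le> norm (G s) + ((B s + e / 3) * h + e / 3 * h)" by simp
      moreover have "\<bar>J (s + h) - J s - h * B s\<bar> \<le> e / 3 * h" using elim(3) by simp
      then have "h * B s - e / 3 * h \<le> J (s + h) - J s" by linarith
      ultimately show ?case unfolding \<phi>_def by (simp add: algebra_simps)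
    qed
  qed
  then have "norm (G R) \<le> J R + e * R" by (simp add: \<phi>_def G_def I_def J_def)
  also have "e * R \<le> \<epsilon>" using R \<epsilon> by (simp add: e_def field_simps)
  finally show "norm (F R - F 0 - integral {0..R} D) \<le> integral {0..R} B + \<epsilon>"
    by (simp add: G_def I_def J_def)
qed

text \<open>A global form of C^{1,1}: a bounded continuous derivative and a second-order Taylor
  remainder with one constant for all times. Both survive translation, subtraction and convolution,
  and the uniform constant allows remainders to be integrated over space.\<close>

definition test_fn :: "(real \<Rightarrow> 'k::real_normed_vector) \<Rightarrow> (real \<Rightarrow> 'k) \<Rightarrow> bool"
  where "test_fn \<Psi> \<Psi>' \<longleftrightarrow> continuous_on UNIV \<Psi>' \<and> bounded (range \<Psi>') \<and>
    (\<exists>L. \<forall>t h. norm (\<Psi> (t + h) - \<Psi> t - h *\<^sub>R \<Psi>' t) \<le> L * h\<^sup>2)"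

lemma test_fnE:
  assumes "test_fn \<Psi> \<Psi>'"
  obtains K L where "K > 0" "L > 0" "\<And>t. norm (\<Psi>' t) \<le> K"
    "\<And>t h. norm (\<Psi> (t + h) - \<Psi> t - h *\<^sub>R \<Psi>' t) \<le> L * h\<^sup>2"
proof -
  obtain K where K: "K > 0" "\<And>t. norm (\<Psi>' t) \<le> K"
    using assms unfolding test_fn_def bounded_pos by auto
  obtain L where L: "\<And>t h. norm (\<Psi> (t + h) - \<Psi> t - h *\<^sub>R \<Psi>' t) \<le> L * h\<^sup>2"
    using assms unfolding test_fn_def by auto
  have "norm (\<Psi> (t + h) - \<Psi> t - h *\<^sub>R \<Psi>' t) \<le> (max L 1) * h\<^sup>2" for t h
    by (rule order_trans[OF L mult_right_mono]) auto
  with K show thesis using that[of K "max L 1"] by auto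
qed

lemma test_fn_derivative:
  assumes "test_fn \<Psi> \<Psi>'"
  shows "(\<Psi> has_vector_derivative \<Psi>' t) (at t within S)"
proof -
  obtain K L where L: "L > 0" "\<And>t h. norm (\<Psi> (t + h) - \<Psi> t - h *\<^sub>R \<Psi>' t) \<le> L * h\<^sup>2"
    by (rule test_fnE[OF assms]) blast
  have "\<exists>d>0. \<forall>y\<in>S. norm (y - t) < d \<longrightarrow> norm (\<Psi> y - \<Psi> t - (y - t) *\<^sub>R \<Psi>' t) \<le> e * norm (y - t)"
    if "e > 0" for e
  proof (intro exI[of _ "e / L"] conjI ballI impI)
    show "e / L > 0" using that L by simp
    fix y assume y: "norm (y - t) < e / L"
    have "norm (\<Psi> y - \<Psi> t - (y - t) *\<^sub>R \<Psi>' t) \<le> L * (y - t)\<^sup>2" using L(2)[of t "y - t"] by simp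
    also have "\<dots> = (L * norm (y - t)) * norm (y - t)" by (simp add: power2_eq_square)
    also have "\<dots> \<le> e * norm (y - t)" using y L(1) by (intro mult_right_mono) (auto simp: field_simps)
    finally show "norm (\<Psi> y - \<Psi> t - (y - t) *\<^sub>R \<Psi>' t) \<le> e * norm (y - t)" .
  qed
  then show ?thesis
    unfolding has_vector_derivative_def has_derivative_within_alt
    by (auto intro: bounded_linear_scaleR_left)
qed

lemma test_fn_continuous:
  assumes "test_fn \<Psi> \<Psi>'"
  shows "continuous_on S \<Psi>"
  unfolding continuous_on_eq_continuous_within
  by (blast intro: has_vector_derivative_continuous test_fn_derivative[OF assms])

lemma test_fn_lipschitz:
  assumes "test_fn \<Psi> \<Psi>'"
  obtains K where "K > 0" "\<And>s t. norm (\<Psi> s - \<Psi> t) \<le> K * \<bar>s - t\<bar>"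
proof -
  obtain K L where K: "K > 0" "\<And>t. norm (\<Psi>' t) \<le> K" by (rule test_fnE[OF assms]) blast
  have "norm (\<Psi> s - \<Psi> t) \<le> K * norm (s - t)" for s t
  proof (rule differentiable_bound[of UNIV])
    show "(\<Psi> has_derivative (\<lambda>h. h *\<^sub>R \<Psi>' x)) (at x within UNIV)" for x
      using test_fn_derivative[OF assms] unfolding has_vector_derivative_def .
    show "onorm (\<lambda>h. h *\<^sub>R \<Psi>' x) \<le> K" for x
    proof (rule onorm_le)
      fix y :: real show "norm (y *\<^sub>R \<Psi>' x) \<le> K * norm y"
        using mult_right_mono[OF K(2)[of x] abs_ge_zero[of y]] by (simp add: mult.commute)
    qed
  qed auto
  then show thesis using that[OF K(1)] by simp
qed

lemma test_fn_shift:
  assumes "test_fn \<Psi> \<Psi>'"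
  shows "test_fn (\<lambda>r. \<Psi> (s + r)) (\<lambda>r. \<Psi>' (s + r))"
proof -
  obtain K L where *: "\<And>t. norm (\<Psi>' t) \<le> K"
    "\<And>t h. norm (\<Psi> (t + h) - \<Psi> t - h *\<^sub>R \<Psi>' t) \<le> L * h\<^sup>2"
    by (rule test_fnE[OF assms]) blast
  have c: "continuous_on UNIV \<Psi>'" using assms by (simp add: test_fn_def)
  show ?thesis unfolding test_fn_def
  proof (intro conjI)
    show "continuous_on UNIV (\<lambda>r. \<Psi>' (s + r))"
      by (rule continuous_on_compose2[OF c]) (auto intro!: continuous_intros)
    show "bounded (range (\<lambda>r. \<Psi>' (s + r)))" using *(1) by (auto intro!: boundedI)
    show "\<exists>L. \<forall>t h. norm (\<Psi> (s + (t + h)) - \<Psi> (s + t) - h *\<^sub>R \<Psi>' (s + t)) \<le> L * h\<^sup>2"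
      using *(2)[of "s + _"] by (auto simp: add.assoc)
  qed
qed

lemma test_fn_diff:
  assumes "test_fn \<Psi> \<Psi>'" "test_fn \<Phi> \<Phi>'"
  shows "test_fn (\<lambda>r. \<Psi> r - \<Phi> r) (\<lambda>r. \<Psi>' r - \<Phi>' r)"
proof -
  obtain K L where 1: "\<And>t. norm (\<Psi>' t) \<le> K"
    "\<And>t h. norm (\<Psi> (t + h) - \<Psi> t - h *\<^sub>R \<Psi>' t) \<le> L * h\<^sup>2"
    by (rule test_fnE[OF assms(1)]) blast
  obtain K' L' where 2: "\<And>t. norm (\<Phi>' t) \<le> K'"
    "\<And>t h. norm (\<Phi> (t + h) - \<Phi> t - h *\<^sub>R \<Phi>' t) \<le> L' * h\<^sup>2"
    by (rule test_fnE[OF assms(2)]) blast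
  show ?thesis unfolding test_fn_def
  proof (intro conjI exI[of _ "L + L'"] allI)
    show "continuous_on UNIV (\<lambda>r. \<Psi>' r - \<Phi>' r)"
      using assms unfolding test_fn_def by (intro continuous_intros) auto
    show "bounded (range (\<lambda>r. \<Psi>' r - \<Phi>' r))"
      using 1(1) 2(1) by (auto intro!: boundedI[of _ "K + K'"] order_trans[OF norm_triangle_ineq4 add_mono])
    fix t h
    have eq: "\<Psi> (t + h) - \<Phi> (t + h) - (\<Psi> t - \<Phi> t) - h *\<^sub>R (\<Psi>' t - \<Phi>' t)
        = (\<Psi> (t + h) - \<Psi> t - h *\<^sub>R \<Psi>' t) - (\<Phi> (t + h) - \<Phi> t - h *\<^sub>R \<Phi>' t)"
      by (simp add: scaleR_diff_right)
    show "norm (\<Psi> (t + h) - \<Phi> (t + h) - (\<Psi> t - \<Phi> t) - h *\<^sub>R (\<Psi>' t - \<Phi>' t)) \<le> (L + L') * h\<^sup>2"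
      using norm_triangle_ineq4[of "\<Psi> (t + h) - \<Psi> t - h *\<^sub>R \<Psi>' t" "\<Phi> (t + h) - \<Phi> t - h *\<^sub>R \<Phi>' t"]
        1(2)[of t h] 2(2)[of t h] unfolding eq by (simp add: distrib_right)
  qed
qed

text \<open>All regularity falls on \<psi>, as \<alpha> is only continuous; the constants of \<psi>
  are multiplied by a bound for \<alpha> and by \<open>t0\<close>.\<close>

lemma test_fn_convolution:
  fixes \<alpha> \<psi> :: "real \<Rightarrow> 'k::{euclidean_space,real_normed_field}"
  assumes t0: "0 \<le> t0" and \<alpha>: "continuous_on {0..t0} \<alpha>" and \<psi>: "test_fn \<psi> \<psi>'"
  shows "test_fn (\<lambda>r. integral {0..t0} (\<lambda>s. \<alpha> s * \<psi> (s + r))) (\<lambda>r. integral {0..t0} (\<lambda>s. \<alpha> s * \<psi>' (s + r)))"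
proof -
  obtain K L where KL: "K > 0" "L > 0" "\<And>t. norm (\<psi>' t) \<le> K"
    "\<And>t h. norm (\<psi> (t + h) - \<psi> t - h *\<^sub>R \<psi>' t) \<le> L * h\<^sup>2"
    by (rule test_fnE[OF \<psi>]) blast
  obtain A where A: "A > 0" "\<And>s. s \<in> {0..t0} \<Longrightarrow> norm (\<alpha> s) \<le> A"
    using continuous_on_Icc_bounded[OF \<alpha>] by blast
  have c': "continuous_on UNIV \<psi>'" using \<psi> by (simp add: test_fn_def)
  have c: "continuous_on UNIV \<psi>" using \<psi> by (rule test_fn_continuous)
  have int: "(\<lambda>s. \<alpha> s * \<psi> (s + r)) integrable_on {0..t0}" "(\<lambda>s. \<alpha> s * \<psi>' (s + r)) integrable_on {0..t0}" for r
    by (intro integrable_continuous_real continuous_on_mult \<alpha> continuous_on_compose2[OF c]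
        continuous_on_compose2[OF c'] continuous_intros subset_UNIV)+
  show ?thesis unfolding test_fn_def
  proof (intro conjI exI[of _ "A * L * t0"] allI)
    have "continuous_on (UNIV \<times> cbox 0 t0) (\<lambda>(r, s). \<alpha> s * \<psi>' (s + r))"
      unfolding split_beta
      by (intro continuous_on_mult continuous_on_compose2[OF \<alpha>] continuous_on_compose2[OF c'] continuous_intros) auto
    from integral_continuous_on_param[OF this]
    show "continuous_on UNIV (\<lambda>r. integral {0..t0} (\<lambda>s. \<alpha> s * \<psi>' (s + r)))" by simp
    have "norm (integral {0..t0} (\<lambda>s. \<alpha> s * \<psi>' (s + r))) \<le> A * K * (t0 - 0)" for r
      using A KL t0
      by (intro integral_bound continuous_on_mult \<alpha> continuous_on_compose2[OF c'] continuous_intros)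
         (auto simp: norm_mult intro!: mult_mono)
    then show "bounded (range (\<lambda>r. integral {0..t0} (\<lambda>s. \<alpha> s * \<psi>' (s + r))))"
      by (intro boundedI) auto
    fix r h
    have "integral {0..t0} (\<lambda>s. \<alpha> s * \<psi> (s + (r + h))) - integral {0..t0} (\<lambda>s. \<alpha> s * \<psi> (s + r))
        - h *\<^sub>R integral {0..t0} (\<lambda>s. \<alpha> s * \<psi>' (s + r))
      = integral {0..t0} (\<lambda>s. \<alpha> s * (\<psi> (s + r + h) - \<psi> (s + r) - h *\<^sub>R \<psi>' (s + r)))"
    proof (rule integral_unique[symmetric])
      have "((\<lambda>s. \<alpha> s * \<psi> (s + (r + h)) - \<alpha> s * \<psi> (s + r) - h *\<^sub>R (\<alpha> s * \<psi>' (s + r))) has_integral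
          integral {0..t0} (\<lambda>s. \<alpha> s * \<psi> (s + (r + h))) - integral {0..t0} (\<lambda>s. \<alpha> s * \<psi> (s + r))
          - h *\<^sub>R integral {0..t0} (\<lambda>s. \<alpha> s * \<psi>' (s + r))) {0..t0}"
        by (intro has_integral_diff has_integral_cmul integrable_integral int)
      then show "((\<lambda>s. \<alpha> s * (\<psi> (s + r + h) - \<psi> (s + r) - h *\<^sub>R \<psi>' (s + r))) has_integral
          integral {0..t0} (\<lambda>s. \<alpha> s * \<psi> (s + (r + h))) - integral {0..t0} (\<lambda>s. \<alpha> s * \<psi> (s + r))
          - h *\<^sub>R integral {0..t0} (\<lambda>s. \<alpha> s * \<psi>' (s + r))) {0..t0}"
        by (simp add: right_diff_distrib add.assoc)
    qed
    also have "norm \<dots> \<le> A * (L * h\<^sup>2) * (t0 - 0)"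
      using A KL t0
      by (intro integral_bound continuous_on_mult \<alpha> continuous_on_diff continuous_on_scaleR
          continuous_on_compose2[OF c'] continuous_on_compose2[OF c] continuous_intros)
         (auto simp: norm_mult intro!: mult_mono)
    finally show "norm (integral {0..t0} (\<lambda>s. \<alpha> s * \<psi> (s + (r + h))) - integral {0..t0} (\<lambda>s. \<alpha> s * \<psi> (s + r))
        - h *\<^sub>R integral {0..t0} (\<lambda>s. \<alpha> s * \<psi>' (s + r))) \<le> A * L * t0 * h\<^sup>2"
      by (simp add: mult_ac)
  qed
qed

text \<open>The quadratic B-spline.\<close>

lemma bump_fn:
  fixes l r :: real
  assumes "l < r"
  obtains \<psi> \<psi>' where "test_fn \<psi> \<psi>'" "\<And>t. 0 \<le> \<psi> t" "\<And>t. t \<notin> {l..r} \<Longrightarrow> \<psi> t = (0::real)"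
    "\<psi> ((l + r) / 2) > 0"
proof -
  define p where "p x = (max 0 x)\<^sup>2" for x :: real
  define q where "q x = 2 * max 0 x" for x :: real
  \<comment> \<open>Third difference of the truncated square. The binomial weights annihilate
    quadratics, so \<open>S\<close> vanishes to the right of 3 as well as to the left of 0.\<close>
  define S where "S x = p x - 3 * p (x - 1) + 3 * p (x - 2) - p (x - 3)" for x
  define S' where "S' x = q x - 3 * q (x - 1) + 3 * q (x - 2) - q (x - 3)" for x
  define d where "d = (r - l) / 3"
  have d: "d > 0" "r = l + 3 * d" using assms by (auto simp: d_def field_simps)
  have pq: "\<bar>p (x + h) - p x - h * q x\<bar> \<le> h\<^sup>2" for x h
  proof (cases "0 \<le> x"; cases "0 \<le> x + h")
    assume "0 \<le> x" "0 \<le> x + h"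
    then show ?thesis by (simp add: p_def q_def power2_sum)
  next
    assume *: "0 \<le> x" "\<not> 0 \<le> x + h"
    have "0 \<le> x * (- 2 * h - x)" using * by (intro mult_nonneg_nonneg) auto
    moreover have "0 \<le> (x + h)\<^sup>2" by simp
    moreover have "p (x + h) - p x - h * q x = x * (- 2 * h - x)"
      using * by (simp add: p_def q_def power2_eq_square algebra_simps)
    ultimately show ?thesis by (simp add: power2_eq_square algebra_simps)
  next
    assume *: "\<not> 0 \<le> x" "0 \<le> x + h"
    then have "(x + h)\<^sup>2 \<le> h\<^sup>2" by (intro power_mono) auto
    then show ?thesis using * by (simp add: p_def q_def)
  qed (simp_all add: p_def q_def)
  have Sq: "\<bar>S (x + h) - S x - h * S' x\<bar> \<le> 8 * h\<^sup>2" for x h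
  proof -
    \<comment> \<open>The Taylor remainder of the truncated square. The absolute weights 1, 3, 3, 1
      add up to the constant 8.\<close>
    define E where "E y = p (y + h) - p y - h * q y" for y
    have "S (x + h) - S x - h * S' x = E x - 3 * E (x - 1) + 3 * E (x - 2) - E (x - 3)"
      by (simp add: S_def S'_def E_def algebra_simps)
    moreover have "\<bar>E y\<bar> \<le> h\<^sup>2" for y using pq[of y h] by (simp add: E_def)
    from this[of x] this[of "x - 1"] this[of "x - 2"] this[of "x - 3"]
    have "\<bar>E x - 3 * E (x - 1) + 3 * E (x - 2) - E (x - 3)\<bar> \<le> 8 * h\<^sup>2" by linarith
    ultimately show ?thesis by simp
  qed
  have S_out: "S x = 0" if "x < 0 \<or> x > 3" for x
    using that by (auto simp: S_def p_def power2_eq_square algebra_simps)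
  have S_pos: "0 \<le> S x" for x
  proof -
    consider "x < 0 \<or> x > 3" | "0 \<le> x" "x \<le> 1" | "1 < x" "x \<le> 2" | "2 < x" "x \<le> 3" by linarith
    then show ?thesis
    proof cases
      case 3
      have "0 \<le> 1 + 2 * ((x - 1) * (2 - x))" using 3 by (intro add_nonneg_nonneg mult_nonneg_nonneg) auto
      also have "\<dots> = S x" using 3 by (simp add: S_def p_def power2_eq_square algebra_simps)
      finally show ?thesis .
    next
      case 4
      have "S x = (3 - x)\<^sup>2" using 4 by (simp add: S_def p_def power2_eq_square algebra_simps)
      then show ?thesis by simp
    qed (auto simp: S_out, simp add: S_def p_def)
  qed
  have S'_bound: "\<bar>S' x\<bar> \<le> 24" for x
    unfolding S'_def q_def by (cases "x < 0"; cases "x < 1"; cases "x < 2"; cases "x < 3") auto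
  define \<psi> where "\<psi> t = S ((t - l) / d)" for t
  define \<psi>' where "\<psi>' t = S' ((t - l) / d) / d" for t
  show thesis
  proof (rule that[of \<psi> \<psi>'])
    show "test_fn \<psi> \<psi>'" unfolding test_fn_def
    proof (intro conjI exI[of _ "8 / d\<^sup>2"] allI)
      show "continuous_on UNIV \<psi>'"
        unfolding \<psi>'_def S'_def q_def using d by (intro continuous_intros) auto
      show "bounded (range \<psi>')"
        using S'_bound d unfolding \<psi>'_def by (intro boundedI[of _ "24 / d"]) (auto simp: divide_le_cancel)
      fix t h
      have "\<psi> (t + h) - \<psi> t - h *\<^sub>R \<psi>' t = S ((t - l) / d + h / d) - S ((t - l) / d) - h / d * S' ((t - l) / d)"
        using d(1) by (simp add: \<psi>_def \<psi>'_def add_divide_distrib diff_divide_distrib algebra_simps)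
      then show "norm (\<psi> (t + h) - \<psi> t - h *\<^sub>R \<psi>' t) \<le> 8 / d\<^sup>2 * h\<^sup>2"
        using Sq[of "(t - l) / d" "h / d"] by (simp add: power_divide)
    qed
    show "0 \<le> \<psi> t" for t using S_pos by (simp add: \<psi>_def)
    show "\<psi> t = 0" if "t \<notin> {l..r}" for t
      using that d unfolding \<psi>_def by (intro S_out) (auto simp: field_simps)
    have "\<psi> ((l + r) / 2) = S (3 / 2)"
      unfolding \<psi>_def using d by (intro arg_cong[of _ _ S]) (simp add: field_simps)
    then show "0 < \<psi> ((l + r) / 2)" by (simp add: S_def p_def power2_eq_square)
  qed
qed

lemma test_fn_of_real:
  assumes "test_fn \<psi> \<psi>'"
  shows "test_fn (\<lambda>t. of_real (\<psi> t) :: 'k::real_normed_field) (\<lambda>t. of_real (\<psi>' t))"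
proof -
  obtain K L where *: "\<And>t. norm (\<psi>' t) \<le> K"
    "\<And>t h. norm (\<psi> (t + h) - \<psi> t - h *\<^sub>R \<psi>' t) \<le> L * h\<^sup>2"
    by (rule test_fnE[OF assms]) blast
  show ?thesis unfolding test_fn_def
  proof (intro conjI exI[of _ L] allI)
    show "continuous_on UNIV (\<lambda>t. of_real (\<psi>' t) :: 'k)"
      using assms by (intro continuous_intros) (simp add: test_fn_def)
    show "bounded (range (\<lambda>t. of_real (\<psi>' t) :: 'k))" using *(1) by (auto intro!: boundedI)
    fix t h
    have "of_real (\<psi> (t + h)) - of_real (\<psi> t) - h *\<^sub>R of_real (\<psi>' t) = (of_real (\<psi> (t + h) - \<psi> t - h *\<^sub>R \<psi>' t) :: 'k)"
      by (simp add: scaleR_conv_of_real)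
    then show "norm (of_real (\<psi> (t + h)) - of_real (\<psi> t) - h *\<^sub>R of_real (\<psi>' t) :: 'k) \<le> L * h\<^sup>2"
      using *(2)[of t h] by (metis norm_of_real real_norm_def)
  qed
qed

section \<open>The semigroup\<close>

text \<open>The semigroup is homogeneous with respect to field scalars; the real factors of time
  increments enter through this identity.\<close>

lemma scaleR_eq_smult: "r *\<^sub>R v = (of_real r :: 'k) *s (v :: 'k::real_normed_field^'n)"
  unfolding vec_eq_iff vector_scaleR_component vector_smult_component
  by (simp add: scaleR_conv_of_real)

text \<open>Covers pairings in which the functional moves together with the state: the first term is
  the change of the state, the second the Lipschitz change of the functional. It serves the
  multiplier pairing and the adjoint pairing alike.\<close>

lemma curve_pairing_continuous:
  fixes q :: "real \<Rightarrow> 'v::real_normed_vector"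
  assumes q: "\<And>s t. s \<in> I \<Longrightarrow> t \<in> I \<Longrightarrow>
      norm (q s - q t) \<le> M * L1_norm a b (\<lambda>\<xi>. x s \<xi> - x t \<xi>) + K * \<bar>s - t\<bar> * L1_norm a b (x t)"
    and x: "\<And>t. t \<in> I \<Longrightarrow> ((\<lambda>s. L1_norm a b (\<lambda>\<xi>. x s \<xi> - x t \<xi>)) \<longlongrightarrow> 0) (at t within I)"
  shows "continuous_on I q"
  unfolding continuous_on_def
proof
  fix t assume t: "t \<in> I"
  have "((\<lambda>s. M * L1_norm a b (\<lambda>\<xi>. x s \<xi> - x t \<xi>) + K * \<bar>s - t\<bar> * L1_norm a b (x t))
      \<longlongrightarrow> M * 0 + K * \<bar>t - t\<bar> * L1_norm a b (x t)) (at t within I)"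
    by (intro tendsto_intros x t)
  then have "((\<lambda>s. M * L1_norm a b (\<lambda>\<xi>. x s \<xi> - x t \<xi>) + K * \<bar>s - t\<bar> * L1_norm a b (x t))
      \<longlongrightarrow> 0) (at t within I)" by simp
  moreover have "\<forall>\<^sub>F s in at t within I. norm (q s - q t)
      \<le> M * L1_norm a b (\<lambda>\<xi>. x s \<xi> - x t \<xi>) + K * \<bar>s - t\<bar> * L1_norm a b (x t)"
    unfolding eventually_at_filter using q t by (intro always_eventually) auto
  ultimately show "(q \<longlongrightarrow> q t) (at t within I)"
    by - (rule LIM_zero_cancel, rule Lim_null_comparison)
qed

locale stable_hyperbolic = hyperbolic a b P1 P0 H
  for a b :: real and P1 :: "'k::real_or_complex^'n^'n" and P0 H :: "real \<Rightarrow> 'k^'n^'n" +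
  fixes WB :: "'k^('n + 'n)^'n" and T :: "real \<Rightarrow> (real \<Rightarrow> 'k^'n) \<Rightarrow> (real \<Rightarrow> 'k^'n)"
    and C \<omega> :: real
  assumes gen: "generates (L1_space a b) (L1_norm a b) (hyp_graph a b (L1_space a b) P1 P0 H WB) T"
    and C_pos: "0 < C" and \<omega>_pos: "0 < \<omega>"
    and decay: "\<And>t f. 0 \<le> t \<Longrightarrow> f \<in> L1_space a b \<Longrightarrow>
      L1_norm a b (T t f) \<le> C * exp (- \<omega> * t) * L1_norm a b f"
begin

section \<open>The domain of the generator as a linear relation\<close>

abbreviation "dom_A \<equiv> hyp_graph a b V P1 P0 H WB"

lemma sg: "C0_semigroup V N T" and gen_eq: "generator V N T = dom_A"
  using gen by (auto simp: generates_def)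

lemma dom_A_iff: "(f, g) \<in> dom_A \<longleftrightarrow> (\<exists>w. hyp f w g \<and> WB *v stack_vec (w b) (w a) = 0)"
  by (simp add: hyp_graph_def)

lemma dom_A_V: "(f, g) \<in> dom_A \<Longrightarrow> f \<in> V" "(f, g) \<in> dom_A \<Longrightarrow> g \<in> V"
  unfolding dom_A_iff hyp_op_def by blast+

lemma dom_A_add:
  assumes "(f, g) \<in> dom_A" "(f', g') \<in> dom_A"
  shows "(\<lambda>\<xi>. f \<xi> + f' \<xi>, \<lambda>\<xi>. g \<xi> + g' \<xi>) \<in> dom_A"
proof -
  obtain w w' where w: "hyp f w g" "WB *v stack_vec (w b) (w a) = 0"
    "hyp f' w' g'" "WB *v stack_vec (w' b) (w' a) = 0" using assms unfolding dom_A_iff by blast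
  show ?thesis unfolding dom_A_iff using hyp_add[OF w(1,3)] w(2,4)
    by (intro exI[of _ "\<lambda>\<xi>. w \<xi> + w' \<xi>"]) (simp add: stack_vec_add matrix_vector_right_distrib)
qed

lemma dom_A_smult:
  assumes "(f, g) \<in> dom_A"
  shows "(\<lambda>\<xi>. c *s f \<xi>, \<lambda>\<xi>. c *s g \<xi>) \<in> dom_A"
proof -
  obtain w where w: "hyp f w g" "WB *v stack_vec (w b) (w a) = 0"
    using assms unfolding dom_A_iff by blast
  show ?thesis unfolding dom_A_iff using hyp_smult[OF w(1), of c] w(2)
    by (intro exI[of _ "\<lambda>\<xi>. c *s w \<xi>"]) (simp add: stack_vec_smult vector_scalar_commute)
qed

lemma dom_A_diff:
  assumes "(f, g) \<in> dom_A" "(f', g') \<in> dom_A"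
  shows "(\<lambda>\<xi>. f \<xi> - f' \<xi>, \<lambda>\<xi>. g \<xi> - g' \<xi>) \<in> dom_A"
  using dom_A_add[OF assms(1) dom_A_smult[OF assms(2), of "-1"]] by simp

lemma dom_A_sum:
  assumes "finite I" "\<And>i. i \<in> I \<Longrightarrow> (f i, g i) \<in> dom_A"
  shows "(\<lambda>\<xi>. \<Sum>i\<in>I. c i *s f i \<xi>, \<lambda>\<xi>. \<Sum>i\<in>I. c i *s g i \<xi>) \<in> dom_A"
  using assms
proof (induction I)
  case empty
  show ?case unfolding dom_A_iff
    by (rule exI[of _ "\<lambda>_. 0"]) (simp add: hyp_0 stack_vec_0)
next
  case (insert i I)
  then show ?case using dom_A_add[OF dom_A_smult[of "f i" "g i" "c i"]] by simp
qed

lemma dom_A_dense: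
  assumes "f \<in> V" "0 < e"
  shows "\<exists>f' g. (f', g) \<in> dom_A \<and> N (\<lambda>\<xi>. f \<xi> - f' \<xi>) < e"
proof -
  obtain f' w g where w: "hyp f' w g" "w b = 0" "w a = 0" "N (\<lambda>\<xi>. f \<xi> - f' \<xi>) < e"
    using hyp_dense[OF assms] by blast
  have "(f', g) \<in> dom_A" unfolding dom_A_iff
    by (rule exI[of _ w]) (simp add: w stack_vec_0)
  with w(4) show ?thesis by blast
qed

section \<open>Semigroup laws as identities almost everywhere\<close>

lemma T_V: "0 \<le> t \<Longrightarrow> f \<in> V \<Longrightarrow> T t f \<in> V"
  using sg unfolding C0_semigroup_def by blast

lemma N_diff_eq_0_iff:
  assumes "f \<in> V" "g \<in> V"
  shows "N (\<lambda>\<xi>. f \<xi> - g \<xi>) = 0 \<longleftrightarrow> (AE \<xi> in lebesgue_on {a..b}. f \<xi> = g \<xi>)"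
  using L1_norm_eq_0_iff[OF L1_space_diff[OF assms]] by simp

lemma T_add:
  assumes "0 \<le> t" "f \<in> V" "g \<in> V"
  shows "AE \<xi> in lebesgue_on {a..b}. T t (\<lambda>\<eta>. f \<eta> + g \<eta>) \<xi> = T t f \<xi> + T t g \<xi>"
proof -
  have "N (\<lambda>\<xi>. T t (\<lambda>\<eta>. f \<eta> + g \<eta>) \<xi> - (T t f \<xi> + T t g \<xi>)) = 0"
    using sg assms unfolding C0_semigroup_def by blast
  then show ?thesis
    by (subst (asm) N_diff_eq_0_iff) (auto intro!: T_V L1_space_add assms)
qed

lemma T_smult:
  assumes "0 \<le> t" "f \<in> V"
  shows "AE \<xi> in lebesgue_on {a..b}. T t (\<lambda>\<eta>. c *s f \<eta>) \<xi> = c *s T t f \<xi>"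
proof -
  have "N (\<lambda>\<xi>. T t (\<lambda>\<eta>. c *s f \<eta>) \<xi> - c *s T t f \<xi>) = 0"
    using sg assms unfolding C0_semigroup_def by blast
  then show ?thesis
    by (subst (asm) N_diff_eq_0_iff) (auto intro!: T_V L1_space_smult assms)
qed

lemma T_diff:
  assumes "0 \<le> t" "f \<in> V" "g \<in> V"
  shows "AE \<xi> in lebesgue_on {a..b}. T t (\<lambda>\<eta>. f \<eta> - g \<eta>) \<xi> = T t f \<xi> - T t g \<xi>"
proof -
  have "AE \<xi> in lebesgue_on {a..b}. T t (\<lambda>\<eta>. (f \<eta> - g \<eta>) + g \<eta>) \<xi> = T t (\<lambda>\<eta>. f \<eta> - g \<eta>) \<xi> + T t g \<xi>"
    by (intro T_add L1_space_diff assms)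
  then show ?thesis by eventually_elim simp
qed

lemma T_0:
  assumes "f \<in> V"
  shows "AE \<xi> in lebesgue_on {a..b}. T 0 f \<xi> = f \<xi>"
proof -
  have "N (\<lambda>\<xi>. T 0 f \<xi> - f \<xi>) = 0"
    using sg assms unfolding C0_semigroup_def by blast
  then show ?thesis
    by (subst (asm) N_diff_eq_0_iff) (use assms in \<open>auto intro!: T_V\<close>)
qed

lemma T_plus:
  assumes "0 \<le> s" "0 \<le> t" "f \<in> V"
  shows "AE \<xi> in lebesgue_on {a..b}. T (s + t) f \<xi> = T s (T t f) \<xi>"
proof -
  have "N (\<lambda>\<xi>. T (s + t) f \<xi> - T s (T t f) \<xi>) = 0"
    using sg assms unfolding C0_semigroup_def by blast
  then show ?thesis
    by (subst (asm) N_diff_eq_0_iff) (use assms in \<open>auto intro!: T_V\<close>)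
qed

lemma T_bound:
  assumes "0 \<le> t" "f \<in> V"
  shows "N (T t f) \<le> C * N f"
proof -
  have "C * exp (- \<omega> * t) * N f \<le> C * 1 * N f"
    using assms C_pos \<omega>_pos by (intro mult_right_mono mult_left_mono L1_norm_nonneg) auto
  with decay[OF assms] show ?thesis by simp
qed

lemma T_diff_bound:
  assumes "0 \<le> t" "f \<in> V" "g \<in> V"
  shows "N (\<lambda>\<xi>. T t f \<xi> - T t g \<xi>) \<le> C * N (\<lambda>\<xi>. f \<xi> - g \<xi>)"
proof -
  have "N (\<lambda>\<xi>. T t f \<xi> - T t g \<xi>) = N (T t (\<lambda>\<eta>. f \<eta> - g \<eta>))"
    by (rule L1_norm_cong_AE[symmetric, OF T_diff[OF assms]]) (intro T_V L1_space_diff assms)+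
  also have "\<dots> \<le> C * N (\<lambda>\<xi>. f \<xi> - g \<xi>)" by (intro T_bound L1_space_diff assms)
  finally show ?thesis .
qed

text \<open>Up to null sets, the function on the left is \<open>T t\<close> applied to
  \<open>T h f - f - g\<close>. Increments at time \<open>t\<close> are thus controlled by those at
  0.\<close>

lemma T_increment_le:
  assumes "0 \<le> t" "0 \<le> h" "f \<in> V" "g \<in> V"
  shows "N (\<lambda>\<xi>. T (t + h) f \<xi> - T t f \<xi> - T t g \<xi>) \<le> C * N (\<lambda>\<xi>. T h f \<xi> - f \<xi> - g \<xi>)"
proof -
  have V: "T h f \<in> V" "T t f \<in> V" "T t g \<in> V" "T t (T h f) \<in> V" "T (t + h) f \<in> V"
    using assms by (auto intro!: T_V)
  have V2: "(\<lambda>\<xi>. T h f \<xi> - f \<xi>) \<in> V" "(\<lambda>\<xi>. T h f \<xi> - f \<xi> - g \<xi>) \<in> V"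
    by (intro L1_space_diff V assms)+
  have "AE \<xi> in lebesgue_on {a..b}. T (t + h) f \<xi> - T t f \<xi> - T t g \<xi>
      = T t (\<lambda>\<eta>. T h f \<eta> - f \<eta> - g \<eta>) \<xi>"
    using T_plus[OF assms(1-3)] T_diff[OF assms(1) V(1) assms(3)] T_diff[OF assms(1) V2(1) assms(4)]
    by eventually_elim simp
  then have "N (\<lambda>\<xi>. T (t + h) f \<xi> - T t f \<xi> - T t g \<xi>) = N (T t (\<lambda>\<eta>. T h f \<eta> - f \<eta> - g \<eta>))"
    by (rule L1_norm_cong_AE) (intro L1_space_diff T_V V V2 assms)+
  also have "\<dots> \<le> C * N (\<lambda>\<xi>. T h f \<xi> - f \<xi> - g \<xi>)" by (rule T_bound[OF assms(1) V2(2)])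
  finally show ?thesis .
qed

section \<open>Orbits starting in the domain\<close>

lemma dom_A_right_increment:
  assumes "(f, g) \<in> dom_A" "0 < e"
  shows "\<forall>\<^sub>F h in at_right 0. N (\<lambda>\<xi>. T h f \<xi> - f \<xi> - h *\<^sub>R g \<xi>) \<le> e * h"
proof -
  have "((\<lambda>h. N (\<lambda>\<xi>. (1 / h) *\<^sub>R (T h f \<xi> - f \<xi>) - g \<xi>)) \<longlongrightarrow> 0) (at_right 0)"
    using assms(1) unfolding gen_eq[symmetric] generator_def by auto
  from order_tendstoD(2)[OF this assms(2)] eventually_at_right_less[of "0::real"]
  show ?thesis
  proof eventually_elim
    case (elim h)
    have "N (\<lambda>\<xi>. T h f \<xi> - f \<xi> - h *\<^sub>R g \<xi>) = N (\<lambda>\<xi>. h *\<^sub>R ((1 / h) *\<^sub>R (T h f \<xi> - f \<xi>) - g \<xi>))"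
      using elim(2) by (simp add: scaleR_diff_right)
    also have "\<dots> = h * N (\<lambda>\<xi>. (1 / h) *\<^sub>R (T h f \<xi> - f \<xi>) - g \<xi>)"
      using elim(2) by (subst L1_norm_scaleR) simp
    also have "\<dots> \<le> h * e" using elim by (intro mult_left_mono) auto
    finally show ?case by (simp add: mult.commute)
  qed
qed

lemma orbit_right_increment:
  assumes fg: "(f, g) \<in> dom_A" and t: "0 \<le> t" and e: "0 < e"
  shows "\<forall>\<^sub>F h in at_right 0. N (\<lambda>\<xi>. T (t + h) f \<xi> - T t f \<xi> - h *\<^sub>R T t g \<xi>) \<le> e * h"
proof -
  note V = dom_A_V[OF fg]
  have "0 < e / C" using e C_pos by simp
  from dom_A_right_increment[OF fg this] eventually_at_right_less[of "0::real"] show ?thesis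
  proof eventually_elim
    case (elim h)
    have hgV: "(\<lambda>\<xi>. h *\<^sub>R g \<xi>) \<in> V" by (rule L1_space_scaleR[OF V(2)])
    have VV: "T t f \<in> V" "T (t + h) f \<in> V" "T t g \<in> V" "T t (\<lambda>\<xi>. h *\<^sub>R g \<xi>) \<in> V"
      using t elim(2) V hgV by (auto intro!: T_V)
    have "AE \<xi> in lebesgue_on {a..b}. T t (\<lambda>\<xi>. h *\<^sub>R g \<xi>) \<xi> = h *\<^sub>R T t g \<xi>"
      unfolding scaleR_eq_smult by (rule T_smult[OF t V(2)])
    then have "AE \<xi> in lebesgue_on {a..b}. T (t + h) f \<xi> - T t f \<xi> - h *\<^sub>R T t g \<xi>
        = T (t + h) f \<xi> - T t f \<xi> - T t (\<lambda>\<xi>. h *\<^sub>R g \<xi>) \<xi>" by eventually_elim simp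
    then have "N (\<lambda>\<xi>. T (t + h) f \<xi> - T t f \<xi> - h *\<^sub>R T t g \<xi>)
        = N (\<lambda>\<xi>. T (t + h) f \<xi> - T t f \<xi> - T t (\<lambda>\<xi>. h *\<^sub>R g \<xi>) \<xi>)"
      by (rule L1_norm_cong_AE) (intro L1_space_diff L1_space_scaleR VV)+
    also have "\<dots> \<le> C * N (\<lambda>\<xi>. T h f \<xi> - f \<xi> - h *\<^sub>R g \<xi>)"
      using t elim(2) V hgV by (intro T_increment_le) auto
    also have "\<dots> \<le> C * (e / C * h)" using elim(1) C_pos by (intro mult_left_mono) auto
    finally show ?case using C_pos by simp
  qed
qed

text \<open>Invariance of the domain and commutation of the generator with the semigroup. As
  operators are graphs of representatives, the image can be taken to be the particular
  representative \<open>T t g\<close>.\<close>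

lemma dom_A_orbit:
  assumes fg: "(f, g) \<in> dom_A" and t: "0 \<le> t"
  shows "(T t f, T t g) \<in> dom_A"
proof -
  note V = dom_A_V[OF fg]
  have VV: "T t f \<in> V" "T t g \<in> V" using t V by (auto intro!: T_V)
  have "((\<lambda>h. N (\<lambda>\<xi>. (1 / h) *\<^sub>R (T h (T t f) \<xi> - T t f \<xi>) - T t g \<xi>)) \<longlongrightarrow> 0) (at_right 0)"
  proof (rule tendstoI)
    fix e :: real assume "0 < e"
    then have "0 < e / 2" by simp
    from orbit_right_increment[OF fg t this] eventually_at_right_less[of "0::real"]
    show "\<forall>\<^sub>F h in at_right 0. dist (N (\<lambda>\<xi>. (1 / h) *\<^sub>R (T h (T t f) \<xi> - T t f \<xi>) - T t g \<xi>)) 0 < e"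
    proof eventually_elim
      case (elim h)
      have h: "h \<ge> 0" using elim by simp
      have "AE \<xi> in lebesgue_on {a..b}. T h (T t f) \<xi> = T (t + h) f \<xi>"
        using T_plus[OF h t V(1)] by eventually_elim (simp add: add.commute)
      then have "AE \<xi> in lebesgue_on {a..b}. (1 / h) *\<^sub>R (T h (T t f) \<xi> - T t f \<xi>) - T t g \<xi>
          = (1 / h) *\<^sub>R (T (t + h) f \<xi> - T t f \<xi> - h *\<^sub>R T t g \<xi>)"
        by eventually_elim (use elim(2) in \<open>simp add: scaleR_diff_right\<close>)
      then have "N (\<lambda>\<xi>. (1 / h) *\<^sub>R (T h (T t f) \<xi> - T t f \<xi>) - T t g \<xi>)
          = N (\<lambda>\<xi>. (1 / h) *\<^sub>R (T (t + h) f \<xi> - T t f \<xi> - h *\<^sub>R T t g \<xi>))"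
        by (rule L1_norm_cong_AE) (use h t V in \<open>intro L1_space_diff L1_space_scaleR T_V VV; simp\<close>)+
      also have "\<dots> = 1 / h * N (\<lambda>\<xi>. T (t + h) f \<xi> - T t f \<xi> - h *\<^sub>R T t g \<xi>)"
        using elim(2) by (subst L1_norm_scaleR) simp
      also have "\<dots> \<le> 1 / h * (e / 2 * h)" using elim by (intro mult_left_mono) auto
      finally show ?case using elim(2) \<open>0 < e\<close> by (simp add: L1_norm_nonneg)
    qed
  qed
  with VV show ?thesis unfolding gen_eq[symmetric] generator_def by simp
qed

text \<open>Right continuity at 0 gives a \<open>d\<close> that works for every starting time,
  because each \<open>T r\<close> is bounded by \<open>C\<close>. A left increment at
  \<open>t\<close> is a right increment at an earlier time, so the limit is two-sided.\<close>

lemma T_tendsto: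
  assumes f: "f \<in> V" and t: "0 \<le> t" and I: "I \<subseteq> {0..}"
  shows "((\<lambda>s. N (\<lambda>\<xi>. T s f \<xi> - T t f \<xi>)) \<longlongrightarrow> 0) (at t within I)"
proof (rule tendstoI)
  fix e :: real assume e: "0 < e"
  have "((\<lambda>h. N (\<lambda>\<xi>. T h f \<xi> - f \<xi>)) \<longlongrightarrow> 0) (at_right 0)"
    using sg f unfolding C0_semigroup_def by blast
  from order_tendstoD(2)[OF this, of "e / C"] e C_pos obtain d where
    d: "d > 0" "\<And>h. 0 < h \<Longrightarrow> h < d \<Longrightarrow> N (\<lambda>\<xi>. T h f \<xi> - f \<xi>) < e / C"
    unfolding eventually_at_right_field by auto
  have *: "N (\<lambda>\<xi>. T (r + h) f \<xi> - T r f \<xi>) < e" if "0 \<le> r" "0 < h" "h < d" for r h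
  proof -
    have "N (\<lambda>\<xi>. T (r + h) f \<xi> - T r f \<xi>) = N (\<lambda>\<xi>. T r (T h f) \<xi> - T r f \<xi>)"
    proof (rule L1_norm_cong_AE)
      show "AE \<xi> in lebesgue_on {a..b}. T (r + h) f \<xi> - T r f \<xi> = T r (T h f) \<xi> - T r f \<xi>"
        using T_plus[OF that(1) less_imp_le[OF that(2)] f] by eventually_elim simp
    qed (use that f in \<open>auto intro!: L1_space_diff T_V\<close>)
    also have "\<dots> \<le> C * N (\<lambda>\<xi>. T h f \<xi> - f \<xi>)"
      using that f by (intro T_diff_bound T_V) auto
    also have "\<dots> < C * (e / C)" using d(2)[OF that(2,3)] C_pos by (intro mult_strict_left_mono)
    finally show ?thesis using C_pos by simp
  qed
  have "N (\<lambda>\<xi>. T s f \<xi> - T t f \<xi>) < e" if "s \<in> I" "s \<noteq> t" "dist s t < d" for s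
  proof (cases "s > t")
    case True
    then show ?thesis using *[of t "s - t"] that t by (auto simp: dist_real_def)
  next
    case False
    then show ?thesis
      using *[of s "t - s"] that I L1_norm_minus_commute[of a b "T s f" "T t f"]
      by (auto simp: dist_real_def subset_iff)
  qed
  then show "\<forall>\<^sub>F s in at t within I. dist (N (\<lambda>\<xi>. T s f \<xi> - T t f \<xi>)) 0 < e"
    unfolding eventually_at using d(1) by (intro exI[of _ d]) (auto simp: L1_norm_nonneg)
qed

section \<open>Boundary traces along orbits\<close>

lemma btrace_diff:
  assumes "(f, g) \<in> dom_A" "(f', g') \<in> dom_A"
  shows "btrace (\<lambda>\<xi>. f \<xi> - f' \<xi>) = btrace f - btrace f'"
proof -
  obtain w w' where w: "hyp f w g" "hyp f' w' g'" using assms unfolding dom_A_iff by blast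
  show ?thesis using hyp_btrace[OF hyp_diff[OF w]] hyp_btrace[OF w(1)] hyp_btrace[OF w(2)]
    by (simp add: stack_vec_diff)
qed

lemma btrace_smult:
  assumes "(f, g) \<in> dom_A"
  shows "btrace (\<lambda>\<xi>. c *s f \<xi>) = c *s btrace f"
proof -
  obtain w where w: "hyp f w g" using assms unfolding dom_A_iff by blast
  show ?thesis using hyp_btrace[OF hyp_smult[OF w]] hyp_btrace[OF w]
    by (simp add: stack_vec_smult)
qed

lemma btrace_bound:
  obtains c where "c > 0" "\<And>f g. (f, g) \<in> dom_A \<Longrightarrow> norm (btrace f) \<le> c * (N f + N g)"
proof -
  obtain c where c: "c > 0" "\<And>f w g \<xi>. hyp f w g \<Longrightarrow> \<xi> \<in> {a..b} \<Longrightarrow> norm (w \<xi>) \<le> c * (N f + N g)"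
    by (rule hyp_trace_bound) blast
  have "norm (btrace f) \<le> (CARD('n) * (2 * c)) * (N f + N g)" if fg: "(f, g) \<in> dom_A" for f g
  proof -
    obtain w where w: "hyp f w g" using fg unfolding dom_A_iff by blast
    have "norm (btrace f) \<le> CARD('n) * (norm (w b) + norm (w a))"
      using norm_stack_vec_le by (simp add: hyp_btrace[OF w])
    also have "\<dots> \<le> CARD('n) * (c * (N f + N g) + c * (N f + N g))"
      using c(2)[OF w] ab by (intro mult_left_mono add_mono) auto
    finally show ?thesis by (simp add: algebra_simps)
  qed
  moreover have "CARD('n) * (2 * c) > 0" using c(1) by simp
  ultimately show thesis by (rule that[rotated])
qed

text \<open>Semigroup identities hold only almost everywhere; this lets them be used under the
  trace.\<close>

lemma btrace_cong:
  assumes "(f, g) \<in> dom_A" "(f', g') \<in> dom_A" "AE \<xi> in lebesgue_on {a..b}. f \<xi> = f' \<xi>"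
  shows "btrace f = btrace f'"
proof -
  obtain w w' where w: "hyp f w g" "hyp f' w' g'" using assms unfolding dom_A_iff by blast
  obtain v v' where v: "sob a b (\<lambda>\<xi>. H \<xi> *v f \<xi>) w v" "sob a b (\<lambda>\<xi>. H \<xi> *v f' \<xi>) w' v'"
    using w unfolding hyp_op_def by blast
  have "AE \<xi> in lebesgue_on {a..b}. H \<xi> *v f \<xi> = H \<xi> *v f' \<xi>"
    using assms(3) by eventually_elim simp
  from sobolev_W1_unique[OF v this ab] show ?thesis
    using ab by (simp add: hyp_btrace[OF w(1)] hyp_btrace[OF w(2)])
qed

text \<open>The trace asks for continuity in the graph norm, which holds because the generator maps
  the orbit of \<open>f\<close> to the orbit of \<open>g\<close>.\<close>

lemma orbit_btrace_continuous:
  assumes fg: "(f, g) \<in> dom_A"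
  shows "continuous_on {0..} (\<lambda>t. btrace (T t f))"
  unfolding continuous_on_def
proof
  obtain c where c: "c > 0" "\<And>f g. (f, g) \<in> dom_A \<Longrightarrow> norm (btrace f) \<le> c * (N f + N g)"
    by (rule btrace_bound) blast
  fix t :: real assume t: "t \<in> {0..}"
  note V = dom_A_V[OF fg]
  have "((\<lambda>s. c * (N (\<lambda>\<xi>. T s f \<xi> - T t f \<xi>) + N (\<lambda>\<xi>. T s g \<xi> - T t g \<xi>))) \<longlongrightarrow> c * (0 + 0)) (at t within {0..})"
    using t by (intro tendsto_intros T_tendsto V) auto
  then have "((\<lambda>s. c * (N (\<lambda>\<xi>. T s f \<xi> - T t f \<xi>) + N (\<lambda>\<xi>. T s g \<xi> - T t g \<xi>))) \<longlongrightarrow> 0) (at t within {0..})"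
    by simp
  moreover have "norm (btrace (T s f) - btrace (T t f)) \<le> c * (N (\<lambda>\<xi>. T s f \<xi> - T t f \<xi>) + N (\<lambda>\<xi>. T s g \<xi> - T t g \<xi>))"
    if "s \<in> {0..}" for s
  proof -
    have s: "0 \<le> s" "0 \<le> t" using that t by auto
    note o = dom_A_orbit[OF fg s(1)] dom_A_orbit[OF fg s(2)]
    show ?thesis using c(2)[OF dom_A_diff[OF o]] btrace_diff[OF o] by simp
  qed
  then have "\<forall>\<^sub>F s in at t within {0..}. norm (btrace (T s f) - btrace (T t f))
      \<le> c * (N (\<lambda>\<xi>. T s f \<xi> - T t f \<xi>) + N (\<lambda>\<xi>. T s g \<xi> - T t g \<xi>))"
    unfolding eventually_at_filter by (intro always_eventually) auto
  ultimately show "((\<lambda>t. btrace (T t f)) \<longlongrightarrow> btrace (T t f)) (at t within {0..})"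
    by - (rule LIM_zero_cancel, rule Lim_null_comparison)
qed

end

section \<open>Admissibility of the boundary traces\<close>

text \<open>Bilinear, without conjugation: rows of matrices act on vectors in this way, and so do
  the components of the output.\<close>

definition cdot :: "'k::real_or_complex^'n \<Rightarrow> 'k^'n \<Rightarrow> 'k"
  where "cdot u v = (\<Sum>j\<in>UNIV. u $ j * v $ j)"

lemma norm_cdot_le: "norm (cdot u v) \<le> norm u * norm v"
proof -
  have "norm (cdot u v) \<le> (\<Sum>j\<in>UNIV. \<bar>norm (u $ j)\<bar> * \<bar>norm (v $ j)\<bar>)"
    unfolding cdot_def by (simp add: norm_mult sum_norm_le)
  also have "\<dots> \<le> norm u * norm v" unfolding norm_vec_def by (rule L2_set_mult_ineq)
  finally show ?thesis .
qed

lemma bounded_bilinear_cdot: "bounded_bilinear (cdot :: 'k::real_or_complex^'n \<Rightarrow> 'k^'n \<Rightarrow> 'k)"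
proof (unfold_locales)
  show "\<exists>K. \<forall>(a :: 'k^'n) b. norm (cdot a b) \<le> norm a * norm b * K"
    by (rule exI[of _ 1]) (simp add: norm_cdot_le)
qed (simp_all add: cdot_def algebra_simps sum.distrib scaleR_sum_right)

interpretation cdot: bounded_bilinear cdot by (rule bounded_bilinear_cdot)

lemma cdot_smult: "cdot (c *s u) v = c * cdot u v" "cdot u (c *s v) = c * cdot u v"
  by (simp_all add: cdot_def sum_distrib_left mult_ac)

lemma matrix_vector_mult_cdot: "(A *v x) $ i = cdot (A $ i) x"
  by (simp add: cdot_def matrix_vector_mult_def)

lemma cdot_L1:
  assumes "continuous_on {a..b} m" "\<And>\<xi>. \<xi> \<in> {a..b} \<Longrightarrow> norm (m \<xi>) \<le> c" "f \<in> L1_space a b"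
  shows "(\<lambda>\<xi>. cdot (m \<xi>) (f \<xi>)) \<in> L1_space a b"
    "norm (LINT \<xi>|lebesgue_on {a..b}. cdot (m \<xi>) (f \<xi>)) \<le> c * L1_norm a b f"
proof -
  have m: "m \<in> borel_measurable (lebesgue_on {a..b})"
    by (rule L1_space_measurable[OF continuous_on_imp_L1[OF assms(1)]])
  have c: "AE \<xi> in lebesgue_on {a..b}. norm (m \<xi>) \<le> c"
    by (rule AE_I2) (simp add: assms(2))
  note * = bilinear_L1[OF bounded_bilinear_cdot norm_cdot_le m c assms(3)]
  show "(\<lambda>\<xi>. cdot (m \<xi>) (f \<xi>)) \<in> L1_space a b" by (rule *(1))
  show "norm (LINT \<xi>|lebesgue_on {a..b}. cdot (m \<xi>) (f \<xi>)) \<le> c * L1_norm a b f"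
    by (rule order_trans[OF L1_integral_bound[OF *(1)] *(2)])
qed

lemma sobolev_W1_matrix:
  fixes A :: "'k::real_or_complex^'n^'m"
  assumes "sob a b f w v"
  shows "sob a b (\<lambda>\<xi>. A *v f \<xi>) (\<lambda>\<xi>. A *v w \<xi>) (\<lambda>\<xi>. A *v v \<xi>)"
proof (rule sobolev_W1_I)
  have v: "v \<in> L1_space a b" using assms by (rule sobolev_W1_deriv)
  then show "(\<lambda>\<xi>. A *v v \<xi>) \<in> L1_space a b" by (rule const_matrix_L1(1))
  have "AE \<xi> in lebesgue_on {a..b}. f \<xi> = w \<xi>" using assms by (rule sobolev_W1_AE)
  then show "AE \<xi> in lebesgue_on {a..b}. A *v f \<xi> = A *v w \<xi>" by eventually_elim simp
  fix \<xi> assume x: "\<xi> \<in> {a..b}"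
  have "v integrable_on {a..\<xi>}" using v x by (auto intro: L1_integrable_sub(2))
  then have "integral {a..\<xi>} (\<lambda>\<xi>. A *v v \<xi>) = A *v integral {a..\<xi>} v"
    using integral_linear[OF _ bounded_bilinear.bounded_linear_right[OF bounded_bilinear_matrix_vector_mult], of v "{a..\<xi>}" A]
    by (simp add: o_def)
  then show "A *v w \<xi> = A *v w a + integral {a..\<xi>} (\<lambda>\<xi>. A *v v \<xi>)"
    using sobolev_W1_eq_integral[OF assms x] by (simp add: matrix_vector_right_distrib)
qed

text \<open>The bound does not involve \<open>R\<close>. This is where decay, and not just
  boundedness, gives estimates uniform in time.\<close>

lemma integral_exp_decay_le:
  assumes "0 \<le> R" "0 < \<omega>" "0 \<le> c"
  shows "integral {0..R} (\<lambda>t. c * exp (- \<omega> * t)) \<le> c / (\<omega>::real)"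
proof -
  have "((\<lambda>t. c * exp (- \<omega> * t)) has_integral (- c / \<omega> * exp (- \<omega> * R) - - c / \<omega> * exp (- \<omega> * 0))) {0..R}"
    using assms by (intro fundamental_theorem_of_calculus)
      (auto intro!: derivative_eq_intros simp: has_real_derivative_iff_has_vector_derivative[symmetric])
  then have "integral {0..R} (\<lambda>t. c * exp (- \<omega> * t)) = c / \<omega> - c / \<omega> * exp (- \<omega> * R)"
    by (subst integral_unique) auto
  then show ?thesis using assms by simp
qed

context stable_hyperbolic
begin

text \<open>
  Transporting \<open>\<Psi>\<close> along the characteristic with speed \<open>\<nu>\<close> turns the test function into a
  multiplier \<open>m\<close> for which \<open>\<partial>\<^sub>t m - \<nu> \<partial>\<^sub>\<xi> m\<close> contains no derivative of \<open>\<Psi>\<close>.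
\<close>

lemma characteristic_trace_bound:
  fixes \<mu> \<mu>' :: "real \<Rightarrow> 'k^'n" and \<nu> \<rho> :: "real \<Rightarrow> real" and \<rho>' e0 :: real
  assumes \<mu>: "\<And>\<xi>. \<xi> \<in> {a..b} \<Longrightarrow> (\<mu> has_vector_derivative \<mu>' \<xi>) (at \<xi> within {a..b})"
    and \<mu>'c: "continuous_on {a..b} \<mu>'"
    and \<nu>c: "continuous_on {a..b} \<nu>" and \<nu>0: "\<And>\<xi>. \<xi> \<in> {a..b} \<Longrightarrow> \<nu> \<xi> \<noteq> 0"
    and char: "AE \<xi> in lebesgue_on {a..b}. \<forall>x. cdot (\<mu> \<xi>) (P1 *v (H \<xi> *v x)) = of_real (\<nu> \<xi>) * cdot (\<mu> \<xi>) x"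
    and \<rho>: "\<And>\<xi>. \<rho> \<xi> = e0 + \<rho>' * \<xi>" and e: "e = a \<or> e = b"
    and \<rho>_other: "\<rho> (a + b - e) = 0"
  obtains M where "M > 0" "\<And>f g w \<Psi> \<Psi>' K R. (f, g) \<in> dom_A \<Longrightarrow> test_fn \<Psi> \<Psi>' \<Longrightarrow>
      (\<And>t. norm (\<Psi> t) \<le> K) \<Longrightarrow> 0 \<le> R \<Longrightarrow> (\<And>t. 0 \<le> t \<Longrightarrow> hyp (T t f) (w t) (T t g)) \<Longrightarrow>
      continuous_on {0..R} (\<lambda>t. w t e) \<Longrightarrow>
      norm (integral {0..R} (\<lambda>t. \<rho> e *\<^sub>R (\<Psi> t * cdot (\<mu> e) (P1 *v w t e)))) \<le> M * K * N f"
proof -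
  \<comment> \<open>Signed travel time from the end \<open>e\<close>. As it vanishes there, the
    transported test function \<open>\<Psi> (t + \<theta> \<xi>)\<close> reduces to
    \<open>\<Psi> t\<close> at \<open>e\<close>.\<close>
  define \<theta> where "\<theta> \<xi> = integral {a..\<xi>} (\<lambda>s. 1 / \<nu> s) - integral {a..e} (\<lambda>s. 1 / \<nu> s)" for \<xi>
  have \<nu>ic: "continuous_on {a..b} (\<lambda>s. 1 / \<nu> s)" using \<nu>c \<nu>0 by (intro continuous_intros) auto
  have \<theta>': "(\<theta> has_vector_derivative 1 / \<nu> \<xi>) (at \<xi> within {a..b})" if "\<xi> \<in> {a..b}" for \<xi>
    unfolding \<theta>_def using has_vector_derivative_diff[OF integral_has_vector_derivative[OF \<nu>ic that] has_vector_derivative_const]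
    by simp
  have \<theta>c: "continuous_on {a..b} \<theta>"
    unfolding continuous_on_eq_continuous_within by (blast intro: has_vector_derivative_continuous \<theta>')
  have \<theta>e: "\<theta> e = 0" by (simp add: \<theta>_def)
  have \<mu>c: "continuous_on {a..b} \<mu>"
    unfolding continuous_on_eq_continuous_within by (blast intro: has_vector_derivative_continuous \<mu>)
  have \<rho>c: "continuous_on {a..b} \<rho>" unfolding \<rho> by (intro continuous_intros)
  have \<rho>d: "(\<rho> has_vector_derivative \<rho>') (at \<xi> within {a..b})" for \<xi>
    unfolding \<rho> by (auto intro!: derivative_eq_intros)
  obtain c where c: "c > 0" "AE \<xi> in lebesgue_on {a..b}. norm (H \<xi>) \<le> c"
    "AE \<xi> in lebesgue_on {a..b}. norm (P0 \<xi>) \<le> c" by (rule bounds)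
  obtain c\<mu> where c\<mu>: "c\<mu> > 0" "\<And>\<xi>. \<xi> \<in> {a..b} \<Longrightarrow> norm (\<mu> \<xi>) \<le> c\<mu>"
    using continuous_on_Icc_bounded[OF \<mu>c] by blast
  obtain c\<mu>' where c\<mu>': "c\<mu>' > 0" "\<And>\<xi>. \<xi> \<in> {a..b} \<Longrightarrow> norm (\<mu>' \<xi>) \<le> c\<mu>'"
    using continuous_on_Icc_bounded[OF \<mu>'c] by blast
  obtain c\<rho> where c\<rho>: "c\<rho> > 0" "\<And>\<xi>. \<xi> \<in> {a..b} \<Longrightarrow> \<bar>\<rho> \<xi>\<bar> \<le> c\<rho>"
    using continuous_on_Icc_bounded[OF \<rho>c] by auto
  obtain c\<nu> where c\<nu>: "c\<nu> > 0" "\<And>\<xi>. \<xi> \<in> {a..b} \<Longrightarrow> \<bar>\<nu> \<xi>\<bar> \<le> c\<nu>"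
    using continuous_on_Icc_bounded[OF \<nu>c] by auto
  \<comment> \<open>The three zero-order terms left by the product rule: from the slope of \<rho>,
    from the derivative of \<mu>, and from \<open>P0\<close>.\<close>
  define cE where "cE = \<bar>\<rho>'\<bar> * c\<nu> * c\<mu> + c\<rho> * c\<mu>' * (norm P1 * c) + c\<rho> * c\<mu> * (c * c)"
  have cE: "cE \<ge> 0" using c c\<mu> c\<mu>' c\<rho> c\<nu> by (simp add: cE_def)
  \<comment> \<open>\<open>C / \<omega>\<close> is the time integral of the decay; the two equal
    terms bound the pairing at the times \<open>R\<close> and 0.\<close>
  define M where "M = cE * C / \<omega> + c\<rho> * c\<mu> * C + c\<rho> * c\<mu> * C + 1"
  have "M > 0" using cE c\<mu> c\<rho> C_pos \<omega>_pos by (simp add: M_def add_nonneg_pos)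
  moreover have "norm (integral {0..R} (\<lambda>t. \<rho> e *\<^sub>R (\<Psi> t * cdot (\<mu> e) (P1 *v w t e)))) \<le> M * K * N f"
    if fg: "(f, g) \<in> dom_A" and \<Psi>: "test_fn \<Psi> \<Psi>'" and K: "\<And>t. norm (\<Psi> t) \<le> K" and R: "0 \<le> R"
      and w: "\<And>t. 0 \<le> t \<Longrightarrow> hyp (T t f) (w t) (T t g)" and wc: "continuous_on {0..R} (\<lambda>t. w t e)"
    for f g w \<Psi> \<Psi>' K R
  proof -
    note V = dom_A_V[OF fg]
    have K0: "0 \<le> K" using K[of 0] norm_ge_zero order_trans by blast
    obtain K1 L where KL: "K1 > 0" "L > 0" "\<And>t. norm (\<Psi>' t) \<le> K1"
      "\<And>t h. norm (\<Psi> (t + h) - \<Psi> t - h *\<^sub>R \<Psi>' t) \<le> L * h\<^sup>2"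
      by (rule test_fnE[OF \<Psi>]) blast
    obtain K2 where K2: "K2 > 0" "\<And>s t. norm (\<Psi> s - \<Psi> t) \<le> K2 * \<bar>s - t\<bar>"
      by (rule test_fn_lipschitz[OF \<Psi>]) blast
    have \<Psi>c: "continuous_on UNIV \<Psi>" by (rule test_fn_continuous[OF \<Psi>])
    have \<Psi>'c: "continuous_on UNIV \<Psi>'" using \<Psi> by (simp add: test_fn_def)
    define m where "m t \<xi> = \<rho> \<xi> *\<^sub>R (\<Psi> (t + \<theta> \<xi>) *s \<mu> \<xi>)" for t \<xi>
    define mt where "mt t \<xi> = \<rho> \<xi> *\<^sub>R (\<Psi>' (t + \<theta> \<xi>) *s \<mu> \<xi>)" for t \<xi>
    define mx where "mx t \<xi> = \<rho> \<xi> *\<^sub>R (\<Psi> (t + \<theta> \<xi>) *s \<mu>' \<xi> + ((1 / \<nu> \<xi>) *\<^sub>R \<Psi>' (t + \<theta> \<xi>)) *s \<mu> \<xi>)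
        + \<rho>' *\<^sub>R (\<Psi> (t + \<theta> \<xi>) *s \<mu> \<xi>)" for t \<xi>
    have \<Psi>\<theta>c: "continuous_on {a..b} (\<lambda>\<xi>. \<Psi> (t + \<theta> \<xi>))" "continuous_on {a..b} (\<lambda>\<xi>. \<Psi>' (t + \<theta> \<xi>))" for t
      by (rule continuous_on_compose2[OF \<Psi>c] continuous_on_compose2[OF \<Psi>'c], intro continuous_intros \<theta>c, simp)+
    note smc = bounded_bilinear.continuous_on[OF bounded_bilinear_vector_scalar_mult]
    have mc: "continuous_on {a..b} (m t)" for t
      unfolding m_def by (intro continuous_intros \<rho>c smc \<Psi>\<theta>c \<mu>c)
    have mtc: "continuous_on {a..b} (mt t)" for t
      unfolding mt_def by (intro continuous_intros \<rho>c smc \<Psi>\<theta>c \<mu>c)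
    have mxc: "continuous_on {a..b} (mx t)" for t
      unfolding mx_def by (intro continuous_on_add continuous_on_scaleR \<rho>c smc \<Psi>\<theta>c \<mu>c \<mu>'c \<nu>ic continuous_on_const)
    have mx: "(m t has_vector_derivative mx t \<xi>) (at \<xi> within {a..b})" if \<xi>: "\<xi> \<in> {a..b}" for t \<xi>
    proof -
      have "((\<lambda>\<xi>. t + \<theta> \<xi>) has_vector_derivative 1 / \<nu> \<xi>) (at \<xi> within {a..b})"
        using has_vector_derivative_add[OF has_vector_derivative_const \<theta>'[OF \<xi>], of t] by simp
      from vector_diff_chain_within[OF this test_fn_derivative[OF \<Psi>]]
      have 1: "((\<lambda>\<xi>. \<Psi> (t + \<theta> \<xi>)) has_vector_derivative (1 / \<nu> \<xi>) *\<^sub>R \<Psi>' (t + \<theta> \<xi>)) (at \<xi> within {a..b})"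
        by (simp add: o_def)
      from bounded_bilinear.has_vector_derivative[OF bounded_bilinear_scaleR \<rho>d
          bounded_bilinear.has_vector_derivative[OF bounded_bilinear_vector_scalar_mult 1 \<mu>[OF \<xi>]]]
      show ?thesis unfolding m_def mx_def .
    qed
    have m_norm: "norm (m t \<xi>) \<le> c\<rho> * c\<mu> * K" if \<xi>: "\<xi> \<in> {a..b}" for t \<xi>
    proof -
      have "norm (m t \<xi>) = \<bar>\<rho> \<xi>\<bar> * (norm (\<Psi> (t + \<theta> \<xi>)) * norm (\<mu> \<xi>))"
        by (simp add: m_def norm_vector_scalar_mult)
      also have "\<dots> \<le> c\<rho> * (K * c\<mu>)"
        using c\<rho> c\<mu> K K0 \<xi> by (intro mult_mono) auto
      finally show ?thesis by (simp add: mult_ac)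
    qed
    \<comment> \<open>The Lipschitz and Taylor constants of \<Psi> may be large and must not reach
      the final bound. In \<open>Dint\<close> they carry a factor h^2 and disappear with
      \<open>h\<close>; only the sup bound \<open>K\<close> remains.\<close>
    have m_lip: "norm (m s \<xi> - m t \<xi>) \<le> c\<rho> * c\<mu> * K2 * \<bar>s - t\<bar>" if \<xi>: "\<xi> \<in> {a..b}" for s t \<xi>
    proof -
      have "m s \<xi> - m t \<xi> = \<rho> \<xi> *\<^sub>R ((\<Psi> (s + \<theta> \<xi>) - \<Psi> (t + \<theta> \<xi>)) *s \<mu> \<xi>)"
        by (simp add: m_def scaleR_diff_right vector_sub_rdistrib)
      also have "norm \<dots> = \<bar>\<rho> \<xi>\<bar> * (norm (\<Psi> (s + \<theta> \<xi>) - \<Psi> (t + \<theta> \<xi>)) * norm (\<mu> \<xi>))"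
        by (simp only: norm_scaleR norm_vector_scalar_mult)
      also have "\<dots> \<le> c\<rho> * ((K2 * \<bar>s - t\<bar>) * c\<mu>)"
        using c\<rho> c\<mu> K2(1) K2(2)[of "s + \<theta> \<xi>" "t + \<theta> \<xi>"] \<xi> by (intro mult_mono) auto
      finally show ?thesis by (simp add: mult_ac)
    qed
    have m_quad: "norm (m (t + h) \<xi> - m t \<xi> - h *\<^sub>R mt t \<xi>) \<le> c\<rho> * c\<mu> * L * h\<^sup>2"
      if \<xi>: "\<xi> \<in> {a..b}" for t h \<xi>
    proof -
      have "m (t + h) \<xi> - m t \<xi> - h *\<^sub>R mt t \<xi>
          = \<rho> \<xi> *\<^sub>R ((\<Psi> (t + \<theta> \<xi> + h) - \<Psi> (t + \<theta> \<xi>) - h *\<^sub>R \<Psi>' (t + \<theta> \<xi>)) *s \<mu> \<xi>)"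
        by (simp add: m_def mt_def scaleR_diff_right vector_sub_rdistrib add_ac scaleR_left_commute
            bounded_bilinear.scaleR_left[OF bounded_bilinear_vector_scalar_mult])
      also have "norm \<dots> = \<bar>\<rho> \<xi>\<bar> * (norm (\<Psi> (t + \<theta> \<xi> + h) - \<Psi> (t + \<theta> \<xi>) - h *\<^sub>R \<Psi>' (t + \<theta> \<xi>)) * norm (\<mu> \<xi>))"
        by (simp only: norm_scaleR norm_vector_scalar_mult)
      also have "\<dots> \<le> c\<rho> * ((L * h\<^sup>2) * c\<mu>)"
        using c\<rho> c\<mu> KL(2) KL(4) \<xi> by (intro mult_mono) auto
      finally show ?thesis by (simp add: mult_ac)
    qed
    define q where "q t = (LINT \<xi>|lebesgue_on {a..b}. cdot (m t \<xi>) (T t f \<xi>))" for t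
    define D where "D t = cdot (m t b) (P1 *v w t b) - cdot (m t a) (P1 *v w t a)" for t
    \<comment> \<open>\<rho> vanishes at the opposite end, so only the trace at \<open>e\<close> is
      left, with the sign of the boundary term in integration by parts.\<close>
    have D_eq: "D t = (if e = b then 1 else - 1) *\<^sub>R (\<rho> e *\<^sub>R (\<Psi> t * cdot (\<mu> e) (P1 *v w t e)))" for t
      using e \<rho>_other \<theta>e ab by (auto simp: D_def m_def cdot.scaleR_left cdot_smult)
    \<comment> \<open>Product rule for finite increments: \<open>m (t + h)\<close> against the
      remainder of the orbit, the increment of \<open>m\<close> against \<open>h\<close> times the
      orbit of \<open>g\<close>, the Taylor remainder of \<open>m\<close> against the state, and
      \<open>h\<close> times the zero-order terms.\<close>
    have Dint: "norm (q (t + h) - q t - h *\<^sub>R D t)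
        \<le> c\<rho> * c\<mu> * K * N (\<lambda>\<xi>. T (t + h) f \<xi> - T t f \<xi> - h *\<^sub>R T t g \<xi>)
          + h\<^sup>2 * (c\<rho> * c\<mu> * K2 * N (T t g) + c\<rho> * c\<mu> * L * N (T t f)) + h * (cE * K * N (T t f))"
      if t: "0 \<le> t" and h: "0 < h" for t h
    proof -
      let ?x = "T t f" and ?x' = "T t g" and ?y = "T (t + h) f"
      let ?I = "\<lambda>F. LINT \<xi>|lebesgue_on {a..b}. F \<xi>"
      have L1: "?x \<in> V" "?x' \<in> V" "?y \<in> V" using V t h by (auto intro!: T_V)
      obtain v where v: "sob a b (\<lambda>\<xi>. H \<xi> *v ?x \<xi>) (w t) v"
        "AE \<xi> in lebesgue_on {a..b}. ?x' \<xi> = P1 *v v \<xi> + P0 \<xi> *v (H \<xi> *v ?x \<xi>)"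
        using w[OF t] unfolding hyp_op_def by blast
      have vV: "v \<in> V" using v(1) by (rule sobolev_W1_deriv)
      note Hx = matrix_L1[OF H_measurable c(2) L1(1)]
      note P1Hx = const_matrix_L1[OF Hx(1), of P1]
      note P0Hx = matrix_L1[OF P0_measurable c(3) Hx(1)]
      note P1v = const_matrix_L1[OF vV, of P1]
      have wV: "(\<lambda>\<xi>. P1 *v w t \<xi>) \<in> V"
        by (intro const_matrix_L1(1) continuous_on_imp_L1 sobolev_W1_continuous[OF v(1)])
      have r1: "(\<lambda>\<xi>. ?y \<xi> - ?x \<xi> - h *\<^sub>R ?x' \<xi>) \<in> V"
        by (intro L1_space_diff L1_space_scaleR L1)
      have i1: "norm (?I (\<lambda>\<xi>. cdot (m (t + h) \<xi>) (?y \<xi> - ?x \<xi> - h *\<^sub>R ?x' \<xi>)))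
          \<le> c\<rho> * c\<mu> * K * N (\<lambda>\<xi>. ?y \<xi> - ?x \<xi> - h *\<^sub>R ?x' \<xi>)"
        by (rule cdot_L1(2)[OF mc m_norm r1])
      have "norm (m (t + h) \<xi> - m t \<xi>) \<le> c\<rho> * c\<mu> * K2 * h" if "\<xi> \<in> {a..b}" for \<xi>
        using m_lip[OF that, of "t + h" t] h by simp
      from cdot_L1(2)[OF continuous_on_diff[OF mc mc] this L1(2)]
      have i2: "norm (?I (\<lambda>\<xi>. cdot (m (t + h) \<xi> - m t \<xi>) (?x' \<xi>))) \<le> c\<rho> * c\<mu> * K2 * h * N ?x'" .
      have dq: "continuous_on {a..b} (\<lambda>\<xi>. m (t + h) \<xi> - m t \<xi> - h *\<^sub>R mt t \<xi>)"
        by (intro continuous_intros mc mtc)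
      have i3: "norm (?I (\<lambda>\<xi>. cdot (m (t + h) \<xi> - m t \<xi> - h *\<^sub>R mt t \<xi>) (?x \<xi>))) \<le> c\<rho> * c\<mu> * L * h\<^sup>2 * N ?x"
        by (rule cdot_L1(2)[OF dq m_quad L1(1)])
      \<comment> \<open>What remains of the time derivative of the pairing once the boundary term is
        split off; it contains \<Psi> but not its derivative.\<close>
      define EI where "EI \<xi> = cdot (m t \<xi>) (P0 \<xi> *v (H \<xi> *v ?x \<xi>))
          - cdot (\<rho> \<xi> *\<^sub>R (\<Psi> (t + \<theta> \<xi>) *s \<mu>' \<xi>)) (P1 *v (H \<xi> *v ?x \<xi>))
          - cdot ((\<rho>' * \<nu> \<xi>) *\<^sub>R (\<Psi> (t + \<theta> \<xi>) *s \<mu> \<xi>)) (?x \<xi>)" for \<xi>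
      have c2: "continuous_on {a..b} (\<lambda>\<xi>. \<rho> \<xi> *\<^sub>R (\<Psi> (t + \<theta> \<xi>) *s \<mu>' \<xi>))"
        "continuous_on {a..b} (\<lambda>\<xi>. (\<rho>' * \<nu> \<xi>) *\<^sub>R (\<Psi> (t + \<theta> \<xi>) *s \<mu> \<xi>))"
        by (intro continuous_intros \<rho>c \<nu>c smc \<Psi>\<theta>c \<mu>c \<mu>'c)+
      have n2: "norm (\<rho> \<xi> *\<^sub>R (\<Psi> (t + \<theta> \<xi>) *s \<mu>' \<xi>)) \<le> c\<rho> * (K * c\<mu>')"
        "norm ((\<rho>' * \<nu> \<xi>) *\<^sub>R (\<Psi> (t + \<theta> \<xi>) *s \<mu> \<xi>)) \<le> \<bar>\<rho>'\<bar> * c\<nu> * (K * c\<mu>)" if "\<xi> \<in> {a..b}" for \<xi>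
        using that c\<rho> c\<mu> c\<mu>' c\<nu> K K0
        by (auto simp: norm_vector_scalar_mult abs_mult intro!: mult_mono mult_nonneg_nonneg)
      have EI_L1: "(\<lambda>\<xi>. cdot (m t \<xi>) (P0 \<xi> *v (H \<xi> *v ?x \<xi>))) \<in> V"
        "(\<lambda>\<xi>. cdot (\<rho> \<xi> *\<^sub>R (\<Psi> (t + \<theta> \<xi>) *s \<mu>' \<xi>)) (P1 *v (H \<xi> *v ?x \<xi>))) \<in> V"
        "(\<lambda>\<xi>. cdot ((\<rho>' * \<nu> \<xi>) *\<^sub>R (\<Psi> (t + \<theta> \<xi>) *s \<mu> \<xi>)) (?x \<xi>)) \<in> V"
        by (rule cdot_L1(1)[OF mc m_norm P0Hx(1)] cdot_L1(1)[OF c2(1) n2(1) P1Hx(1)]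
            cdot_L1(1)[OF c2(2) n2(2) L1(1)], assumption)+
      have "norm (?I EI) \<le> c\<rho> * c\<mu> * K * N (\<lambda>\<xi>. P0 \<xi> *v (H \<xi> *v ?x \<xi>))
          + c\<rho> * (K * c\<mu>') * N (\<lambda>\<xi>. P1 *v (H \<xi> *v ?x \<xi>)) + \<bar>\<rho>'\<bar> * c\<nu> * (K * c\<mu>) * N ?x"
      proof -
        have eq: "?I EI = ?I (\<lambda>\<xi>. cdot (m t \<xi>) (P0 \<xi> *v (H \<xi> *v ?x \<xi>)))
          - ?I (\<lambda>\<xi>. cdot (\<rho> \<xi> *\<^sub>R (\<Psi> (t + \<theta> \<xi>) *s \<mu>' \<xi>)) (P1 *v (H \<xi> *v ?x \<xi>)))
          - ?I (\<lambda>\<xi>. cdot ((\<rho>' * \<nu> \<xi>) *\<^sub>R (\<Psi> (t + \<theta> \<xi>) *s \<mu> \<xi>)) (?x \<xi>))"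
          using EI_L1 unfolding EI_def L1_space_def by (simp add: Bochner_Integration.integral_diff)
        show ?thesis unfolding eq
          by (rule order_trans[OF norm_triangle_ineq4 add_mono[OF order_trans[OF norm_triangle_ineq4 add_mono]]])
             (rule cdot_L1(2)[OF mc m_norm P0Hx(1)] cdot_L1(2)[OF c2(1) n2(1) P1Hx(1)]
            cdot_L1(2)[OF c2(2) n2(2) L1(1)], assumption)+
      qed
      also have "\<dots> \<le> c\<rho> * c\<mu> * K * (c * (c * N ?x)) + c\<rho> * (K * c\<mu>') * (norm P1 * (c * N ?x)) + \<bar>\<rho>'\<bar> * c\<nu> * (K * c\<mu>) * N ?x"
        using Hx(2) c(1) c\<rho>(1) c\<mu>(1) c\<mu>'(1) K0
        by (intro add_mono mult_left_mono order_refl order_trans[OF P0Hx(2)] order_trans[OF P1Hx(2)]) auto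
      also have "\<dots> = cE * K * N ?x" by (simp add: cE_def algebra_simps)
      finally have i4: "norm (?I EI) \<le> cE * K * N ?x" .
      have parts: "?I (\<lambda>\<xi>. cdot (m t \<xi>) (P1 *v v \<xi>)) = D t - ?I (\<lambda>\<xi>. cdot (mx t \<xi>) (P1 *v w t \<xi>))"
        unfolding D_def
        by (rule sobolev_W1_by_parts[OF bounded_bilinear_cdot norm_cdot_le sobolev_W1_matrix[OF v(1)] ab mxc mx])
      have int: "integrable (lebesgue_on {a..b}) (\<lambda>\<xi>. cdot (F \<xi>) (z \<xi>))" if F: "continuous_on {a..b} F" and "z \<in> V" for F z
      proof -
        obtain B where "\<And>\<xi>. \<xi> \<in> {a..b} \<Longrightarrow> norm (F \<xi>) \<le> B" using continuous_on_Icc_bounded[OF F] by blast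
        from cdot_L1(1)[OF F this \<open>z \<in> V\<close>] show ?thesis by (simp add: L1_space_def)
      qed
      have id: "?I (\<lambda>\<xi>. cdot (m t \<xi>) (?x' \<xi>)) + ?I (\<lambda>\<xi>. cdot (mt t \<xi>) (?x \<xi>)) = D t + ?I EI"
      proof -
        have "?I (\<lambda>\<xi>. cdot (m t \<xi>) (?x' \<xi>)) = ?I (\<lambda>\<xi>. cdot (m t \<xi>) (P1 *v v \<xi>) + cdot (m t \<xi>) (P0 \<xi> *v (H \<xi> *v ?x \<xi>)))"
        proof (rule integral_cong_AE)
          show "AE \<xi> in lebesgue_on {a..b}. cdot (m t \<xi>) (?x' \<xi>) = cdot (m t \<xi>) (P1 *v v \<xi>) + cdot (m t \<xi>) (P0 \<xi> *v (H \<xi> *v ?x \<xi>))"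
            using v(2) by eventually_elim (simp add: cdot.add_right)
        qed (use int[OF mc L1(2)] int[OF mc P1v(1)] int[OF mc P0Hx(1)] in auto)
        also have "\<dots> = ?I (\<lambda>\<xi>. cdot (m t \<xi>) (P1 *v v \<xi>)) + ?I (\<lambda>\<xi>. cdot (m t \<xi>) (P0 \<xi> *v (H \<xi> *v ?x \<xi>)))"
          by (rule Bochner_Integration.integral_add[OF int[OF mc P1v(1)] int[OF mc P0Hx(1)]])
        finally have 1: "?I (\<lambda>\<xi>. cdot (m t \<xi>) (?x' \<xi>)) = D t - ?I (\<lambda>\<xi>. cdot (mx t \<xi>) (P1 *v w t \<xi>))
            + ?I (\<lambda>\<xi>. cdot (m t \<xi>) (P0 \<xi> *v (H \<xi> *v ?x \<xi>)))" using parts by simp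
        have "?I (\<lambda>\<xi>. cdot (m t \<xi>) (P0 \<xi> *v (H \<xi> *v ?x \<xi>)) - EI \<xi>)
            = ?I (\<lambda>\<xi>. cdot (mx t \<xi>) (P1 *v w t \<xi>) - cdot (mt t \<xi>) (?x \<xi>))"
        proof (rule integral_cong_AE)
          have "AE \<xi> in lebesgue_on {a..b}. \<xi> \<in> {a..b}" using AE_space by eventually_elim simp
          then show "AE \<xi> in lebesgue_on {a..b}. cdot (m t \<xi>) (P0 \<xi> *v (H \<xi> *v ?x \<xi>)) - EI \<xi>
              = cdot (mx t \<xi>) (P1 *v w t \<xi>) - cdot (mt t \<xi>) (?x \<xi>)"
            using char sobolev_W1_AE[OF v(1)]
          proof eventually_elim
            case (elim \<xi>)
            then have n0: "\<nu> \<xi> \<noteq> 0" using \<nu>0 by blast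
            \<comment> \<open>The left eigenvector relation at \<open>w t \<xi>\<close> = H x. The
              speed \<nu> cancels the factor 1 / \<nu> produced by differentiating \<theta>, and the
              two terms with \<Psi>' cancel each other.\<close>
            have ch: "cdot (\<mu> \<xi>) (P1 *v w t \<xi>) = \<nu> \<xi> *\<^sub>R cdot (\<mu> \<xi>) (?x \<xi>)"
              using elim(2)[rule_format, of "?x \<xi>"] elim(3) by (simp add: scaleR_conv_of_real)
            show ?case
              unfolding EI_def mx_def mt_def elim(3) using n0
              by (simp add: cdot.add_left cdot.scaleR_left cdot_smult ch scaleR_add_right mult_ac)
          qed
        qed (use EI_L1 int[OF mxc wV] int[OF mtc L1(1)] in \<open>auto simp: EI_def L1_space_def\<close>)
        moreover have "?I (\<lambda>\<xi>. cdot (m t \<xi>) (P0 \<xi> *v (H \<xi> *v ?x \<xi>)) - EI \<xi>)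
            = ?I (\<lambda>\<xi>. cdot (m t \<xi>) (P0 \<xi> *v (H \<xi> *v ?x \<xi>))) - ?I EI"
          using EI_L1 unfolding EI_def L1_space_def by (intro Bochner_Integration.integral_diff) auto
        moreover have "?I (\<lambda>\<xi>. cdot (mx t \<xi>) (P1 *v w t \<xi>) - cdot (mt t \<xi>) (?x \<xi>))
            = ?I (\<lambda>\<xi>. cdot (mx t \<xi>) (P1 *v w t \<xi>)) - ?I (\<lambda>\<xi>. cdot (mt t \<xi>) (?x \<xi>))"
          by (rule Bochner_Integration.integral_diff[OF int[OF mxc wV] int[OF mtc L1(1)]])
        ultimately have "?I (\<lambda>\<xi>. cdot (m t \<xi>) (P0 \<xi> *v (H \<xi> *v ?x \<xi>))) - ?I EI
            = ?I (\<lambda>\<xi>. cdot (mx t \<xi>) (P1 *v w t \<xi>)) - ?I (\<lambda>\<xi>. cdot (mt t \<xi>) (?x \<xi>))"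
          by metis
        then have P: "?I (\<lambda>\<xi>. cdot (m t \<xi>) (P0 \<xi> *v (H \<xi> *v ?x \<xi>)))
            = ?I (\<lambda>\<xi>. cdot (mx t \<xi>) (P1 *v w t \<xi>)) - ?I (\<lambda>\<xi>. cdot (mt t \<xi>) (?x \<xi>)) + ?I EI"
          by (simp only: diff_eq_eq)
        show ?thesis unfolding 1 P by simp
      qed
      have j1: "?I (\<lambda>\<xi>. cdot (m (t + h) \<xi>) (?y \<xi> - ?x \<xi> - h *\<^sub>R ?x' \<xi>))
          = q (t + h) - ?I (\<lambda>\<xi>. cdot (m (t + h) \<xi>) (?x \<xi>)) - h *\<^sub>R ?I (\<lambda>\<xi>. cdot (m (t + h) \<xi>) (?x' \<xi>))"
        using int[OF mc[of "t + h"] L1(1)] int[OF mc[of "t + h"] L1(2)] int[OF mc[of "t + h"] L1(3)]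
        by (simp add: q_def cdot.diff_right cdot.scaleR_right)
      have j2: "?I (\<lambda>\<xi>. cdot (m (t + h) \<xi> - m t \<xi>) (?x' \<xi>))
          = ?I (\<lambda>\<xi>. cdot (m (t + h) \<xi>) (?x' \<xi>)) - ?I (\<lambda>\<xi>. cdot (m t \<xi>) (?x' \<xi>))"
        using int[OF mc[of "t + h"] L1(2)] int[OF mc[of t] L1(2)]
        by (simp add: cdot.diff_left)
      have j3: "?I (\<lambda>\<xi>. cdot (m (t + h) \<xi> - m t \<xi> - h *\<^sub>R mt t \<xi>) (?x \<xi>))
          = ?I (\<lambda>\<xi>. cdot (m (t + h) \<xi>) (?x \<xi>)) - q t - h *\<^sub>R ?I (\<lambda>\<xi>. cdot (mt t \<xi>) (?x \<xi>))"
        using int[OF mc[of "t + h"] L1(1)] int[OF mc[of t] L1(1)] int[OF mtc[of t] L1(1)]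
        by (simp add: q_def cdot.diff_left cdot.scaleR_left)
      have "h *\<^sub>R D t = h *\<^sub>R ?I (\<lambda>\<xi>. cdot (m t \<xi>) (?x' \<xi>)) + h *\<^sub>R ?I (\<lambda>\<xi>. cdot (mt t \<xi>) (?x \<xi>)) - h *\<^sub>R ?I EI"
        using id by (simp add: scaleR_add_right[symmetric] scaleR_diff_right[symmetric])
      then have eq: "q (t + h) - q t - h *\<^sub>R D t
          = ?I (\<lambda>\<xi>. cdot (m (t + h) \<xi>) (?y \<xi> - ?x \<xi> - h *\<^sub>R ?x' \<xi>))
            + (h *\<^sub>R ?I (\<lambda>\<xi>. cdot (m (t + h) \<xi> - m t \<xi>) (?x' \<xi>))
            + ?I (\<lambda>\<xi>. cdot (m (t + h) \<xi> - m t \<xi> - h *\<^sub>R mt t \<xi>) (?x \<xi>))) + h *\<^sub>R ?I EI"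
        unfolding j1 j2 j3 by (simp add: scaleR_diff_right)
      have "norm (q (t + h) - q t - h *\<^sub>R D t) \<le> c\<rho> * c\<mu> * K * N (\<lambda>\<xi>. ?y \<xi> - ?x \<xi> - h *\<^sub>R ?x' \<xi>)
          + (h * (c\<rho> * c\<mu> * K2 * h * N ?x') + c\<rho> * c\<mu> * L * h\<^sup>2 * N ?x) + h * (cE * K * N ?x)"
        unfolding eq
      proof (rule order_trans[OF norm_triangle_ineq add_mono[OF
            order_trans[OF norm_triangle_ineq add_mono[OF i1 order_trans[OF norm_triangle_ineq add_mono[OF _ i3]]]]]])
        show "norm (h *\<^sub>R ?I EI) \<le> h * (cE * K * N ?x)" using i4 h by simp
        show "norm (h *\<^sub>R ?I (\<lambda>\<xi>. cdot (m (t + h) \<xi> - m t \<xi>) (?x' \<xi>))) \<le> h * (c\<rho> * c\<mu> * K2 * h * N ?x')"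
          using i2 h by simp
      qed
      then show ?thesis by (simp add: power2_eq_square algebra_simps)
    qed
    \<comment> \<open>The defect rate inherits the decay of the orbit, so its integral is bounded
      independently of \<open>R\<close>.\<close>
    define B where "B t = cE * K * C * N f * exp (- \<omega> * t)" for t
    have "norm (q R - q 0 - integral {0..R} D) \<le> integral {0..R} B"
    proof (rule right_increment_bound[OF R])
      show "continuous_on {0..R} B" unfolding B_def by (intro continuous_intros)
      have "continuous_on {0..R} (\<lambda>t. P1 *v w t e)"
        by (intro continuous_on_matrix_vector_mult wc continuous_intros)
      then show "continuous_on {0..R} D" unfolding D_eq
        by (intro continuous_intros cdot.continuous_on test_fn_continuous[OF \<Psi>])
      show "continuous_on {0..R} q"
      proof (rule curve_pairing_continuous)
        show "((\<lambda>s. N (\<lambda>\<xi>. T s f \<xi> - T t f \<xi>)) \<longlongrightarrow> 0) (at t within {0..R})" if "t \<in> {0..R}" for t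
          using that V by (intro T_tendsto) auto
        fix s t assume "s \<in> {0..R}" "t \<in> {0..R}"
        then have L1: "T s f \<in> V" "T t f \<in> V" using V by (auto intro!: T_V)
        note d = L1_space_diff[OF L1]
        have "continuous_on {a..b} (\<lambda>\<xi>. m s \<xi> - m t \<xi>)" by (intro continuous_intros mc)
        note l = cdot_L1[OF this m_lip L1(2)] and l1 = cdot_L1[OF mc m_norm d]
        have "q s - q t = (LINT \<xi>|lebesgue_on {a..b}. cdot (m s \<xi>) (T s f \<xi> - T t f \<xi>))
            + (LINT \<xi>|lebesgue_on {a..b}. cdot (m s \<xi> - m t \<xi>) (T t f \<xi>))"
          using cdot_L1(1)[OF mc[of s] m_norm L1(1)] cdot_L1(1)[OF mc[of s] m_norm L1(2)]
            cdot_L1(1)[OF mc[of t] m_norm L1(2)]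
          by (simp add: q_def cdot.diff_right cdot.diff_left L1_space_def)
        then show "norm (q s - q t) \<le> (c\<rho> * c\<mu> * K) * N (\<lambda>\<xi>. T s f \<xi> - T t f \<xi>)
            + (c\<rho> * c\<mu> * K2) * \<bar>s - t\<bar> * N (T t f)"
          using order_trans[OF norm_triangle_ineq add_mono[OF l1(2) l(2)]] by simp
      qed
      fix t \<epsilon> :: real assume t: "0 \<le> t" "t < R" and \<epsilon>: "0 < \<epsilon>"
      \<comment> \<open>\<open>Q\<close> and \<open>Z\<close> are the coefficients of the two terms
        of order o(h), raised by 1 to permit division; each term receives half of
        \<epsilon>.\<close>
      define Q where "Q = c\<rho> * c\<mu> * K + 1"
      have Q: "Q > 0" using c\<rho> c\<mu> K0 by (simp add: Q_def add_nonneg_pos)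
      define Z where "Z = c\<rho> * c\<mu> * K2 * N (T t g) + c\<rho> * c\<mu> * L * N (T t f) + 1"
      have Z: "Z > 0" using c\<rho> c\<mu> K2 KL by (simp add: Z_def add_nonneg_pos L1_norm_nonneg)
      have \<epsilon>Q: "\<epsilon> / (2 * Q) > 0" using \<epsilon> Q by simp
      have "\<epsilon> / (2 * Z) > 0" using \<epsilon> Z by simp
      then have "\<forall>\<^sub>F h in at_right 0. h < \<epsilon> / (2 * Z)"
        unfolding eventually_at_right_field by (intro exI[of _ "\<epsilon> / (2 * Z)"]) auto
      with orbit_right_increment[OF fg t(1) \<epsilon>Q] eventually_at_right_less[of "0::real"]
      show "\<forall>\<^sub>F h in at_right 0. norm (q (t + h) - q t - h *\<^sub>R D t) \<le> (B t + \<epsilon>) * h"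
      proof eventually_elim
        case (elim h)
        have "norm (q (t + h) - q t - h *\<^sub>R D t)
          \<le> c\<rho> * c\<mu> * K * N (\<lambda>\<xi>. T (t + h) f \<xi> - T t f \<xi> - h *\<^sub>R T t g \<xi>)
          + h\<^sup>2 * (c\<rho> * c\<mu> * K2 * N (T t g) + c\<rho> * c\<mu> * L * N (T t f)) + h * (cE * K * N (T t f))"
          by (rule Dint[OF t(1) elim(2)])
        also have "\<dots> \<le> Q * (\<epsilon> / (2 * Q) * h) + h * (\<epsilon> / (2 * Z)) * Z + h * B t"
        proof (intro add_mono)
          show "c\<rho> * c\<mu> * K * N (\<lambda>\<xi>. T (t + h) f \<xi> - T t f \<xi> - h *\<^sub>R T t g \<xi>) \<le> Q * (\<epsilon> / (2 * Q) * h)"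
            using elim Q c\<rho> c\<mu> K0 by (intro mult_mono) (auto simp: Q_def L1_norm_nonneg)
          show "h\<^sup>2 * (c\<rho> * c\<mu> * K2 * N (T t g) + c\<rho> * c\<mu> * L * N (T t f)) \<le> h * (\<epsilon> / (2 * Z)) * Z"
          proof (rule mult_mono)
            show "h\<^sup>2 \<le> h * (\<epsilon> / (2 * Z))"
              using elim(2,3) unfolding power2_eq_square by (intro mult_left_mono) auto
            show "0 \<le> h * (\<epsilon> / (2 * Z))" using elim(2) \<open>\<epsilon> / (2 * Z) > 0\<close> by (intro mult_nonneg_nonneg) auto
            show "0 \<le> c\<rho> * c\<mu> * K2 * N (T t g) + c\<rho> * c\<mu> * L * N (T t f)"
              using c\<rho>(1) c\<mu>(1) K2(1) KL(2) by (simp add: L1_norm_nonneg)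
          qed (simp add: Z_def)
          have "cE * K * N (T t f) \<le> cE * K * (C * exp (- \<omega> * t) * N f)"
            using cE K0 decay[OF t(1) V(1)] by (intro mult_left_mono) auto
          then show "h * (cE * K * N (T t f)) \<le> h * B t"
            using elim(2) by (intro mult_left_mono) (auto simp: B_def mult_ac)
        qed
        also have "\<dots> = (B t + \<epsilon>) * h"
          using Q Z by (simp add: field_simps)
        finally show ?case .
      qed
    qed
    also have "\<dots> \<le> cE * K * C * N f / \<omega>"
      unfolding B_def using cE K0 C_pos \<omega>_pos R
      by (intro integral_exp_decay_le) (auto simp: L1_norm_nonneg)
    finally have main: "norm (q R - q 0 - integral {0..R} D) \<le> cE * K * C * N f / \<omega>" .
    have q_bound: "norm (q t) \<le> c\<rho> * c\<mu> * K * (C * N f)" if "0 \<le> t" for t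
    proof -
      have "norm (q t) \<le> c\<rho> * c\<mu> * K * N (T t f)"
        unfolding q_def by (rule cdot_L1(2)[OF mc m_norm T_V[OF that V(1)]])
      also have "\<dots> \<le> c\<rho> * c\<mu> * K * (C * N f)"
        using c\<rho> c\<mu> K0 T_bound[OF that V(1)] by (intro mult_left_mono) auto
      finally show ?thesis .
    qed
    have "norm (integral {0..R} D) \<le> norm (q R) + norm (q 0) + norm (q R - q 0 - integral {0..R} D)"
      using norm_triangle_ineq4[of "q R - q 0" "q R - q 0 - integral {0..R} D"]
        norm_triangle_ineq4[of "q R" "q 0"] by simp
    also have "\<dots> \<le> c\<rho> * c\<mu> * K * (C * N f) + c\<rho> * c\<mu> * K * (C * N f) + cE * K * C * N f / \<omega>"
      by (intro add_mono q_bound R order_refl main)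
    also have "\<dots> \<le> M * K * N f"
    proof -
      have "0 \<le> K * N f" using K0 by (simp add: L1_norm_nonneg)
      then show ?thesis unfolding M_def by (simp add: algebra_simps)
    qed
    finally have "norm (integral {0..R} D) \<le> M * K * N f" .
    moreover have "norm (integral {0..R} D) = norm (integral {0..R} (\<lambda>t. \<rho> e *\<^sub>R (\<Psi> t * cdot (\<mu> e) (P1 *v w t e))))"
      unfolding D_eq by simp
    ultimately show ?thesis by simp
  qed
  ultimately show thesis by (rule that)
qed

end

text \<open>The diagonalisation S P1 H = diag(\<nu>) S read row by row: the rows of \<open>S\<close>
  are left eigenvectors of P1 H with real, nonvanishing eigenvalues, the characteristic speeds. The
  multiplier argument treats one row at a time.\<close>

definition char_rows :: "real \<Rightarrow> real \<Rightarrow> 'k::real_or_complex^'n^'n \<Rightarrow> (real \<Rightarrow> 'k^'n^'n) \<Rightarrow>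
    (real \<Rightarrow> 'k^'n^'n) \<Rightarrow> (real \<Rightarrow> 'k^'n^'n) \<Rightarrow> ('n \<Rightarrow> real \<Rightarrow> real) \<Rightarrow> bool"
  where "char_rows a b P1 H S S' \<nu> \<longleftrightarrow>
    continuous_on {a..b} S' \<and>
    (\<forall>\<xi>\<in>{a..b}. (S has_vector_derivative S' \<xi>) (at \<xi> within {a..b}) \<and> invertible (S \<xi>)) \<and>
    (\<forall>i. continuous_on {a..b} (\<nu> i) \<and> (\<forall>\<xi>\<in>{a..b}. \<nu> i \<xi> \<noteq> 0)) \<and>
    (AE \<xi> in lebesgue_on {a..b}. \<forall>i x.
      cdot (S \<xi> $ i) (P1 *v (H \<xi> *v x)) = of_real (\<nu> i \<xi>) * cdot (S \<xi> $ i) x)"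

lemma matrix_inv_right_vec:
  fixes A :: "'k::field^'n^'n"
  assumes "invertible A"
  shows "A *v (matrix_inv A *v x) = x"
proof -
  have "A ** matrix_inv A = mat 1"
    unfolding matrix_inv_def using assms unfolding invertible_def by (rule someI2_ex) blast
  then show ?thesis by (simp add: matrix_vector_mul_assoc)
qed

lemma diagonal_mult_vec:
  fixes D :: "'k::comm_ring_1^'n^'n"
  assumes "\<And>j. j \<noteq> i \<Longrightarrow> D $ i $ j = 0"
  shows "(D *v x) $ i = D $ i $ i * x $ i"
proof -
  have "(D *v x) $ i = (\<Sum>j\<in>UNIV. if j = i then D $ i $ i * x $ i else 0)"
    unfolding matrix_vector_mult_def vec_lambda_beta using assms by (intro sum.cong) auto
  then show ?thesis by simp
qed

text \<open>Multiplication of the factorisation by \<open>S\<close> from the left leaves a product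
  of two diagonal matrices; its diagonal entries are the speeds.\<close>

lemma diagonalisable_imp_char_rows:
  assumes "diagonalisable a b P1 H"
  shows "\<exists>S S' \<nu>. char_rows a b P1 H S S' \<nu>"
proof -
  obtain S HD :: "real \<Rightarrow> ('a, 'b) sq_mat" and m where
    C1: "C1_interval a b S" "C1_interval a b HD"
    and inv: "\<And>\<xi>. \<xi> \<in> {a..b} \<Longrightarrow> invertible (S \<xi>)" and pos: "\<And>\<xi>. \<xi> \<in> {a..b} \<Longrightarrow> positive_diagonal (HD \<xi>)"
    and eq: "AE \<xi> in lebesgue_on {a..b}. P1 ** H \<xi> = matrix_inv (S \<xi>) ** sign_matrix m ** HD \<xi> ** S \<xi>"
    using assms unfolding diagonalisable_def by blast
  obtain S' where S': "continuous_on {a..b} S'"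
    "\<And>\<xi>. \<xi> \<in> {a..b} \<Longrightarrow> (S has_vector_derivative S' \<xi>) (at \<xi> within {a..b})"
    using C1(1) unfolding C1_interval_def by blast
  obtain HD' where "\<And>\<xi>. \<xi> \<in> {a..b} \<Longrightarrow> (HD has_vector_derivative HD' \<xi>) (at \<xi> within {a..b})"
    using C1(2) unfolding C1_interval_def by blast
  then have HDc: "continuous_on {a..b} HD"
    unfolding continuous_on_eq_continuous_within by (blast intro: has_vector_derivative_continuous)
  \<comment> \<open>The diagonal entry is a positive real inside the field; its norm is that real
    number.\<close>
  define \<nu> where "\<nu> i \<xi> = (if card {k. k < i} < m then 1 else - 1) * norm (HD \<xi> $ i $ i)" for i \<xi>
  have HDii: "HD \<xi> $ i $ i = of_real (norm (HD \<xi> $ i $ i))" "HD \<xi> $ i $ i \<noteq> 0" if \<xi>: "\<xi> \<in> {a..b}" for \<xi> i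
  proof -
    obtain r where "r > 0" "HD \<xi> $ i $ i = of_real r"
      using pos[OF \<xi>] unfolding positive_diagonal_def by blast
    then show "HD \<xi> $ i $ i = of_real (norm (HD \<xi> $ i $ i))" "HD \<xi> $ i $ i \<noteq> 0" by auto
  qed
  have "AE \<xi> in lebesgue_on {a..b}. \<xi> \<in> {a..b}" using AE_space by eventually_elim simp
  then have "AE \<xi> in lebesgue_on {a..b}. \<forall>i x.
      cdot (S \<xi> $ i) (P1 *v (H \<xi> *v x)) = of_real (\<nu> i \<xi>) * cdot (S \<xi> $ i) x"
    using eq
  proof eventually_elim
    case (elim \<xi>)
    show ?case
    proof (intro allI)
      fix i x
      have "S \<xi> *v (P1 *v (H \<xi> *v x)) = S \<xi> *v (matrix_inv (S \<xi>) *v (sign_matrix m *v (HD \<xi> *v (S \<xi> *v x))))"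
        using elim(2) by (simp add: matrix_vector_mul_assoc matrix_mul_assoc)
      also have "\<dots> = sign_matrix m *v (HD \<xi> *v (S \<xi> *v x))"
        by (rule matrix_inv_right_vec[OF inv[OF elim(1)]])
      finally have "(S \<xi> *v (P1 *v (H \<xi> *v x))) $ i = (sign_matrix m *v (HD \<xi> *v (S \<xi> *v x))) $ i"
        by simp
      also have "\<dots> = sign_matrix m $ i $ i * (HD \<xi> *v (S \<xi> *v x)) $ i"
        by (rule diagonal_mult_vec) (simp add: sign_matrix_def)
      also have "(HD \<xi> *v (S \<xi> *v x)) $ i = HD \<xi> $ i $ i * (S \<xi> *v x) $ i"
        using pos[OF elim(1)] by (intro diagonal_mult_vec) (simp add: positive_diagonal_def)
      also have "sign_matrix m $ i $ i * (HD \<xi> $ i $ i * (S \<xi> *v x) $ i) = of_real (\<nu> i \<xi>) * (S \<xi> *v x) $ i"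
        using HDii(1)[OF elim(1), of i] by (simp add: \<nu>_def sign_matrix_def)
      finally show "cdot (S \<xi> $ i) (P1 *v (H \<xi> *v x)) = of_real (\<nu> i \<xi>) * cdot (S \<xi> $ i) x"
        by (simp add: matrix_vector_mult_cdot)
    qed
  qed
  moreover have "continuous_on {a..b} (\<nu> i)" for i
    unfolding \<nu>_def by (intro continuous_intros HDc)
  moreover have "\<nu> i \<xi> \<noteq> 0" if "\<xi> \<in> {a..b}" for i \<xi>
    using HDii(2)[OF that, of i] by (simp add: \<nu>_def)
  ultimately have "char_rows a b P1 H S S' \<nu>"
    unfolding char_rows_def using S' inv by blast
  then show ?thesis by blast
qed

lemma cdot_stack_vec:
  "cdot r (stack_vec u v) = (\<Sum>j\<in>UNIV. r $ Inl j * u $ j) + (\<Sum>j\<in>UNIV. r $ Inr j * v $ j)"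
  unfolding cdot_def UNIV_Plus_UNIV[symmetric] Plus_def
  by (subst sum.union_disjoint) (auto simp: sum.reindex stack_vec_def)

text \<open>The rows of an invertible matrix span all linear functionals. For \<open>Q\<close> =
  S(e) P1 this expresses any trace component at the end \<open>e\<close> by the characteristic
  components there.\<close>

lemma linear_functional_via_rows:
  fixes Q :: "'k::real_or_complex^'n^'n"
  assumes "invertible Q"
  shows "\<exists>\<beta>. \<forall>u. (\<Sum>j\<in>UNIV. s j * u $ j) = (\<Sum>i\<in>UNIV. \<beta> i * (Q *v u) $ i)"
proof -
  obtain B where B: "B ** Q = mat 1" using assms unfolding invertible_def by blast
  have "(\<Sum>j\<in>UNIV. s j * u $ j) = (\<Sum>i\<in>UNIV. (\<Sum>j\<in>UNIV. s j * B $ j $ i) * (Q *v u) $ i)" for u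
  proof -
    have u: "u = B *v (Q *v u)" by (simp add: matrix_vector_mul_assoc B)
    have "(\<Sum>j\<in>UNIV. s j * u $ j) = (\<Sum>j\<in>UNIV. s j * (\<Sum>i\<in>UNIV. B $ j $ i * (Q *v u) $ i))"
      by (subst u) (simp add: matrix_vector_mult_def[of B])
    also have "\<dots> = (\<Sum>j\<in>UNIV. \<Sum>i\<in>UNIV. s j * B $ j $ i * (Q *v u) $ i)"
      by (simp add: sum_distrib_left mult.assoc)
    also have "\<dots> = (\<Sum>i\<in>UNIV. \<Sum>j\<in>UNIV. s j * B $ j $ i * (Q *v u) $ i)"
      by (rule sum.swap)
    finally show ?thesis by (simp add: sum_distrib_right)
  qed
  then show ?thesis by (intro exI[of _ "\<lambda>i. \<Sum>j\<in>UNIV. s j * B $ j $ i"] allI)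
qed

context stable_hyperbolic
begin

text \<open>L^1 admissibility of the observation \<open>r\<close> in dual form: the L^1 norm in time
  is tested with functions bounded by \<open>K\<close>. The constant depends neither on the horizon
  \<open>R\<close> nor on \<Psi>'.\<close>

definition admissible_const :: "'k^('n + 'n) \<Rightarrow> real \<Rightarrow> bool"
  where "admissible_const r M \<longleftrightarrow> 0 \<le> M \<and> (\<forall>f g \<Psi> \<Psi>' K R. (f, g) \<in> dom_A \<longrightarrow> test_fn \<Psi> \<Psi>' \<longrightarrow>
      (\<forall>t. norm (\<Psi> t) \<le> K) \<longrightarrow> 0 \<le> R \<longrightarrow>
      norm (integral {0..R} (\<lambda>t. \<Psi> t * cdot r (btrace (T t f)))) \<le> M * K * N f)"

lemma admissible_constD:
  assumes "admissible_const r M" "(f, g) \<in> dom_A" "test_fn \<Psi> \<Psi>'" "\<And>t. norm (\<Psi> t) \<le> K" "0 \<le> R"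
  shows "norm (integral {0..R} (\<lambda>t. \<Psi> t * cdot r (btrace (T t f)))) \<le> M * K * N f"
  using assms unfolding admissible_const_def by blast

text \<open>The representatives are chosen separately for each \<open>t\<close>, so continuity in
  time is not automatic. At the two ends it follows from continuity of \<open>btrace\<close>, which
  the choice cannot affect.\<close>

lemma orbit_trace_representative:
  assumes fg: "(f, g) \<in> dom_A"
  obtains w where "\<And>t. 0 \<le> t \<Longrightarrow> hyp (T t f) (w t) (T t g)"
    "\<And>t. 0 \<le> t \<Longrightarrow> btrace (T t f) = stack_vec (w t b) (w t a)"
    "\<And>e R. e = a \<or> e = b \<Longrightarrow> continuous_on {0..R} (\<lambda>t. w t e)"
proof -
  have "\<exists>w. 0 \<le> t \<longrightarrow> hyp (T t f) w (T t g)" for t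
    using dom_A_orbit[OF fg, of t] unfolding dom_A_iff by blast
  then obtain w where w: "\<And>t. 0 \<le> t \<Longrightarrow> hyp (T t f) (w t) (T t g)" by metis
  have bt: "btrace (T t f) = stack_vec (w t b) (w t a)" if "0 \<le> t" for t
    by (rule hyp_btrace[OF w[OF that]])
  have c: "continuous_on {0..R} (\<lambda>t. btrace (T t f))" for R
    by (rule continuous_on_subset[OF orbit_btrace_continuous[OF fg]]) auto
  have "continuous_on {0..R} (\<lambda>t. w t e)" if e: "e = a \<or> e = b" for e R
  proof -
    have cb: "continuous_on {0..R} (\<lambda>t. (\<chi> j. btrace (T t f) $ Inl j) :: 'k^'n)"
      and ca: "continuous_on {0..R} (\<lambda>t. (\<chi> j. btrace (T t f) $ Inr j) :: 'k^'n)"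
      by (intro continuous_intros c)+
    have "w t b = (\<chi> j. btrace (T t f) $ Inl j)" "w t a = (\<chi> j. btrace (T t f) $ Inr j)" if "t \<in> {0..R}" for t
      using that bt[of t] by (simp_all add: stack_vec_def vec_eq_iff)
    then show ?thesis
      using e continuous_on_cong[OF refl, of "{0..R}" "\<lambda>t. w t b", THEN iffD2, OF _ cb]
        continuous_on_cong[OF refl, of "{0..R}" "\<lambda>t. w t a", THEN iffD2, OF _ ca] by blast
  qed
  with w bt show thesis by (rule that)
qed

text \<open>The multiplier bound holds for every characteristic component at either end, whatever
  the sign of its speed, and these components determine the whole trace.\<close>

lemma admissible:
  assumes rows: "char_rows a b P1 H S S' \<nu>"
  shows "\<exists>M. admissible_const r M"
proof -
  have S'c: "continuous_on {a..b} S'"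
    and S': "\<And>\<xi>. \<xi> \<in> {a..b} \<Longrightarrow> (S has_vector_derivative S' \<xi>) (at \<xi> within {a..b})"
    and inv: "\<And>\<xi>. \<xi> \<in> {a..b} \<Longrightarrow> invertible (S \<xi>)"
    and \<nu>: "\<And>i. continuous_on {a..b} (\<nu> i)" "\<And>i \<xi>. \<xi> \<in> {a..b} \<Longrightarrow> \<nu> i \<xi> \<noteq> 0"
    and ch: "AE \<xi> in lebesgue_on {a..b}. \<forall>i x.
      cdot (S \<xi> $ i) (P1 *v (H \<xi> *v x)) = of_real (\<nu> i \<xi>) * cdot (S \<xi> $ i) x"
    using rows unfolding char_rows_def by blast+
  define Q where "Q e i M \<longleftrightarrow> M > 0 \<and> (\<forall>f g w \<Psi> \<Psi>' K R. (f, g) \<in> dom_A \<longrightarrow> test_fn \<Psi> \<Psi>' \<longrightarrow>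
      (\<forall>t. norm (\<Psi> t) \<le> K) \<longrightarrow> 0 \<le> R \<longrightarrow> (\<forall>t\<ge>0. hyp (T t f) (w t) (T t g)) \<longrightarrow>
      continuous_on {0..R} (\<lambda>t. w t e) \<longrightarrow>
      norm (integral {0..R} (\<lambda>t. \<Psi> t * cdot (S e $ i) (P1 *v w t e))) \<le> M * K * N f)" for e i M
  have one: "\<exists>M. Q e i M" if e: "e = a \<or> e = b" for e i
  proof -
    \<comment> \<open>The slope is chosen so that the affine weight \<rho> vanishes at the end
      opposite to \<open>e\<close> and equals \<open>b - a\<close> at \<open>e\<close>; division by
      \<open>b - a\<close> then isolates the trace.\<close>
    define \<rho>' where "\<rho>' = (if e = b then 1 else - 1 :: real)"
    define \<rho> where "\<rho> \<xi> = - \<rho>' * (a + b - e) + \<rho>' * \<xi>" for \<xi>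
    have \<rho>e: "\<rho> e = b - a" using e ab by (auto simp: \<rho>_def \<rho>'_def)
    have row: "((\<lambda>\<xi>. S \<xi> $ i) has_vector_derivative S' \<xi> $ i) (at \<xi> within {a..b})" if "\<xi> \<in> {a..b}" for \<xi>
      by (rule bounded_linear.has_vector_derivative[OF bounded_linear_vec_nth S'[OF that]])
    have rowc: "continuous_on {a..b} (\<lambda>\<xi>. S' \<xi> $ i)" by (intro continuous_intros S'c)
    have chi: "AE \<xi> in lebesgue_on {a..b}. \<forall>x.
        cdot (S \<xi> $ i) (P1 *v (H \<xi> *v x)) = of_real (\<nu> i \<xi>) * cdot (S \<xi> $ i) x"
      using ch by eventually_elim blast
    have \<rho>0: "\<rho> (a + b - e) = 0" by (simp add: \<rho>_def)
    obtain M where M: "M > 0" "\<And>f g w \<Psi> \<Psi>' K R. (f, g) \<in> dom_A \<Longrightarrow> test_fn \<Psi> \<Psi>' \<Longrightarrow>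
      (\<And>t. norm (\<Psi> t) \<le> K) \<Longrightarrow> 0 \<le> R \<Longrightarrow> (\<And>t. 0 \<le> t \<Longrightarrow> hyp (T t f) (w t) (T t g)) \<Longrightarrow>
      continuous_on {0..R} (\<lambda>t. w t e) \<Longrightarrow>
      norm (integral {0..R} (\<lambda>t. \<rho> e *\<^sub>R (\<Psi> t * cdot (S e $ i) (P1 *v w t e)))) \<le> M * K * N f"
      using characteristic_trace_bound[OF row rowc \<nu>(1)[of i] \<nu>(2)[of _ i] chi \<rho>_def e \<rho>0] by blast
    have "Q e i (M / (b - a))" unfolding Q_def
    proof (intro conjI allI impI)
      show "M / (b - a) > 0" using M(1) ab by simp
    next
      fix f g w and \<Psi> \<Psi>' :: "real \<Rightarrow> 'k" and K R
      assume *: "(f, g) \<in> dom_A" "test_fn \<Psi> \<Psi>'" "\<forall>t. norm (\<Psi> t) \<le> K" "0 \<le> R"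
        "\<forall>t\<ge>0. hyp (T t f) (w t) (T t g)" "continuous_on {0..R} (\<lambda>t. w t e)"
      then have "norm (integral {0..R} (\<lambda>t. \<rho> e *\<^sub>R (\<Psi> t * cdot (S e $ i) (P1 *v w t e)))) \<le> M * K * N f"
        by (intro M(2)) blast+
      then show "norm (integral {0..R} (\<lambda>t. \<Psi> t * cdot (S e $ i) (P1 *v w t e))) \<le> M / (b - a) * K * N f"
        using ab unfolding \<rho>e integral_cmul norm_scaleR by (simp add: pos_le_divide_eq mult_ac)
    qed
    then show ?thesis by blast
  qed
  have "\<forall>i. \<exists>M. Q b i M" "\<forall>i. \<exists>M. Q a i M" using one by blast+
  then obtain Mb Ma where QM: "\<And>i. Q b i (Mb i)" "\<And>i. Q a i (Ma i)" by metis
  have Mb: "Mb i > 0" "\<And>f g w \<Psi> \<Psi>' K R. (f, g) \<in> dom_A \<Longrightarrow> test_fn \<Psi> \<Psi>' \<Longrightarrow>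
      (\<forall>t. norm (\<Psi> t) \<le> K) \<Longrightarrow> 0 \<le> R \<Longrightarrow> (\<forall>t\<ge>0. hyp (T t f) (w t) (T t g)) \<Longrightarrow>
      continuous_on {0..R} (\<lambda>t. w t b) \<Longrightarrow>
      norm (integral {0..R} (\<lambda>t. \<Psi> t * cdot (S b $ i) (P1 *v w t b))) \<le> Mb i * K * N f" for i
    using QM(1)[of i] unfolding Q_def by blast+
  have Ma: "Ma i > 0" "\<And>f g w \<Psi> \<Psi>' K R. (f, g) \<in> dom_A \<Longrightarrow> test_fn \<Psi> \<Psi>' \<Longrightarrow>
      (\<forall>t. norm (\<Psi> t) \<le> K) \<Longrightarrow> 0 \<le> R \<Longrightarrow> (\<forall>t\<ge>0. hyp (T t f) (w t) (T t g)) \<Longrightarrow>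
      continuous_on {0..R} (\<lambda>t. w t a) \<Longrightarrow>
      norm (integral {0..R} (\<lambda>t. \<Psi> t * cdot (S a $ i) (P1 *v w t a))) \<le> Ma i * K * N f" for i
    using QM(2)[of i] unfolding Q_def by blast+
  have "invertible (S b ** P1)" "invertible (S a ** P1)"
    using inv[of a] inv[of b] ab P1_inv by (simp_all add: invertible_mult)
  from linear_functional_via_rows[OF this(1), of "\<lambda>j. r $ Inl j"]
    linear_functional_via_rows[OF this(2), of "\<lambda>j. r $ Inr j"]
  obtain \<beta> \<gamma> where
    \<beta>: "\<And>u. (\<Sum>j\<in>UNIV. r $ Inl j * u $ j) = (\<Sum>i\<in>UNIV. \<beta> i * cdot (S b $ i) (P1 *v u))"
    and \<gamma>: "\<And>u. (\<Sum>j\<in>UNIV. r $ Inr j * u $ j) = (\<Sum>i\<in>UNIV. \<gamma> i * cdot (S a $ i) (P1 *v u))"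
    by (auto simp: matrix_vector_mul_assoc[symmetric] matrix_vector_mult_cdot[symmetric])
  define M where "M = (\<Sum>i\<in>UNIV. norm (\<beta> i) * Mb i) + (\<Sum>i\<in>UNIV. norm (\<gamma> i) * Ma i)"
  have "admissible_const r M" unfolding admissible_const_def
  proof (intro conjI allI impI)
    show "0 \<le> M" unfolding M_def using Mb(1) Ma(1)
      by (intro add_nonneg_nonneg sum_nonneg mult_nonneg_nonneg) (auto intro: less_imp_le)
    fix f g and \<Psi> \<Psi>' :: "real \<Rightarrow> 'k" and K R
    assume fg: "(f, g) \<in> dom_A" and \<Psi>: "test_fn \<Psi> \<Psi>'" and K: "\<forall>t. norm (\<Psi> t) \<le> K" and R: "0 \<le> (R::real)"
    obtain w where w: "\<And>t. 0 \<le> t \<Longrightarrow> hyp (T t f) (w t) (T t g)"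
      "\<And>t. 0 \<le> t \<Longrightarrow> btrace (T t f) = stack_vec (w t b) (w t a)"
      "\<And>e R. e = a \<or> e = b \<Longrightarrow> continuous_on {0..R} (\<lambda>t. w t e)"
      by (rule orbit_trace_representative[OF fg]) blast
    have w1: "\<forall>t\<ge>0. hyp (T t f) (w t) (T t g)" using w(1) by blast
    have wc: "continuous_on {0..R} (\<lambda>t. w t b)" "continuous_on {0..R} (\<lambda>t. w t a)" using w(3) by auto
    have \<Psi>c: "continuous_on {0..R} \<Psi>" by (rule test_fn_continuous[OF \<Psi>])
    let ?Fb = "\<lambda>i t. \<Psi> t * cdot (S b $ i) (P1 *v w t b)" and ?Fa = "\<lambda>i t. \<Psi> t * cdot (S a $ i) (P1 *v w t a)"
    have ib: "?Fb i integrable_on {0..R}" and ia: "?Fa i integrable_on {0..R}" for i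
      by (intro integrable_continuous_real continuous_intros \<Psi>c cdot.continuous_on
          continuous_on_matrix_vector_mult wc)+
    have "integral {0..R} (\<lambda>t. \<Psi> t * cdot r (btrace (T t f)))
        = integral {0..R} (\<lambda>t. (\<Sum>i\<in>UNIV. \<beta> i * ?Fb i t) + (\<Sum>i\<in>UNIV. \<gamma> i * ?Fa i t))"
      by (rule integral_cong) (simp add: w(2) cdot_stack_vec \<beta> \<gamma> distrib_left sum_distrib_left mult.left_commute)
    also have "\<dots> = (\<Sum>i\<in>UNIV. \<beta> i * integral {0..R} (?Fb i)) + (\<Sum>i\<in>UNIV. \<gamma> i * integral {0..R} (?Fa i))"
      by (intro integral_unique has_integral_add has_integral_sum has_integral_mult_right
          integrable_integral ib ia) auto
    finally have eq: "integral {0..R} (\<lambda>t. \<Psi> t * cdot r (btrace (T t f)))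
        = (\<Sum>i\<in>UNIV. \<beta> i * integral {0..R} (?Fb i)) + (\<Sum>i\<in>UNIV. \<gamma> i * integral {0..R} (?Fa i))" .
    have "norm (integral {0..R} (\<lambda>t. \<Psi> t * cdot r (btrace (T t f))))
        \<le> (\<Sum>i\<in>UNIV. norm (\<beta> i) * (Mb i * K * N f)) + (\<Sum>i\<in>UNIV. norm (\<gamma> i) * (Ma i * K * N f))"
      unfolding eq
    proof (rule order_trans[OF norm_triangle_ineq add_mono[OF sum_norm_le sum_norm_le]])
      show "norm (\<beta> i * integral {0..R} (?Fb i)) \<le> norm (\<beta> i) * (Mb i * K * N f)" for i
        unfolding norm_mult by (intro mult_left_mono Mb(2)[OF fg \<Psi> K R w1 wc(1)]) auto
      show "norm (\<gamma> i * integral {0..R} (?Fa i)) \<le> norm (\<gamma> i) * (Ma i * K * N f)" for i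
        unfolding norm_mult by (intro mult_left_mono Ma(2)[OF fg \<Psi> K R w1 wc(2)]) auto
    qed
    also have "\<dots> = M * K * N f"
      by (simp add: M_def distrib_right sum_distrib_right mult.assoc)
    finally show "norm (integral {0..R} (\<lambda>t. \<Psi> t * cdot r (btrace (T t f)))) \<le> M * K * N f" .
  qed
  then show ?thesis by blast
qed

end

lemma eventually_at_right_less_real: "(0::real) < c \<Longrightarrow> \<forall>\<^sub>F h in at_right 0. h < c"
  unfolding eventually_at_right_field by (intro exI[of _ c]) auto

section \<open>Response to distributed sources\<close>

context stable_hyperbolic
begin

section \<open>Observed traces along orbits\<close>

lemma cdot_btrace_orbit_continuous:
  "(f, g) \<in> dom_A \<Longrightarrow> 0 \<le> l \<Longrightarrow> continuous_on {l..R} (\<lambda>t. cdot r (btrace (T t f)))"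
  by (intro cdot.continuous_on continuous_intros continuous_on_subset[OF orbit_btrace_continuous]) auto

lemma btrace_T_diff:
  assumes "(f, g) \<in> dom_A" "(f', g') \<in> dom_A" "0 \<le> t"
  shows "btrace (T t (\<lambda>\<xi>. f \<xi> - f' \<xi>)) = btrace (T t f) - btrace (T t f')"
proof -
  note d = dom_A_diff[OF assms(1,2)]
  note o = dom_A_orbit[OF assms(1,3)] dom_A_orbit[OF assms(2,3)]
  have "btrace (T t (\<lambda>\<xi>. f \<xi> - f' \<xi>)) = btrace (\<lambda>\<xi>. T t f \<xi> - T t f' \<xi>)"
    by (rule btrace_cong[OF dom_A_orbit[OF d assms(3)] dom_A_diff[OF o]
          T_diff[OF assms(3) dom_A_V(1)[OF assms(1)] dom_A_V(1)[OF assms(2)]]])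
  then show ?thesis by (simp add: btrace_diff[OF o])
qed

lemma btrace_T_smult:
  assumes "(f, g) \<in> dom_A" "0 \<le> t"
  shows "btrace (T t (\<lambda>\<xi>. c *s f \<xi>)) = c *s btrace (T t f)"
proof -
  note o = dom_A_orbit[OF assms]
  have "btrace (T t (\<lambda>\<xi>. c *s f \<xi>)) = btrace (\<lambda>\<xi>. c *s T t f \<xi>)"
    by (rule btrace_cong[OF dom_A_orbit[OF dom_A_smult[OF assms(1)] assms(2)] dom_A_smult[OF o]
          T_smult[OF assms(2) dom_A_V(1)[OF assms(1)]]])
  then show ?thesis by (simp add: btrace_smult[OF o])
qed

lemma btrace_T_plus:
  assumes "(f, g) \<in> dom_A" "0 \<le> s" "0 \<le> t"
  shows "btrace (T s (T t f)) = btrace (T (s + t) f)"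
  using assms dom_A_orbit[OF dom_A_orbit[OF assms(1,3)] assms(2)] dom_A_orbit[OF assms(1), of "s + t"]
  by (intro btrace_cong[symmetric] T_plus dom_A_V(1)) auto

text \<open>
  As a functional of \<open>f\<close>, this is the state at time \<open>s\<close> of the adjoint system driven by \<open>\<psi>\<close>.
\<close>

definition adj :: "'k^('n + 'n) \<Rightarrow> (real \<Rightarrow> 'k) \<Rightarrow> real \<Rightarrow> real \<Rightarrow> (real \<Rightarrow> 'k^'n) \<Rightarrow> 'k"
  where "adj r \<psi> t0 s f = integral {0..t0} (\<lambda>t. \<psi> (s + t) * cdot r (btrace (T t f)))"

section \<open>Linearity, bounds and evolution of the adjoint state\<close>

lemma adj_integrable:
  assumes "test_fn \<psi> \<psi>'" "(f, g) \<in> dom_A"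
  shows "continuous_on {0..t0} (\<lambda>t. \<psi> (s + t) * cdot r (btrace (T t f)))"
    "(\<lambda>t. \<psi> (s + t) * cdot r (btrace (T t f))) integrable_on {0..t0}"
proof -
  show c: "continuous_on {0..t0} (\<lambda>t. \<psi> (s + t) * cdot r (btrace (T t f)))"
    by (intro continuous_on_mult test_fn_continuous[OF test_fn_shift[OF assms(1)]]
        cdot_btrace_orbit_continuous[OF assms(2)] order_refl)
  show "(\<lambda>t. \<psi> (s + t) * cdot r (btrace (T t f))) integrable_on {0..t0}"
    by (rule integrable_continuous_real[OF c])
qed

lemma adj_diff:
  assumes "test_fn \<psi> \<psi>'" "(f, g) \<in> dom_A" "(f', g') \<in> dom_A"
  shows "adj r \<psi> t0 s (\<lambda>\<xi>. f \<xi> - f' \<xi>) = adj r \<psi> t0 s f - adj r \<psi> t0 s f'"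
proof -
  have "adj r \<psi> t0 s (\<lambda>\<xi>. f \<xi> - f' \<xi>) = integral {0..t0} (\<lambda>t. \<psi> (s + t) * cdot r (btrace (T t f))
      - \<psi> (s + t) * cdot r (btrace (T t f')))"
    unfolding adj_def
    by (rule integral_cong) (simp add: btrace_T_diff[OF assms(2,3)] cdot.diff_right right_diff_distrib)
  also have "\<dots> = adj r \<psi> t0 s f - adj r \<psi> t0 s f'"
    unfolding adj_def
    by (rule Henstock_Kurzweil_Integration.integral_diff[OF adj_integrable(2)[OF assms(1,2)] adj_integrable(2)[OF assms(1,3)]])
  finally show ?thesis .
qed

lemma adj_smult:
  assumes "test_fn \<psi> \<psi>'" "(f, g) \<in> dom_A"
  shows "adj r \<psi> t0 s (\<lambda>\<xi>. c *s f \<xi>) = c * adj r \<psi> t0 s f"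
proof -
  have "adj r \<psi> t0 s (\<lambda>\<xi>. c *s f \<xi>) = integral {0..t0} (\<lambda>t. c * (\<psi> (s + t) * cdot r (btrace (T t f))))"
    unfolding adj_def
    by (rule integral_cong) (simp add: btrace_T_smult[OF assms(2)] cdot_smult mult_ac)
  also have "\<dots> = c * adj r \<psi> t0 s f"
    unfolding adj_def by (rule integral_mult_right)
  finally show ?thesis .
qed

lemma adj_add:
  assumes "test_fn \<psi> \<psi>'" "(f, g) \<in> dom_A" "(f', g') \<in> dom_A"
  shows "adj r \<psi> t0 s (\<lambda>\<xi>. f \<xi> + f' \<xi>) = adj r \<psi> t0 s f + adj r \<psi> t0 s f'"
  using adj_diff[OF assms(1,2) dom_A_smult[OF assms(3), of "-1"]] adj_smult[OF assms(1,3), of r t0 s "-1"]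
  by simp

lemma adj_sum:
  assumes "test_fn \<psi> \<psi>'" "finite J" "\<And>j. j \<in> J \<Longrightarrow> (f j, g j) \<in> dom_A"
  shows "adj r \<psi> t0 s (\<lambda>\<xi>. \<Sum>j\<in>J. c j *s f j \<xi>) = (\<Sum>j\<in>J. c j * adj r \<psi> t0 s (f j))"
  using assms(2,3)
proof (induction J)
  case empty
  have "(\<lambda>\<xi>. 0, \<lambda>\<xi>. 0) \<in> dom_A" using dom_A_sum[of "{}"] by simp
  from adj_smult[OF assms(1) this, of r t0 s 0] show ?case by simp
next
  case (insert j J)
  have 1: "(\<lambda>\<xi>. c j *s f j \<xi>, \<lambda>\<xi>. c j *s g j \<xi>) \<in> dom_A" using insert by (intro dom_A_smult) auto
  have 2: "(\<lambda>\<xi>. \<Sum>j\<in>J. c j *s f j \<xi>, \<lambda>\<xi>. \<Sum>j\<in>J. c j *s g j \<xi>) \<in> dom_A"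
    using insert by (intro dom_A_sum) auto
  show ?case using insert adj_add[OF assms(1) 1 2, of r t0 s] adj_smult[OF assms(1), of "f j" "g j" r t0 s "c j"]
    by simp
qed

text \<open>Translating \<psi> keeps the bound on its sup. Although defined through traces, the
  adjoint states are thus bounded by the L^1 norm of \<open>f\<close>, uniformly in
  \<open>s\<close>.\<close>

lemma adj_bound:
  assumes "admissible_const r M" "test_fn \<psi> \<psi>'" "\<And>t. norm (\<psi> t) \<le> K" "0 \<le> t0" "(f, g) \<in> dom_A"
  shows "norm (adj r \<psi> t0 s f) \<le> M * K * N f"
  unfolding adj_def
  by (rule admissible_constD[OF assms(1,5) test_fn_shift[OF assms(2)] assms(3,4)])

text \<open>The difference of two adjoint states is tested by the difference of two translates of
  \<psi>, whose sup is at most \<open>K * \<bar>s - s'\<bar>\<close>; again only the L^1 norm of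
  \<open>f\<close> enters.\<close>

lemma adj_lipschitz:
  assumes "admissible_const r M" "test_fn \<psi> \<psi>'" "\<And>s t. norm (\<psi> s - \<psi> t) \<le> K * \<bar>s - t\<bar>" "0 \<le> t0" "(f, g) \<in> dom_A"
  shows "norm (adj r \<psi> t0 s f - adj r \<psi> t0 s' f) \<le> M * (K * \<bar>s - s'\<bar>) * N f"
proof -
  have "adj r \<psi> t0 s f - adj r \<psi> t0 s' f
      = integral {0..t0} (\<lambda>t. (\<psi> (s + t) - \<psi> (s' + t)) * cdot r (btrace (T t f)))"
    unfolding adj_def left_diff_distrib
    by (rule Henstock_Kurzweil_Integration.integral_diff[symmetric]) (rule adj_integrable(2)[OF assms(2,5)])+
  moreover have "norm (\<psi> (s + t) - \<psi> (s' + t)) \<le> K * \<bar>s - s'\<bar>" for t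
    using assms(3)[of "s + t" "s' + t"] by simp
  ultimately show ?thesis
    using admissible_constD[OF assms(1,5) test_fn_diff[OF test_fn_shift[OF assms(2), of s] test_fn_shift[OF assms(2), of s']]
        _ assms(4)] by simp
qed

text \<open>The integrated adjoint equation: the integral is split at \<open>h\<close>, and its tail
  is rewritten by the semigroup law. Extending the window to \<open>t0 + h\<close> adds nothing
  since \<psi> vanishes from \<open>t0\<close> on.\<close>

lemma adj_shift:
  assumes \<psi>: "test_fn \<psi> \<psi>'" and supp: "\<And>t. t0 \<le> t \<Longrightarrow> \<psi> t = 0" and fg: "(f, g) \<in> dom_A"
    and s: "0 \<le> s" and h: "0 \<le> h" "h \<le> t0"
  shows "adj r \<psi> t0 s f = integral {0..h} (\<lambda>t. \<psi> (s + t) * cdot r (btrace (T t f))) + adj r \<psi> t0 (s + h) (T h f)"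
proof -
  let ?F = "\<lambda>t. \<psi> (s + t) * cdot r (btrace (T t f))"
  have int: "?F integrable_on {0..c}" for c by (rule adj_integrable(2)[OF \<psi> fg])
  have c: "continuous_on {h..t0 + h} ?F"
    by (rule continuous_on_subset[OF adj_integrable(1)[OF \<psi> fg, of "t0 + h"]]) (use h in auto)
  have "adj r \<psi> t0 (s + h) (T h f) = integral {0..t0} (\<lambda>t. ?F (t + h))"
    unfolding adj_def
    by (rule integral_cong) (use h in \<open>simp add: btrace_T_plus[OF fg] add_ac\<close>)
  also have "\<dots> = integral {h..t0 + h} ?F"
    using integral_shift_real_ivl[of h h "t0 + h" ?F] by simp
  also have "\<dots> = integral {h..t0} ?F + integral {t0..t0 + h} ?F"
    using h by (intro Henstock_Kurzweil_Integration.integral_combine[symmetric] integrable_continuous_real c) auto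
  also have "integral {t0..t0 + h} ?F = integral {t0..t0 + h} (\<lambda>_. 0)"
    by (rule integral_cong) (use s in \<open>simp add: supp\<close>)
  finally have "adj r \<psi> t0 (s + h) (T h f) = integral {h..t0} ?F" by simp
  moreover have "adj r \<psi> t0 s f = integral {0..h} ?F + integral {h..t0} ?F"
    unfolding adj_def using h by (intro Henstock_Kurzweil_Integration.integral_combine[symmetric] int) auto
  ultimately show ?thesis by simp
qed

text \<open>The adjoint state paired with \<open>z\<close> vanishes at time 0, where
  \<open>z\<close> does, and at \<open>t0\<close>, where the adjoint state does. Its derivative is
  the source term minus the weighted observation, so integration expresses the observation by the
  sources. Exchanging integrals turns these into orbit traces tested by the convolution of \<alpha>
  and \<psi>.\<close>

lemma source_response_weak:
  assumes adm: "admissible_const r M" and J: "finite J"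
    and z: "\<And>t. 0 \<le> t \<Longrightarrow> (z t, Az t) \<in> dom_A"
    and z_inc: "\<And>t e. 0 \<le> t \<Longrightarrow> 0 < e \<Longrightarrow> \<forall>\<^sub>F h in at_right 0.
      N (\<lambda>\<xi>. z (t + h) \<xi> - z t \<xi> - h *\<^sub>R (Az t \<xi> + (\<Sum>j\<in>J. \<alpha> j t *s g j \<xi>))) \<le> e * h"
    and z_cont: "\<And>t. 0 \<le> t \<Longrightarrow> ((\<lambda>s. N (\<lambda>\<xi>. z s \<xi> - z t \<xi>)) \<longlongrightarrow> 0) (at t within {0..})"
    and z0: "N (z 0) = 0" and y: "continuous_on {0..} (\<lambda>t. cdot r (btrace (z t)))"
    and \<alpha>: "\<And>j. j \<in> J \<Longrightarrow> continuous_on {0..} (\<alpha> j)" and g: "\<And>j. j \<in> J \<Longrightarrow> g j \<in> V"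
    and t0: "0 < t0" and A: "\<And>j t. j \<in> J \<Longrightarrow> t \<in> {0..t0} \<Longrightarrow> norm (\<alpha> j t) \<le> A j"
    and \<psi>: "test_fn \<psi> \<psi>'" and supp: "\<And>t. t0 \<le> t \<Longrightarrow> \<psi> t = 0"
    and \<psi>_bound: "\<And>t. norm (\<psi> t) \<le> K"
    and \<psi>_int: "\<And>t. integral {0..t0} (\<lambda>s. norm (\<psi> (s + t))) \<le> I"
  shows "norm (integral {0..t0} (\<lambda>t. \<psi> t * cdot r (btrace (z t)))) \<le> M * I * (\<Sum>j\<in>J. A j * N (g j))"
proof (rule field_le_epsilon)
  fix \<epsilon> :: real assume \<epsilon>: "0 < \<epsilon>"
  have M: "0 \<le> M" using adm by (simp add: admissible_const_def)
  have K: "0 \<le> K" using order_trans[OF norm_ge_zero \<psi>_bound] .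
  have \<psi>sc: "continuous_on {0..t0} (\<lambda>s. \<psi> (s + t))" for t
    by (rule continuous_on_compose2[OF test_fn_continuous[OF \<psi>, of UNIV]]) (auto intro!: continuous_intros)
  have I: "0 \<le> I"
    by (rule order_trans[OF Henstock_Kurzweil_Integration.integral_nonneg \<psi>_int[of 0]])
       (rule integrable_continuous_real[OF continuous_on_norm[OF \<psi>sc]], simp)
  have A0: "0 \<le> A j" if "j \<in> J" for j
    by (rule order_trans[OF norm_ge_zero A[OF that, of 0]]) (use t0 in simp)
  have SA: "0 \<le> (\<Sum>j\<in>J. A j)" by (rule sum_nonneg) (rule A0)
  \<comment> \<open>The total error is \<delta> times the product in the denominator: the part with
    \<open>I\<close> arises from \<open>N (p j)\<close> in place of \<open>N (g j)\<close>, the part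
    with \<open>t0 * K\<close> from the defect \<open>B\<close> over the whole interval.\<close>
  define \<delta> where "\<delta> = \<epsilon> / (M * (I + t0 * K) * (\<Sum>j\<in>J. A j) + 1)"
  have den: "M * (I + t0 * K) * (\<Sum>j\<in>J. A j) + 1 > 0"
    using M I K t0 SA by (intro add_nonneg_pos mult_nonneg_nonneg) auto
  have \<delta>: "\<delta> > 0" using \<epsilon> den by (simp add: \<delta>_def)
  \<comment> \<open>The adjoint state is evaluated through traces, which the sources need not have;
    density of the domain supplies substitutes.\<close>
  have "\<forall>j. \<exists>p p'. j \<in> J \<longrightarrow> (p, p') \<in> dom_A \<and> N (\<lambda>\<xi>. g j \<xi> - p \<xi>) < \<delta>"
    using dom_A_dense[OF g \<delta>] by blast
  then obtain p p' where p: "\<And>j. j \<in> J \<Longrightarrow> (p j, p' j) \<in> dom_A"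
    "\<And>j. j \<in> J \<Longrightarrow> N (\<lambda>\<xi>. g j \<xi> - p j \<xi>) < \<delta>" by metis
  have pV: "p j \<in> V" if "j \<in> J" for j using p(1)[OF that] by (rule dom_A_V)
  have Np: "N (p j) \<le> N (g j) + \<delta>" if "j \<in> J" for j
    using L1_norm_triangle_diff[OF g[OF that] L1_space_diff[OF g[OF that] pV[OF that]]] p(2)[OF that] by simp
  obtain Kl where Kl: "Kl > 0" "\<And>s t. norm (\<psi> s - \<psi> t) \<le> Kl * \<bar>s - t\<bar>"
    by (rule test_fn_lipschitz[OF \<psi>]) blast
  note \<psi>c = test_fn_continuous[OF \<psi>]
  note L_bound = adj_bound[OF adm \<psi> \<psi>_bound less_imp_le[OF t0]]
  note L_lip = adj_lipschitz[OF adm \<psi> Kl(2) less_imp_le[OF t0]]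
  let ?c = "\<lambda>f. cdot r (btrace f)"
  let ?L = "adj r \<psi> t0"
  define q where "q s = ?L s (z s)" for s
  define D where "D s = (\<Sum>j\<in>J. \<alpha> j s * ?L s (p j)) - \<psi> s * ?c (z s)" for s
  \<comment> \<open>The defect per unit of time caused by replacing \<open>g j\<close> with
    \<open>p j\<close>.\<close>
  define B where "B = M * K * (\<delta> * (\<Sum>j\<in>J. A j))"
  have zV: "z t \<in> V" "Az t \<in> V" if "0 \<le> t" for t using z[OF that] by (auto dest: dom_A_V)
  have \<alpha>c: "continuous_on {0..t0} (\<alpha> j)" if "j \<in> J" for j
    by (rule continuous_on_subset[OF \<alpha>[OF that]]) auto
  have yc: "continuous_on {0..t0} (\<lambda>t. ?c (z t))" by (rule continuous_on_subset[OF y]) auto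
  have Lc: "continuous_on {0..t0} (\<lambda>s. ?L s (p j))" if "j \<in> J" for j
  proof (rule curve_pairing_continuous[where x = "\<lambda>_. p j"])
    show "norm (?L s (p j) - ?L t (p j)) \<le> 0 * N (\<lambda>\<xi>. p j \<xi> - p j \<xi>) + (M * Kl) * \<bar>s - t\<bar> * N (p j)" for s t
      using L_lip[OF p(1)[OF that], of s t] by (simp add: mult.assoc)
  qed (simp add: L1_norm_0)
  have main: "norm (q t0 - q 0 - integral {0..t0} D) \<le> integral {0..t0} (\<lambda>_. B)"
  proof (rule right_increment_bound[OF less_imp_le[OF t0]])
    show "continuous_on {0..t0} q"
    proof (rule curve_pairing_continuous)
      show "((\<lambda>s. N (\<lambda>\<xi>. z s \<xi> - z t \<xi>)) \<longlongrightarrow> 0) (at t within {0..t0})" if "t \<in> {0..t0}" for t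
        using that by (intro tendsto_within_subset[OF z_cont]) auto
      fix s t assume "s \<in> {0..t0}" "t \<in> {0..t0}"
      then have st: "0 \<le> s" "0 \<le> t" by auto
      have eq: "q s - q t = ?L s (\<lambda>\<xi>. z s \<xi> - z t \<xi>) + (?L s (z t) - ?L t (z t))"
        by (simp add: q_def adj_diff[OF \<psi> z[OF st(1)] z[OF st(2)]])
      have "norm (q s - q t) \<le> M * K * N (\<lambda>\<xi>. z s \<xi> - z t \<xi>) + M * (Kl * \<bar>s - t\<bar>) * N (z t)"
        unfolding eq
        by (rule order_trans[OF norm_triangle_ineq add_mono[OF L_bound[OF dom_A_diff[OF z[OF st(1)] z[OF st(2)]]] L_lip[OF z[OF st(2)]]]])
      then show "norm (q s - q t) \<le> (M * K) * N (\<lambda>\<xi>. z s \<xi> - z t \<xi>) + (M * Kl) * \<bar>s - t\<bar> * N (z t)"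
        by (simp add: mult.assoc)
    qed
    show "continuous_on {0..t0} D"
      unfolding D_def by (intro continuous_on_diff continuous_on_sum continuous_on_mult \<alpha>c Lc \<psi>c yc)
    show "continuous_on {0..t0} (\<lambda>_. B)" by (rule continuous_on_const)
    fix s e :: real assume s: "0 \<le> s" "s < t0" and e: "0 < e"
    \<comment> \<open>Budget for \<open>e\<close>: one half for the increments of \<open>z\<close>
      and of the free orbit, a quarter for the motion of the adjoint state, a quarter for the trace
      integral \<open>F\<close>.\<close>
    define e1 where "e1 = e / (4 * (M * K + 1))"
    have MK: "M * K + 1 > 0" using M K by (simp add: add_nonneg_pos)
    have e1: "e1 > 0" using e MK by (simp add: e1_def)
    define Z where "Z = (\<Sum>j\<in>J. A j * (M * Kl * N (p j))) + 1"
    have Z: "Z > 0" unfolding Z_def using A0 M Kl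
      by (intro add_nonneg_pos sum_nonneg mult_nonneg_nonneg) (auto simp: L1_norm_nonneg)
    have small: "\<forall>\<^sub>F h in at_right 0. h < e / (4 * Z)" "\<forall>\<^sub>F h in at_right 0. h < t0 - s"
      using e Z s by (auto intro!: eventually_at_right_less_real)
    \<comment> \<open>The weighted trace of the free orbit started at \<open>z s\<close>; its
      derivative at 0 is the term \<open>\<psi> s * ?c (z s)\<close> of \<open>D\<close>.\<close>
    define F where "F u = integral {0..u} (\<lambda>t. \<psi> (s + t) * ?c (T t (z s)))" for u
    have zs: "(z s, Az s) \<in> dom_A" by (rule z[OF s(1)])
    have Fd: "(F has_vector_derivative \<psi> (s + 0) * ?c (T 0 (z s))) (at 0 within {0..t0})"
      unfolding F_def
      by (rule integral_has_vector_derivative[OF adj_integrable(1)[OF \<psi> zs]]) (use t0 in auto)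
    have T0: "btrace (T 0 (z s)) = btrace (z s)"
      by (rule btrace_cong[OF dom_A_orbit[OF zs order_refl] zs T_0[OF zV(1)[OF s(1)]]])
    have F0: "F 0 = 0" by (simp add: F_def)
    have "\<forall>\<^sub>F h in at_right 0. norm (F h - h *\<^sub>R (\<psi> s * ?c (z s))) \<le> e / 4 * h"
      using has_vector_derivative_right_increment[OF Fd order_refl t0, of "e / 4"] e
      by (simp add: T0 F0)
    with z_inc[OF s(1) e1] dom_A_right_increment[OF zs e1] small eventually_at_right_less[of "0::real"]
    show "\<forall>\<^sub>F h in at_right 0. norm (q (s + h) - q s - h *\<^sub>R D s) \<le> (B + e) * h"
    proof eventually_elim
      case (elim h)
      have h: "0 \<le> h" "h \<le> t0" "0 \<le> s + h" using elim(4,5) s by auto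
      define P where "P \<xi> = (\<Sum>j\<in>J. \<alpha> j s *s p j \<xi>)" for \<xi>
      define P' where "P' \<xi> = (\<Sum>j\<in>J. \<alpha> j s *s p' j \<xi>)" for \<xi>
      define G where "G \<xi> = (\<Sum>j\<in>J. \<alpha> j s *s g j \<xi>)" for \<xi>
      have PP: "(P, P') \<in> dom_A" unfolding P_def P'_def by (intro dom_A_sum J p(1))
      have GV: "G \<in> V" unfolding G_def by (intro L1_space_sum L1_space_smult g)
      have PV: "P \<in> V" by (rule dom_A_V(1)[OF PP])
      note hP = dom_A_smult[OF PP, of "of_real h"]
      note Th = dom_A_orbit[OF zs h(1)]
      note zh = z[OF h(3)]
      note d1 = dom_A_diff[OF zh Th]
      note d2 = dom_A_diff[OF d1 hP]
      \<comment> \<open>The deviation of \<open>z\<close> from the free orbit plus the substituted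
        sources. It lies in the domain, so the adjoint state may be split linearly. Smallness of its
        L^1 norm suffices; its graph norm is never estimated.\<close>
      let ?u = "\<lambda>\<xi>. z (s + h) \<xi> - T h (z s) \<xi> - of_real h *s P \<xi>"
      have LP: "?L s' P = (\<Sum>j\<in>J. \<alpha> j s * ?L s' (p j))" for s'
        unfolding P_def by (rule adj_sum[OF \<psi> J p(1)])
      have "q s = F h + ?L (s + h) (T h (z s))"
        unfolding q_def F_def by (rule adj_shift[OF \<psi> supp zs s(1) h(1,2)])
      moreover have "?L (s + h) ?u = q (s + h) - ?L (s + h) (T h (z s)) - of_real h * ?L (s + h) P"
        by (simp add: adj_diff[OF \<psi> d1 hP] adj_diff[OF \<psi> zh Th] adj_smult[OF \<psi> PP] q_def)
      ultimately have eq: "q (s + h) - q s - h *\<^sub>R D s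
          = ?L (s + h) ?u + h *\<^sub>R (?L (s + h) P - ?L s P) - (F h - h *\<^sub>R (\<psi> s * ?c (z s)))"
        unfolding D_def LP[symmetric] by (simp add: scaleR_conv_of_real algebra_simps)
      have n1: "norm (?L (s + h) ?u) \<le> B * h + e / 2 * h"
      proof -
        have sumV: "(\<lambda>\<xi>. Az s \<xi> + G \<xi>) \<in> V" by (intro L1_space_add zV s(1) GV)
        have V1: "(\<lambda>\<xi>. z (s + h) \<xi> - z s \<xi> - h *\<^sub>R (Az s \<xi> + G \<xi>)) \<in> V"
          by (intro L1_space_diff L1_space_scaleR sumV zV h s)
        have V2: "(\<lambda>\<xi>. T h (z s) \<xi> - z s \<xi> - h *\<^sub>R Az s \<xi>) \<in> V"
          by (intro L1_space_diff L1_space_scaleR T_V zV h s)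
        have V3: "(\<lambda>\<xi>. h *\<^sub>R (G \<xi> - P \<xi>)) \<in> V" by (intro L1_space_scaleR L1_space_diff GV PV)
        have "N (\<lambda>\<xi>. G \<xi> - P \<xi>) \<le> \<delta> * (\<Sum>j\<in>J. A j)"
        proof -
          have "N (\<lambda>\<xi>. G \<xi> - P \<xi>) = N (\<lambda>\<xi>. \<Sum>j\<in>J. \<alpha> j s *s (g j \<xi> - p j \<xi>))"
            by (simp add: G_def P_def sum_subtractf vector_ssub_ldistrib)
          also have "\<dots> \<le> (\<Sum>j\<in>J. N (\<lambda>\<xi>. \<alpha> j s *s (g j \<xi> - p j \<xi>)))"
            by (rule L1_norm_sum[OF J]) (intro L1_space_smult L1_space_diff g pV)
          also have "\<dots> \<le> (\<Sum>j\<in>J. A j * \<delta>)"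
          proof (rule sum_mono)
            fix j assume j: "j \<in> J"
            have "N (\<lambda>\<xi>. \<alpha> j s *s (g j \<xi> - p j \<xi>)) = norm (\<alpha> j s) * N (\<lambda>\<xi>. g j \<xi> - p j \<xi>)"
              by (rule L1_space_smult(2)[OF L1_space_diff[OF g[OF j] pV[OF j]]])
            also have "\<dots> \<le> A j * \<delta>"
              using A[OF j, of s] s p(2)[OF j] A0[OF j] by (intro mult_mono) (auto simp: L1_norm_nonneg)
            finally show "N (\<lambda>\<xi>. \<alpha> j s *s (g j \<xi> - p j \<xi>)) \<le> A j * \<delta>" .
          qed
          finally show ?thesis by (simp add: sum_distrib_left mult.commute)
        qed
        then have n3: "N (\<lambda>\<xi>. h *\<^sub>R (G \<xi> - P \<xi>)) \<le> h * (\<delta> * (\<Sum>j\<in>J. A j))"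
          using h(1) by (simp add: L1_norm_scaleR mult_left_mono)
        have "N ?u \<le> N (\<lambda>\<xi>. (z (s + h) \<xi> - z s \<xi> - h *\<^sub>R (Az s \<xi> + G \<xi>)) - (T h (z s) \<xi> - z s \<xi> - h *\<^sub>R Az s \<xi>))
            + N (\<lambda>\<xi>. h *\<^sub>R (G \<xi> - P \<xi>))"
          by (rule L1_norm_triangle'[OF L1_space_diff[OF V1 V2] V3])
             (simp add: scaleR_eq_smult[symmetric] scaleR_add_right scaleR_diff_right)
        also have "\<dots> \<le> (e1 * h + e1 * h) + h * (\<delta> * (\<Sum>j\<in>J. A j))"
          using L1_norm_triangle_diff[OF V1 V2] elim(1,2) n3 unfolding G_def by (intro add_mono) linarith+
        finally have Nu: "N ?u \<le> 2 * e1 * h + h * (\<delta> * (\<Sum>j\<in>J. A j))" by simp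
        have "norm (?L (s + h) ?u) \<le> M * K * N ?u" by (rule L_bound[OF d2])
        also have "\<dots> \<le> M * K * (2 * e1 * h + h * (\<delta> * (\<Sum>j\<in>J. A j)))"
          using Nu M K by (intro mult_left_mono) auto
        also have "\<dots> = (M * K) * (2 * e1 * h) + B * h" by (simp add: B_def algebra_simps)
        also have "\<dots> \<le> (M * K + 1) * (2 * e1 * h) + B * h"
          using e1 h(1) by (intro add_mono mult_right_mono) auto
        also have "(M * K + 1) * (2 * e1 * h) = e / 2 * h" using MK by (simp add: e1_def field_simps)
        finally show ?thesis by simp
      qed
      have n2: "norm (h *\<^sub>R (?L (s + h) P - ?L s P)) \<le> e / 4 * h"
      proof -
        have "norm (?L (s + h) P - ?L s P) = norm (\<Sum>j\<in>J. \<alpha> j s * (?L (s + h) (p j) - ?L s (p j)))"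
          unfolding LP by (simp add: sum_subtractf right_diff_distrib)
        also have "\<dots> \<le> (\<Sum>j\<in>J. A j * (M * (Kl * h) * N (p j)))"
        proof (rule sum_norm_le)
          fix j assume j: "j \<in> J"
          show "norm (\<alpha> j s * (?L (s + h) (p j) - ?L s (p j))) \<le> A j * (M * (Kl * h) * N (p j))"
            unfolding norm_mult using A[OF j, of s] s A0[OF j] L_lip[OF p(1)[OF j], of "s + h" s] h(1)
            by (intro mult_mono) auto
        qed
        also have "\<dots> \<le> h * Z" using h(1) by (simp add: Z_def sum_distrib_left algebra_simps)
        also have "\<dots> \<le> e / (4 * Z) * Z" using elim(3) Z by (intro mult_right_mono) auto
        also have "\<dots> = e / 4" using Z by simp
        finally show ?thesis using mult_left_mono[OF _ h(1), of _ "e / 4"] h(1) by (simp add: mult.commute[of h])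
      qed
      have "norm (q (s + h) - q s - h *\<^sub>R D s) \<le> (B * h + e / 2 * h + e / 4 * h) + e / 4 * h"
        unfolding eq
        by (rule order_trans[OF norm_triangle_ineq4 add_mono[OF order_trans[OF norm_triangle_ineq add_mono[OF n1 n2]] elim(6)]])
      also have "\<dots> = (B + e) * h" by (simp add: algebra_simps)
      finally show ?case .
    qed
  qed
  have "norm (q 0) \<le> M * K * N (z 0)" unfolding q_def by (rule L_bound[OF z[OF order_refl]])
  then have q0: "q 0 = 0" by (simp add: z0)
  have "q t0 = integral {0..t0} (\<lambda>_. 0)"
    unfolding q_def adj_def by (rule integral_cong) (simp add: supp)
  then have qt0: "q t0 = 0" by simp
  \<comment> \<open>By Fubini the moving adjoint state becomes a single test of the orbit of
    \<open>p j\<close> with the kernel \<open>\<Psi>\<close>, whose sup is at most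
    \<open>A j * I\<close> however steep \<psi> is.\<close>
  have LD: "norm (integral {0..t0} (\<lambda>s. \<alpha> j s * ?L s (p j))) \<le> M * (A j * I) * N (p j)" if j: "j \<in> J" for j
  proof -
    define \<Psi> where "\<Psi> r = integral {0..t0} (\<lambda>s. \<alpha> j s * \<psi> (s + r))" for r
    have \<Psi>_bound: "norm (\<Psi> t) \<le> A j * I" for t
    proof -
      have "norm (\<Psi> t) \<le> integral {0..t0} (\<lambda>s. A j * norm (\<psi> (s + t)))"
        unfolding \<Psi>_def
      proof (rule integral_norm_bound_integral)
        show "(\<lambda>s. \<alpha> j s * \<psi> (s + t)) integrable_on {0..t0}"
          by (intro integrable_continuous_real continuous_on_mult \<alpha>c[OF j] \<psi>sc)
        show "(\<lambda>s. A j * norm (\<psi> (s + t))) integrable_on {0..t0}"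
          by (intro integrable_continuous_real continuous_on_mult continuous_on_const continuous_on_norm \<psi>sc)
        show "norm (\<alpha> j s * \<psi> (s + t)) \<le> A j * norm (\<psi> (s + t))" if "s \<in> {0..t0}" for s
          unfolding norm_mult using A[OF j that] by (intro mult_right_mono) auto
      qed
      also have "\<dots> = A j * integral {0..t0} (\<lambda>s. norm (\<psi> (s + t)))" by (rule integral_mult_right)
      also have "\<dots> \<le> A j * I" by (rule mult_left_mono[OF \<psi>_int A0[OF j]])
      finally show ?thesis .
    qed
    have cc: "continuous_on (cbox (0, 0) (t0, t0)) (\<lambda>(s, t). \<alpha> j s * (\<psi> (s + t) * ?c (T t (p j))))"
      unfolding split_beta
    proof (intro continuous_on_mult)
      show "continuous_on (cbox (0, 0) (t0, t0)) (\<lambda>x. \<alpha> j (fst x))"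
        by (rule continuous_on_compose2[OF \<alpha>c[OF j]]) (auto intro!: continuous_intros simp: cbox_Pair_eq)
      show "continuous_on (cbox (0, 0) (t0, t0)) (\<lambda>x. \<psi> (fst x + snd x))"
        by (rule continuous_on_compose2[OF \<psi>c[of UNIV]]) (auto intro!: continuous_intros)
      show "continuous_on (cbox (0, 0) (t0, t0)) (\<lambda>x. ?c (T (snd x) (p j)))"
        by (rule continuous_on_compose2[OF cdot_btrace_orbit_continuous[OF p(1)[OF j] order_refl, of t0]])
           (auto intro!: continuous_intros simp: cbox_Pair_eq)
    qed
    have "integral {0..t0} (\<lambda>s. \<alpha> j s * ?L s (p j))
        = integral {0..t0} (\<lambda>s. integral {0..t0} (\<lambda>t. \<alpha> j s * (\<psi> (s + t) * ?c (T t (p j)))))"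
      unfolding adj_def by simp
    also have "\<dots> = integral {0..t0} (\<lambda>t. integral {0..t0} (\<lambda>s. \<alpha> j s * (\<psi> (s + t) * ?c (T t (p j)))))"
      using integral_swap_continuous[OF cc] by simp
    also have "\<dots> = integral {0..t0} (\<lambda>t. \<Psi> t * ?c (T t (p j)))"
      unfolding \<Psi>_def by (simp add: mult.assoc[symmetric])
    finally have eq: "integral {0..t0} (\<lambda>s. \<alpha> j s * ?L s (p j)) = integral {0..t0} (\<lambda>t. \<Psi> t * ?c (T t (p j)))" .
    have "test_fn \<Psi> (\<lambda>r. integral {0..t0} (\<lambda>s. \<alpha> j s * \<psi>' (s + r)))"
      unfolding \<Psi>_def by (rule test_fn_convolution[OF less_imp_le[OF t0] \<alpha>c[OF j] \<psi>])
    from admissible_constD[OF adm p(1)[OF j] this \<Psi>_bound less_imp_le[OF t0]] show ?thesis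
      unfolding eq .
  qed
  have iL: "(\<lambda>s. \<alpha> j s * ?L s (p j)) integrable_on {0..t0}" if "j \<in> J" for j
    by (intro integrable_continuous_real continuous_on_mult \<alpha>c Lc that)
  have iy: "(\<lambda>s. \<psi> s * ?c (z s)) integrable_on {0..t0}"
    by (intro integrable_continuous_real continuous_on_mult \<psi>c yc)
  have "integral {0..t0} D = (\<Sum>j\<in>J. integral {0..t0} (\<lambda>s. \<alpha> j s * ?L s (p j))) - integral {0..t0} (\<lambda>s. \<psi> s * ?c (z s))"
    unfolding D_def
    by (intro integral_unique has_integral_diff has_integral_sum integrable_integral iL iy J)
  then have "norm (integral {0..t0} (\<lambda>s. \<psi> s * ?c (z s)))
      = norm ((\<Sum>j\<in>J. integral {0..t0} (\<lambda>s. \<alpha> j s * ?L s (p j))) + (q t0 - q 0 - integral {0..t0} D))"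
    by (simp add: q0 qt0)
  also have "\<dots> \<le> (\<Sum>j\<in>J. M * (A j * I) * N (p j)) + t0 * B"
    using main t0 by (intro order_trans[OF norm_triangle_ineq add_mono[OF sum_norm_le[OF LD]]]) auto
  also have "\<dots> \<le> (\<Sum>j\<in>J. M * (A j * I) * (N (g j) + \<delta>)) + t0 * B"
    by (rule add_mono[OF sum_mono order_refl]) (use M I A0 Np in \<open>auto intro!: mult_left_mono\<close>)
  also have "\<dots> = M * I * (\<Sum>j\<in>J. A j * N (g j)) + \<delta> * (M * (I + t0 * K) * (\<Sum>j\<in>J. A j))"
    by (simp add: B_def sum.distrib sum_distrib_left algebra_simps)
  also have "\<delta> * (M * (I + t0 * K) * (\<Sum>j\<in>J. A j)) \<le> \<epsilon>"
  proof -
    have "\<delta> * (M * (I + t0 * K) * (\<Sum>j\<in>J. A j)) \<le> \<delta> * (M * (I + t0 * K) * (\<Sum>j\<in>J. A j) + 1)"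
      using \<delta> by (intro mult_left_mono) auto
    also have "\<dots> = \<epsilon>" using den by (simp add: \<delta>_def)
    finally show ?thesis .
  qed
  finally show "norm (integral {0..t0} (\<lambda>t. \<psi> t * cdot r (btrace (z t)))) \<le> M * I * (\<Sum>j\<in>J. A j * N (g j)) + \<epsilon>"
    by simp
qed

end

text \<open>Full row rank means independent rows, hence a right inverse. Surjectivity supplies
  boundary values realising each unit input.\<close>

lemma full_row_rank_surj:
  fixes A :: "'k::field^'m^'n"
  assumes "rank A = CARD('n)"
  shows "\<exists>p. A *v p = v"
proof -
  have rows: "rows A = range (\<lambda>i. row i A)" by (auto simp: rows_def)
  have dim: "vec.dim (rows A) = CARD('n)" using assms by (simp add: row_rank_def_gen)
  have "vec.dim (rows A) \<le> card (rows A)"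
    by (rule vec.dim_le_card) (auto simp: rows vec.span_superset)
  moreover have "card (rows A) \<le> CARD('n)" unfolding rows by (rule card_image_le) simp
  ultimately have card: "card (rows A) = CARD('n)" using dim by simp
  have ind: "\<not> vec.dependent (rows A)"
    by (rule vec.card_le_dim_spanning[of _ "rows A"]) (auto simp: rows vec.span_superset dim[unfolded rows] card[unfolded rows])
  \<comment> \<open>\<open>rows A\<close> is a set and would merge equal rows. Its cardinality shows
    that the rows are pairwise distinct, so sums over it can be reindexed.\<close>
  have inj: "inj (\<lambda>i. row i A)"
    by (rule eq_card_imp_inj_on) (use card in \<open>auto simp: rows\<close>)
  have "\<forall>c. (\<Sum>i\<in>UNIV. c i *s row i A) = 0 \<longrightarrow> (\<forall>i. c i = 0)"
  proof (intro allI impI)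
    fix c i assume c: "(\<Sum>i\<in>UNIV. c i *s row i A) = 0"
    define d where "d v = c (the_inv (\<lambda>i. row i A) v)" for v
    have "(\<Sum>v\<in>rows A. d v *s v) = (\<Sum>i\<in>UNIV. c i *s row i A)"
      unfolding rows by (subst sum.reindex[OF inj]) (simp add: d_def the_inv_f_f[OF inj])
    then have "(\<Sum>v\<in>rows A. d v *s v) = 0" using c by simp
    moreover have "\<not> (\<exists>u. (\<exists>v\<in>rows A. u v \<noteq> 0) \<and> (\<Sum>v\<in>rows A. u v *s v) = 0)"
      using ind vec.dependent_finite[of "rows A"] by (simp add: rows)
    moreover have "row i A \<in> rows A" by (simp add: rows)
    ultimately have "d (row i A) = 0" by blast
    then show "c i = 0" by (simp add: d_def the_inv_f_f[OF inj])
  qed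
  then obtain B where "A ** B = mat 1"
    unfolding matrix_right_invertible_independent_rows[symmetric] by blast
  then show ?thesis
    by (intro exI[of _ "B *v v"]) (simp add: matrix_vector_mul_assoc)
qed

lemma sum_UNIV_sum:
  "(\<Sum>k\<in>(UNIV :: ('a::finite + 'b::finite) set). F k) = (\<Sum>j\<in>UNIV. F (Inl j)) + (\<Sum>j\<in>UNIV. F (Inr j))"
  unfolding UNIV_Plus_UNIV[symmetric] Plus_def
  by (subst sum.union_disjoint) (auto simp: sum.reindex)

lemma continuous_AE_le_imp_le:
  fixes f :: "real \<Rightarrow> real"
  assumes "continuous_on {a..b} f" "AE s in lebesgue_on {a..b}. f s \<le> c" "a < b" "s \<in> {a..b}"
  shows "f s \<le> c"
proof -
  have "max 0 (f s - c) = 0"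
  proof (rule continuous_AE_0_imp_0[OF _ _ assms(3,4)])
    show "continuous_on {a..b} (\<lambda>s. max 0 (f s - c))" by (intro continuous_intros assms(1))
    show "AE s in lebesgue_on {a..b}. max 0 (f s - c) = 0" using assms(2) by eventually_elim simp
  qed
  then show ?thesis by (simp add: max_def split: if_splits)
qed

text \<open>The essential supremum is an extended real. Minus infinity is excluded because the
  interval has positive length and norms are nonnegative; in the finite case continuity turns the
  bound almost everywhere into one at every point.\<close>

lemma Linf_norm_cases:
  fixes u :: "real \<Rightarrow> 'v::euclidean_space"
  assumes "continuous_on {0..t} u" "0 < t"
  obtains "Linf_norm t u = \<infinity>" | A where "Linf_norm t u = ereal A" "\<And>s. s \<in> {0..t} \<Longrightarrow> norm (u s) \<le> A"
proof -
  have ae: "AE s in lebesgue_on {0..t}. ereal (norm (u s)) \<le> Linf_norm t u"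
    unfolding Linf_norm_def by (rule esssup_AE)
  have le: "norm (u s) \<le> A" if A: "Linf_norm t u \<le> ereal A" and s: "s \<in> {0..t}" for A s
  proof (rule continuous_AE_le_imp_le[OF _ _ assms(2) s])
    show "continuous_on {0..t} (\<lambda>s. norm (u s))" by (intro continuous_intros assms(1))
    show "AE s in lebesgue_on {0..t}. norm (u s) \<le> A"
      using ae
    proof eventually_elim
      case (elim s)
      then have "ereal (norm (u s)) \<le> ereal A" using A by (rule order_trans)
      then show ?case by simp
    qed
  qed
  show thesis
  proof (cases "Linf_norm t u")
    case (real A)
    then show ?thesis using le[of A] that(2) by simp
  next
    case MInf
    then have "norm (u 0) \<le> -1" using le[of "-1" 0] assms(2) by simp
    then show ?thesis using norm_ge_zero[of "u 0"] by linarith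
  qed (use that(1) in simp)
qed

lemma Linf_norm_le:
  fixes y :: "real \<Rightarrow> 'v::euclidean_space"
  assumes "continuous_on {0..t} y" "\<And>s. s \<in> {0..t} \<Longrightarrow> norm (y s) \<le> B"
  shows "Linf_norm t y \<le> ereal B"
  unfolding Linf_norm_def
proof (rule esssup_I)
  have "(\<lambda>s. norm (y s)) \<in> borel_measurable (lebesgue_on {0..t})"
    by (rule L1_space_measurable[OF continuous_on_imp_L1]) (intro continuous_intros assms(1))
  then show "(\<lambda>s. ereal (norm (y s))) \<in> borel_measurable (lebesgue_on {0..t})" by simp
  show "AE s in lebesgue_on {0..t}. ereal (norm (y s)) \<le> ereal B"
    by (rule AE_I2) (simp add: assms(2))
qed

context stable_hyperbolic
begin

text \<open>Recovers the value at \<open>t0\<close> by concentrating \<psi> just before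
  \<open>t0\<close>. The weak bound is proportional to the mass of \<psi>, which cancels, so the
  height and steepness of \<psi> leave no trace.\<close>

lemma source_response:
  assumes adm: "admissible_const r M" and J: "finite J"
    and z: "\<And>t. 0 \<le> t \<Longrightarrow> (z t, Az t) \<in> dom_A"
    and z_inc: "\<And>t e. 0 \<le> t \<Longrightarrow> 0 < e \<Longrightarrow> \<forall>\<^sub>F h in at_right 0.
      N (\<lambda>\<xi>. z (t + h) \<xi> - z t \<xi> - h *\<^sub>R (Az t \<xi> + (\<Sum>j\<in>J. \<alpha> j t *s g j \<xi>))) \<le> e * h"
    and z_cont: "\<And>t. 0 \<le> t \<Longrightarrow> ((\<lambda>s. N (\<lambda>\<xi>. z s \<xi> - z t \<xi>)) \<longlongrightarrow> 0) (at t within {0..})"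
    and z0: "N (z 0) = 0" and y: "continuous_on {0..} (\<lambda>t. cdot r (btrace (z t)))"
    and \<alpha>: "\<And>j. j \<in> J \<Longrightarrow> continuous_on {0..} (\<alpha> j)" and g: "\<And>j. j \<in> J \<Longrightarrow> g j \<in> V"
    and t0: "0 < t0" and A: "\<And>j t. j \<in> J \<Longrightarrow> t \<in> {0..t0} \<Longrightarrow> norm (\<alpha> j t) \<le> A j"
  shows "norm (cdot r (btrace (z t0))) \<le> M * (\<Sum>j\<in>J. A j * N (g j))"
proof (rule field_le_epsilon)
  fix \<epsilon> :: real assume \<epsilon>: "0 < \<epsilon>"
  let ?y = "\<lambda>t. cdot r (btrace (z t))"
  obtain d where d: "d > 0" "\<And>t. 0 \<le> t \<Longrightarrow> \<bar>t - t0\<bar> < d \<Longrightarrow> norm (?y t - ?y t0) < \<epsilon>"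
    using y[unfolded continuous_on_iff, rule_format, of t0 \<epsilon>] t0 \<epsilon>
    by (auto simp: dist_norm)
  \<comment> \<open>The window from \<open>l\<close> to \<open>e\<close> ends before
    \<open>t0\<close>, since \<psi> has to vanish from \<open>t0\<close> on, and lies within
    \<open>d\<close> of \<open>t0\<close>, where the observation is nearly constant.\<close>
  define l where "l = max 0 (t0 - d / 2)"
  define e where "e = (l + t0) / 2"
  have le: "0 \<le> l" "l < e" "e < t0" "t0 - d < l" using d(1) t0 by (auto simp: l_def e_def)
  obtain \<phi> \<phi>' where \<phi>: "test_fn \<phi> \<phi>'" "\<And>t. 0 \<le> \<phi> t" "\<And>t. t \<notin> {l..e} \<Longrightarrow> \<phi> t = (0::real)"
    "\<phi> ((l + e) / 2) > 0"
    by (rule bump_fn[OF le(2)]) blast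
  have \<phi>c: "continuous_on S \<phi>" for S by (rule test_fn_continuous[OF \<phi>(1)])
  define I where "I = integral {l..e} \<phi>"
  have \<phi>I: "(\<phi> has_integral I) {l..e}"
    unfolding I_def by (rule integrable_integral[OF integrable_continuous_real[OF \<phi>c]])
  have "I \<noteq> 0"
    using integral_eq_0_iff[OF \<phi>c le(2)] \<phi>(2,4) le(2) unfolding I_def by force
  moreover have "I \<ge> 0" using \<phi>I \<phi>(2) by (rule has_integral_nonneg)
  ultimately have I: "I > 0" by simp
  have \<phi>UNIV: "(\<phi> has_integral I) UNIV"
    by (rule has_integral_on_superset[OF \<phi>I]) (use \<phi>(3) in auto)
  have \<phi>t0: "(\<phi> has_integral I) {0..t0}"
    by (rule has_integral_on_superset[OF \<phi>I]) (use \<phi>(3) le in auto)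
  define \<psi> :: "real \<Rightarrow> 'k" where "\<psi> t = of_real (\<phi> t)" for t
  have \<psi>: "test_fn \<psi> (\<lambda>t. of_real (\<phi>' t))" unfolding \<psi>_def by (rule test_fn_of_real[OF \<phi>(1)])
  have n\<psi>: "norm (\<psi> t) = \<phi> t" for t using \<phi>(2) by (simp add: \<psi>_def)
  obtain K where K: "K > 0" "\<And>t. t \<in> {l..e} \<Longrightarrow> norm (\<phi> t) \<le> K"
    using continuous_on_Icc_bounded[OF \<phi>c] by blast
  have weak: "norm (integral {0..t0} (\<lambda>t. \<psi> t * ?y t)) \<le> M * I * (\<Sum>j\<in>J. A j * N (g j))"
  proof (rule source_response_weak[OF adm J z z_inc z_cont z0 y \<alpha> g t0 A \<psi>])
    show "\<psi> t = 0" if "t0 \<le> t" for t using that le by (simp add: \<psi>_def \<phi>(3))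
    show "norm (\<psi> t) \<le> K" for t
      using K(1) K(2)[of t] \<phi>(3)[of t] \<phi>(2)[of t] unfolding n\<psi> by (cases "t \<in> {l..e}") auto
    \<comment> \<open>As \<phi> is nonnegative, a translated window captures at most its full
      mass.\<close>
    show "integral {0..t0} (\<lambda>s. norm (\<psi> (s + t))) \<le> I" for t
    proof -
      have "integral {0..t0} (\<lambda>s. norm (\<psi> (s + t))) = integral {t..t0 + t} \<phi>"
        unfolding n\<psi> using integral_shift_real_ivl[of t t "t0 + t" \<phi>] by simp
      also have "\<dots> \<le> integral UNIV \<phi>"
        using \<phi>UNIV \<phi>(2) by (intro integral_subset_le integrable_continuous_real \<phi>c) (auto simp: has_integral_iff)
      also have "\<dots> = I" using \<phi>UNIV by (rule integral_unique)
      finally show ?thesis .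
    qed
  qed (assumption | simp)+
  have yc: "continuous_on {0..t0} ?y" by (rule continuous_on_subset[OF y]) auto
  have \<psi>c: "continuous_on {0..t0} \<psi>" by (rule test_fn_continuous[OF \<psi>])
  have int: "(\<lambda>t. \<psi> t * ?y t) integrable_on {0..t0}" "(\<lambda>t. \<psi> t * (?y t0 - ?y t)) integrable_on {0..t0}"
    by (intro integrable_continuous_real continuous_on_mult continuous_on_diff continuous_on_const \<psi>c yc)+
  have "((\<lambda>t. \<phi> t *\<^sub>R ?y t0) has_integral I *\<^sub>R ?y t0) {0..t0}"
    by (rule has_integral_scaleR_left[OF \<phi>t0])
  then have "I *\<^sub>R ?y t0 = integral {0..t0} (\<lambda>t. \<phi> t *\<^sub>R ?y t0)"
    by (rule integral_unique[symmetric])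
  moreover have "integral {0..t0} (\<lambda>t. \<phi> t *\<^sub>R ?y t0)
      = integral {0..t0} (\<lambda>t. \<psi> t * ?y t + \<psi> t * (?y t0 - ?y t))"
    by (rule integral_cong) (simp add: \<psi>_def scaleR_conv_of_real algebra_simps)
  ultimately have eq: "I *\<^sub>R ?y t0 = integral {0..t0} (\<lambda>t. \<psi> t * ?y t) + integral {0..t0} (\<lambda>t. \<psi> t * (?y t0 - ?y t))"
    by (simp only: Henstock_Kurzweil_Integration.integral_add[OF int])
  have "norm (integral {0..t0} (\<lambda>t. \<psi> t * (?y t0 - ?y t))) \<le> integral {0..t0} (\<lambda>t. \<phi> t * \<epsilon>)"
  proof (rule integral_norm_bound_integral[OF int(2)])
    show "(\<lambda>t. \<phi> t * \<epsilon>) integrable_on {0..t0}"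
      by (intro integrable_continuous_real continuous_on_mult continuous_on_const \<phi>c)
    fix t assume t: "t \<in> {0..t0}"
    show "norm (\<psi> t * (?y t0 - ?y t)) \<le> \<phi> t * \<epsilon>"
    proof (cases "t \<in> {l..e}")
      case True
      then have "norm (?y t0 - ?y t) \<le> \<epsilon>"
        using d(2)[of t] le by (auto simp: norm_minus_commute)
      then show ?thesis unfolding norm_mult n\<psi> using \<phi>(2) by (rule mult_left_mono)
    next
      case False
      then show ?thesis using \<phi>(3) by (simp add: \<psi>_def)
    qed
  qed
  also have "\<dots> = I * \<epsilon>" by (rule integral_unique[OF has_integral_mult_left[OF \<phi>t0]])
  finally have "norm (I *\<^sub>R ?y t0) \<le> M * I * (\<Sum>j\<in>J. A j * N (g j)) + I * \<epsilon>"
    unfolding eq by (rule order_trans[OF norm_triangle_ineq add_mono[OF weak]])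
  then have "I * norm (?y t0) \<le> I * (M * (\<Sum>j\<in>J. A j * N (g j)) + \<epsilon>)"
    using I by (simp add: algebra_simps)
  then show "norm (?y t0) \<le> M * (\<Sum>j\<in>J. A j * N (g j)) + \<epsilon>" using I by simp
qed


section \<open>From boundary inputs to distributed sources\<close>

lemma norm_le_sum_components: "norm (v :: 'k^'n) \<le> (\<Sum>i\<in>UNIV. norm (v $ i))"
  unfolding norm_vec_def by (rule L2_set_le_sum) auto

text \<open>
  Subtracting lifts \<open>\<Phi>\<^sub>j\<close> of the boundary data turns the input into distributed sources
  \<open>u\<^sub>j \<Gamma>\<^sub>j - u\<^sub>j' \<Phi>\<^sub>j\<close>; the second kind disappears as \<open>\<Phi>\<^sub>j\<close> becomes small in \<open>L\<^sup>1\<close>.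
\<close>

lemma classical_output_bound:
  assumes adm: "admissible_const r M"
    and pb: "\<And>j. WB *v stack_vec (pb j) (pa j) = axis j 1"
    and G: "\<And>j e. 0 < e \<Longrightarrow> \<exists>f w g. hyp f w g \<and> w b = pb j \<and> w a = pa j \<and> N f < e \<and> N g \<le> G j"
    and cs: "classical_solution a b P1 P0 H WB WC u x y" and u_smooth: "Cc_infinity u"
    and x0: "AE \<xi> in lebesgue_on {a..b}. x 0 \<xi> = 0"
    and r: "r = WC $ i"
    and t: "0 < t" and A: "\<And>s. s \<in> {0..t} \<Longrightarrow> norm (u s) \<le> A"
  shows "norm (y t $ i) \<le> A * ((\<Sum>j\<in>UNIV. norm (cdot r (stack_vec (pb j) (pa j)))) + M * (\<Sum>j\<in>UNIV. G j))"
proof (rule field_le_epsilon)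
  fix \<epsilon> :: real assume \<epsilon>: "0 < \<epsilon>"
  have M: "0 \<le> M" using adm by (simp add: admissible_const_def)
  have A0: "0 \<le> A" by (rule order_trans[OF norm_ge_zero A[of 0]]) (use t in simp)
  obtain x' where uc: "continuous_on {0..} u" and yc: "continuous_on {0..} y"
    and x: "\<And>t. 0 \<le> t \<Longrightarrow> x t \<in> L2_space a b" "\<And>t. 0 \<le> t \<Longrightarrow> x' t \<in> L2_space a b"
    and x': "\<And>t. 0 \<le> t \<Longrightarrow> ((\<lambda>s. X_norm a b H (\<lambda>\<xi>. (1 / (s - t)) *\<^sub>R (x s \<xi> - x t \<xi>) - x' t \<xi>)) \<longlongrightarrow> 0) (at t within {0..})"
    and w_ex: "\<And>t. 0 \<le> t \<Longrightarrow> \<exists>w. hyp_op a b (L2_space a b) P1 P0 H (x t) w (x' t) \<and>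
          u t = WB *v stack_vec (w b) (w a) \<and> y t = WC *v stack_vec (w b) (w a)"
    using cs unfolding classical_solution_def by blast
  have L2L1: "L2_space a b \<subseteq> V" using L2_imp_L1[of _ a b] ab by auto
  have "\<exists>w. 0 \<le> t \<longrightarrow> hyp (x t) w (x' t) \<and> u t = WB *v stack_vec (w b) (w a) \<and> y t = WC *v stack_vec (w b) (w a)" for t
    using w_ex[of t] hyp_op_mono[OF _ L2L1] by blast
  then obtain w where w: "\<And>t. 0 \<le> t \<Longrightarrow> hyp (x t) (w t) (x' t)"
    "\<And>t. 0 \<le> t \<Longrightarrow> u t = WB *v stack_vec (w t b) (w t a)"
    "\<And>t. 0 \<le> t \<Longrightarrow> y t = WC *v stack_vec (w t b) (w t a)" by metis
  have xV: "x t \<in> V" "x' t \<in> V" if "0 \<le> t" for t using x[OF that] L2L1 by auto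
  obtain D :: "nat \<Rightarrow> real \<Rightarrow> 'k^'n" where D0: "\<And>t. 0 \<le> t \<Longrightarrow> D 0 t = u t"
    and D: "\<And>k t. 0 \<le> t \<Longrightarrow> (D k has_vector_derivative D (Suc k) t) (at t within {0..})"
    using u_smooth unfolding Cc_infinity_def by blast
  have ud: "(u has_vector_derivative D 1 t) (at t within {0..})" if "0 \<le> t" for t
  proof (rule has_vector_derivative_transform[of t "{0..}" u "D 0"])
    show "(D 0 has_vector_derivative D 1 t) (at t within {0..})" using D[OF that, of 0] by simp
  qed (use that D0 in auto)
  have u'c: "continuous_on {0..} (D 1)"
    unfolding continuous_on_eq_continuous_within
    using has_vector_derivative_continuous[OF D] by simp
  obtain A' where A': "A' > 0" "\<And>s. s \<in> {0..t} \<Longrightarrow> norm (D 1 s) \<le> A'"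
    using continuous_on_Icc_bounded[OF continuous_on_subset[OF u'c, of "{0..t}"]] by auto
  \<comment> \<open>Compatibility forced by the zero initial state: the continuous representative
    vanishes, hence so do the traces. It makes \<open>z 0\<close> vanish almost everywhere.\<close>
  have u0: "u 0 = 0"
  proof -
    obtain v where v: "sob a b (\<lambda>\<xi>. H \<xi> *v x 0 \<xi>) (w 0) v" using w(1)[of 0] unfolding hyp_op_def by auto
    have "sob a b (\<lambda>\<xi>. H \<xi> *v (0 :: 'k^'n)) (\<lambda>\<xi>. 0) (\<lambda>\<xi>. 0)"
      by (simp add: sobolev_W1_def L1_space_0)
    moreover have "AE \<xi> in lebesgue_on {a..b}. H \<xi> *v x 0 \<xi> = H \<xi> *v (0 :: 'k^'n)"
      using x0 by eventually_elim simp
    ultimately have "w 0 \<xi> = 0" if "\<xi> \<in> {a..b}" for \<xi>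
      using sobolev_W1_unique[OF v _ _ ab that] by blast
    then show ?thesis using w(2)[of 0] ab by (simp add: stack_vec_0)
  qed
  \<comment> \<open>\<open>A'\<close> bounds the derivative of the input and depends on it. The size
    of the lifts is chosen after \<open>A'\<close>, so that the sources with u' contribute at most
    \<epsilon>; the bounds \<open>G j\<close> are unaffected by this choice.\<close>
  define e where "e = \<epsilon> / (M * A' * CARD('n) + 1)"
  have den: "M * A' * CARD('n) + 1 > 0" using M A' by (simp add: add_nonneg_pos)
  have e: "e > 0" using \<epsilon> den by (simp add: e_def)
  have "\<forall>j. \<exists>f w g. hyp f w g \<and> w b = pb j \<and> w a = pa j \<and> N f < e \<and> N g \<le> G j" using G[OF e] by blast
  then obtain \<Phi> W \<Gamma> where \<Phi>: "\<And>j. hyp (\<Phi> j) (W j) (\<Gamma> j)" "\<And>j. W j b = pb j" "\<And>j. W j a = pa j"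
    "\<And>j. N (\<Phi> j) < e" "\<And>j. N (\<Gamma> j) \<le> G j" by metis
  have \<Phi>V: "\<Phi> j \<in> V" "\<Gamma> j \<in> V" for j using \<Phi>(1)[of j] by (auto simp: hyp_op_def)
  define z where "z t \<xi> = x t \<xi> - (\<Sum>j\<in>UNIV. u t $ j *s \<Phi> j \<xi>)" for t \<xi>
  define Az where "Az t \<xi> = x' t \<xi> - (\<Sum>j\<in>UNIV. u t $ j *s \<Gamma> j \<xi>)" for t \<xi>
  define wz where "wz t \<xi> = w t \<xi> - (\<Sum>j\<in>UNIV. u t $ j *s W j \<xi>)" for t \<xi>
  have hz: "hyp (z t) (wz t) (Az t)" if "0 \<le> t" for t
    unfolding z_def wz_def Az_def
    by (intro hyp_diff w(1) hyp_sum hyp_smult \<Phi>(1) finite_class.finite_UNIV that)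
  have stz: "stack_vec (wz t b) (wz t a)
      = stack_vec (w t b) (w t a) - (\<Sum>j\<in>UNIV. u t $ j *s stack_vec (pb j) (pa j))" for t
    unfolding wz_def vec_eq_iff by (auto simp: stack_vec_def \<Phi> sum_component split: sum.splits)
  have matsum: "B *v (\<Sum>j\<in>UNIV. c j *s q j) = (\<Sum>j\<in>UNIV. c j *s (B *v q j))"
    for B :: "'k^('n+'n)^'n" and c :: "'n \<Rightarrow> 'k" and q
    by (simp add: vec.linear_sum[OF matrix_vector_mul_linear_gen] vector_scalar_commute)
  have basis: "(\<Sum>j\<in>UNIV. u t $ j *s axis j 1) = u t" for t
    by (rule basis_expansion)
  have bz: "WB *v stack_vec (wz t b) (wz t a) = 0" if "0 \<le> t" for t
    unfolding stz matrix_vector_mult_diff_distrib matsum pb basis using w(2)[OF that] by simp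
  have zdom: "(z t, Az t) \<in> dom_A" if "0 \<le> t" for t
    unfolding dom_A_iff using hz[OF that] bz[OF that] by blast
  have yz: "cdot r (btrace (z t)) = y t $ i - (\<Sum>j\<in>UNIV. u t $ j * cdot r (stack_vec (pb j) (pa j)))"
    if "0 \<le> t" for t
    unfolding hyp_btrace[OF hz[OF that]] stz w(3)[OF that] matrix_vector_mult_cdot r
    by (simp add: cdot.diff_right cdot.sum_right cdot_smult)
  \<comment> \<open>The left copy of the index type carries the sources \<open>\<Gamma> j\<close>
    weighted by \<open>u\<close>, the right copy the sources \<open>\<Phi> j\<close> weighted by
    minus its derivative.\<close>
  define \<alpha> where "\<alpha> k t = (case k of Inl j \<Rightarrow> u t $ j | Inr j \<Rightarrow> - (D 1 t $ j))" for k :: "'n + 'n" and t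
  define g where "g k = (case k of Inl j \<Rightarrow> \<Gamma> j | Inr j \<Rightarrow> \<Phi> j)" for k :: "'n + 'n"
  define B where "B k = (case k of Inl j \<Rightarrow> A | Inr j \<Rightarrow> A')" for k :: "'n + 'n"
  \<comment> \<open>The terms \<open>u t $ j *s \<Gamma> j\<close> of \<open>Az\<close> and of the
    sources cancel; what is left is the time derivative of \<open>z\<close>.\<close>
  have src: "Az t \<xi> + (\<Sum>k\<in>UNIV. \<alpha> k t *s g k \<xi>) = x' t \<xi> - (\<Sum>j\<in>UNIV. D 1 t $ j *s \<Phi> j \<xi>)" for t \<xi>
    by (simp add: sum_UNIV_sum \<alpha>_def g_def Az_def sum_negf)
  have lip: "N (\<lambda>\<xi>. \<Sum>j\<in>UNIV. c $ j *s \<Phi> j \<xi>) \<le> CARD('n) * e * norm c" for c :: "'k^'n"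
  proof -
    have "N (\<lambda>\<xi>. \<Sum>j\<in>UNIV. c $ j *s \<Phi> j \<xi>) \<le> (\<Sum>j\<in>UNIV. N (\<lambda>\<xi>. c $ j *s \<Phi> j \<xi>))"
      by (rule L1_norm_sum) (auto intro: L1_space_smult \<Phi>V)
    also have "\<dots> \<le> (\<Sum>j\<in>(UNIV :: 'n set). norm c * e)"
      unfolding L1_space_smult(2)[OF \<Phi>V(1)]
      by (intro sum_mono mult_mono Finite_Cartesian_Product.norm_nth_le less_imp_le[OF \<Phi>(4)] L1_norm_nonneg) auto
    finally show ?thesis by (simp add: mult_ac)
  qed
  have \<Phi>sumV: "(\<lambda>\<xi>. \<Sum>j\<in>UNIV. c $ j *s \<Phi> j \<xi>) \<in> V" for c :: "'k^'n"
    by (intro L1_space_sum L1_space_smult \<Phi>V)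
  obtain cX where cX: "cX > 0" "\<And>f. f \<in> L2_space a b \<Longrightarrow> N f \<le> cX * X_norm a b H f"
    by (rule L1_norm_le_X_norm) blast
  have L2_quot: "(\<lambda>\<xi>. (1 / (s - t)) *\<^sub>R (x s \<xi> - x t \<xi>) - x' t \<xi>) \<in> L2_space a b" if "0 \<le> s" "0 \<le> t" for s t
    by (intro L2_space_diff L2_space_scaleR x that)
  \<comment> \<open>Differentiability in the norm of \<open>X\<close>, transferred to L^1 and freed
    of the division by the increment.\<close>
  have xinc: "\<exists>d>0. \<forall>s\<in>{0..}. s \<noteq> t \<and> \<bar>s - t\<bar> < d \<longrightarrow>
      N (\<lambda>\<xi>. x s \<xi> - x t \<xi> - (s - t) *\<^sub>R x' t \<xi>) \<le> \<eta> * \<bar>s - t\<bar>" if t: "0 \<le> t" and \<eta>: "0 < \<eta>" for t \<eta>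
  proof -
    have "\<eta> / cX > 0" using \<eta> cX by simp
    from order_tendstoD(2)[OF x'[OF t] this] obtain d where d: "d > 0"
      "\<And>s. s \<in> {0..} \<Longrightarrow> s \<noteq> t \<Longrightarrow> dist s t < d \<Longrightarrow>
        X_norm a b H (\<lambda>\<xi>. (1 / (s - t)) *\<^sub>R (x s \<xi> - x t \<xi>) - x' t \<xi>) < \<eta> / cX"
      unfolding eventually_at by blast
    have "N (\<lambda>\<xi>. x s \<xi> - x t \<xi> - (s - t) *\<^sub>R x' t \<xi>) \<le> \<eta> * \<bar>s - t\<bar>"
      if s: "s \<in> {0..}" "s \<noteq> t" "\<bar>s - t\<bar> < d" for s
    proof -
      let ?Q = "\<lambda>\<xi>. (1 / (s - t)) *\<^sub>R (x s \<xi> - x t \<xi>) - x' t \<xi>"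
      have "N ?Q \<le> cX * X_norm a b H ?Q" using s(1) t by (intro cX(2) L2_quot) auto
      also have "\<dots> \<le> cX * (\<eta> / cX)"
        using d(2)[of s] s cX(1) by (intro mult_left_mono) (auto simp: dist_real_def intro: less_imp_le)
      finally have NQ: "N ?Q \<le> \<eta>" using cX(1) by simp
      have "N (\<lambda>\<xi>. x s \<xi> - x t \<xi> - (s - t) *\<^sub>R x' t \<xi>) = N (\<lambda>\<xi>. (s - t) *\<^sub>R ?Q \<xi>)"
        using s(2) by (simp add: scaleR_diff_right)
      also have "\<dots> = \<bar>s - t\<bar> * N ?Q" by (rule L1_norm_scaleR)
      also have "\<dots> \<le> \<bar>s - t\<bar> * \<eta>" by (rule mult_left_mono[OF NQ abs_ge_zero])
      finally show ?thesis by (simp add: mult.commute)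
    qed
    with d(1) show ?thesis by blast
  qed
  have z_inc: "\<forall>\<^sub>F h in at_right 0.
      N (\<lambda>\<xi>. z (t + h) \<xi> - z t \<xi> - h *\<^sub>R (Az t \<xi> + (\<Sum>k\<in>UNIV. \<alpha> k t *s g k \<xi>))) \<le> \<eta> * h"
    if t: "0 \<le> t" and \<eta>: "0 < \<eta>" for t \<eta>
  proof -
    have \<eta>2: "\<eta> / 2 > 0" using \<eta> by simp
    have ce: "real CARD('n) * e > 0" using e by simp
    have \<eta>3: "\<eta> / 2 / (CARD('n) * e) > 0" using \<eta>2 ce by (rule divide_pos_pos)
    have "(u has_vector_derivative D 1 t) (at t within {0..t + 1})"
      by (rule has_vector_derivative_within_subset[OF ud[OF t]]) auto
    from has_vector_derivative_right_increment[OF this t _ \<eta>3]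
    have ui: "\<forall>\<^sub>F h in at_right 0. norm (u (t + h) - u t - h *\<^sub>R D 1 t) \<le> \<eta> / 2 / (CARD('n) * e) * h" by simp
    obtain d where d: "d > 0" "\<And>s. s \<in> {0..} \<Longrightarrow> s \<noteq> t \<and> \<bar>s - t\<bar> < d \<Longrightarrow>
      N (\<lambda>\<xi>. x s \<xi> - x t \<xi> - (s - t) *\<^sub>R x' t \<xi>) \<le> \<eta> / 2 * \<bar>s - t\<bar>"
      using xinc[OF t \<eta>2] by blast
    have cancel: "q * (\<eta> / 2 / q * h) = \<eta> / 2 * h" if "q > 0" for q h :: real using that by simp
    show ?thesis
      using ui eventually_at_right_less_real[OF d(1)] eventually_at_right_less[of "0::real"]
    proof eventually_elim
      case (elim h)
      have th: "0 \<le> t + h" using t elim by simp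
      let ?X = "\<lambda>\<xi>. x (t + h) \<xi> - x t \<xi> - h *\<^sub>R x' t \<xi>"
      let ?c = "u (t + h) - u t - h *\<^sub>R D 1 t"
      have XV: "?X \<in> V" by (intro L1_space_diff L1_space_scaleR xV th t)
      have "N ?X \<le> \<eta> / 2 * h" using d(2)[of "t + h"] elim t by simp
      moreover have "N (\<lambda>\<xi>. \<Sum>j\<in>UNIV. ?c $ j *s \<Phi> j \<xi>) \<le> CARD('n) * e * (\<eta> / 2 / (CARD('n) * e) * h)"
        using ce by (intro order_trans[OF lip] mult_left_mono elim(1)) auto
      then have "N (\<lambda>\<xi>. \<Sum>j\<in>UNIV. ?c $ j *s \<Phi> j \<xi>) \<le> \<eta> / 2 * h"
        unfolding cancel[OF ce] .
      moreover have "(\<lambda>\<xi>. z (t + h) \<xi> - z t \<xi> - h *\<^sub>R (Az t \<xi> + (\<Sum>k\<in>UNIV. \<alpha> k t *s g k \<xi>)))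
          = (\<lambda>\<xi>. ?X \<xi> - (\<Sum>j\<in>UNIV. ?c $ j *s \<Phi> j \<xi>))"
        unfolding src z_def
        by (simp add: scaleR_diff_right scaleR_sum_right vector_sub_rdistrib sum_subtractf sum.distrib algebra_simps
            bounded_bilinear.scaleR_left[OF bounded_bilinear_vector_scalar_mult])
      ultimately show ?case
        using L1_norm_triangle_diff[OF XV \<Phi>sumV[of ?c]] by simp
    qed
  qed
  have z_cont: "((\<lambda>s. N (\<lambda>\<xi>. z s \<xi> - z t \<xi>)) \<longlongrightarrow> 0) (at t within {0..})" if t: "0 \<le> t" for t
  proof -
    obtain d where d: "d > 0" "\<And>s. s \<in> {0..} \<Longrightarrow> s \<noteq> t \<and> \<bar>s - t\<bar> < d \<Longrightarrow>
      N (\<lambda>\<xi>. x s \<xi> - x t \<xi> - (s - t) *\<^sub>R x' t \<xi>) \<le> 1 * \<bar>s - t\<bar>"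
      using xinc[OF t zero_less_one] by blast
    have "((\<lambda>s. \<bar>s - t\<bar> + \<bar>s - t\<bar> * N (x' t) + CARD('n) * e * norm (u s - u t)) \<longlongrightarrow>
        \<bar>t - t\<bar> + \<bar>t - t\<bar> * N (x' t) + CARD('n) * e * norm (u t - u t)) (at t within {0..})"
      using uc t by (intro tendsto_intros) (auto simp: continuous_on_def)
    then have lim: "((\<lambda>s. \<bar>s - t\<bar> + \<bar>s - t\<bar> * N (x' t) + CARD('n) * e * norm (u s - u t)) \<longlongrightarrow> 0) (at t within {0..})"
      by simp
    have "\<forall>\<^sub>F s in at t within {0..}. norm (N (\<lambda>\<xi>. z s \<xi> - z t \<xi>))
        \<le> \<bar>s - t\<bar> + \<bar>s - t\<bar> * N (x' t) + CARD('n) * e * norm (u s - u t)"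
      unfolding eventually_at
    proof (intro exI[of _ d] conjI d(1) ballI impI)
      fix s assume s: "s \<in> {0..}" "s \<noteq> t \<and> dist s t < d"
      let ?X = "\<lambda>\<xi>. x s \<xi> - x t \<xi> - (s - t) *\<^sub>R x' t \<xi>"
      have V1: "x s \<in> V" "x t \<in> V" "(\<lambda>\<xi>. (s - t) *\<^sub>R x' t \<xi>) \<in> V" using s(1) t by (auto intro!: xV L1_space_scaleR)
      have XV: "?X \<in> V" by (intro L1_space_diff V1)
      have 1: "N (\<lambda>\<xi>. x s \<xi> - x t \<xi>) \<le> N ?X + N (\<lambda>\<xi>. (s - t) *\<^sub>R x' t \<xi>)"
        by (rule L1_norm_triangle'[OF XV V1(3)]) simp
      have "(\<lambda>\<xi>. z s \<xi> - z t \<xi>) = (\<lambda>\<xi>. (x s \<xi> - x t \<xi>) - (\<Sum>j\<in>UNIV. (u s - u t) $ j *s \<Phi> j \<xi>))"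
        by (simp add: z_def vector_sub_rdistrib sum_subtractf algebra_simps)
      then have "N (\<lambda>\<xi>. z s \<xi> - z t \<xi>) \<le> N (\<lambda>\<xi>. x s \<xi> - x t \<xi>) + N (\<lambda>\<xi>. \<Sum>j\<in>UNIV. (u s - u t) $ j *s \<Phi> j \<xi>)"
        using L1_norm_triangle_diff[OF L1_space_diff[OF V1(1,2)] \<Phi>sumV[of "u s - u t"]] by simp
      with 1 lip[of "u s - u t"] d(2)[OF s(1)] s(2)
      show "norm (N (\<lambda>\<xi>. z s \<xi> - z t \<xi>)) \<le> \<bar>s - t\<bar> + \<bar>s - t\<bar> * N (x' t) + CARD('n) * e * norm (u s - u t)"
        by (simp add: L1_norm_nonneg L1_norm_scaleR dist_real_def)
    qed
    from Lim_null_comparison[OF this lim] show ?thesis .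
  qed
  have z0: "N (z 0) = 0"
    by (subst L1_norm_eq_0_iff) (use x0 dom_A_V(1)[OF zdom[OF order_refl]] u0 in \<open>auto simp: z_def\<close>)
  \<comment> \<open>Continuity of the observation is read off from that of \<open>u\<close> and
    \<open>y\<close>, since the two differ by the feedthrough of the lifts.\<close>
  have y_cont: "continuous_on {0..} (\<lambda>t. cdot r (btrace (z t)))"
  proof (rule continuous_on_cong[THEN iffD2, OF refl yz])
    show "continuous_on {0..} (\<lambda>t. y t $ i - (\<Sum>j\<in>UNIV. u t $ j * cdot r (stack_vec (pb j) (pa j))))"
      by (intro continuous_intros yc uc)
  qed simp
  have \<alpha>c: "continuous_on {0..} (\<alpha> k)" for k
    using continuous_on_minus[OF continuous_on_component[OF u'c]] continuous_on_component[OF uc]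
    unfolding \<alpha>_def by (cases k) auto
  have gV: "g k \<in> V" for k unfolding g_def by (cases k) (auto intro: \<Phi>V)
  have \<alpha>B: "norm (\<alpha> k s) \<le> B k" if "s \<in> {0..t}" for k s
    using order_trans[OF Finite_Cartesian_Product.norm_nth_le A[OF that]]
      order_trans[OF Finite_Cartesian_Product.norm_nth_le A'(2)[OF that]]
    unfolding \<alpha>_def B_def by (cases k) auto
  have "norm (cdot r (btrace (z t))) \<le> M * (\<Sum>k\<in>UNIV. B k * N (g k))"
    by (rule source_response[OF adm finite_class.finite_UNIV zdom z_inc z_cont z0 y_cont \<alpha>c gV t \<alpha>B])
  also have "(\<Sum>k\<in>UNIV. B k * N (g k)) \<le> (\<Sum>j\<in>UNIV. A * G j) + (\<Sum>j\<in>(UNIV::'n set). A' * e)"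
    unfolding sum_UNIV_sum B_def g_def
    unfolding sum.case
    by (intro add_mono sum_mono mult_left_mono \<Phi>(5) less_imp_le[OF \<Phi>(4)] A0 less_imp_le[OF A'(1)])
  finally have 1: "norm (cdot r (btrace (z t))) \<le> M * ((\<Sum>j\<in>UNIV. A * G j) + (\<Sum>j\<in>(UNIV::'n set). A' * e))"
    using M by (simp add: mult_left_mono)
  have "y t $ i = cdot r (btrace (z t)) + (\<Sum>j\<in>UNIV. u t $ j * cdot r (stack_vec (pb j) (pa j)))"
    using yz[of t] t by simp
  also have "norm \<dots> \<le> M * ((\<Sum>j\<in>UNIV. A * G j) + (\<Sum>j\<in>(UNIV::'n set). A' * e))
      + (\<Sum>j\<in>UNIV. A * norm (cdot r (stack_vec (pb j) (pa j))))"
  proof (rule order_trans[OF norm_triangle_ineq add_mono[OF 1 sum_norm_le]])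
    fix j
    show "norm (u t $ j * cdot r (stack_vec (pb j) (pa j))) \<le> A * norm (cdot r (stack_vec (pb j) (pa j)))"
      unfolding norm_mult using A[of t] t Finite_Cartesian_Product.norm_nth_le[of "u t" j]
      by (intro mult_right_mono) auto
  qed
  also have "\<dots> = A * ((\<Sum>j\<in>UNIV. norm (cdot r (stack_vec (pb j) (pa j)))) + M * (\<Sum>j\<in>UNIV. G j))
      + (M * A' * CARD('n)) * e"
    by (simp add: sum_distrib_left algebra_simps)
  also have "(M * A' * CARD('n)) * e \<le> \<epsilon>"
  proof -
    have "(M * A' * CARD('n)) * e \<le> (M * A' * CARD('n) + 1) * e"
      using e by (intro mult_right_mono) auto
    also have "\<dots> = \<epsilon>" using den by (simp add: e_def)
    finally show ?thesis .
  qed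
  finally show "norm (y t $ i) \<le> A * ((\<Sum>j\<in>UNIV. norm (cdot r (stack_vec (pb j) (pa j)))) + M * (\<Sum>j\<in>UNIV. G j)) + \<epsilon>"
    by simp
qed

end

text \<open>The boundary values, the lift constants \<open>G\<close> and the admissibility constants
  \<open>M\<close> are fixed before the input is given, which makes the gain uniform. Each
  \<open>k i\<close> adds the direct feedthrough of the lifts to the response to their
  sources.\<close>

lemma (in stable_hyperbolic) BIBO:
  assumes rows: "char_rows a b P1 H S S' \<nu>" and surj: "\<And>v. \<exists>p. WB *v p = v"
  shows "BIBO_stable a b P1 P0 H WB WC"
proof -
  have "\<forall>j. \<exists>u v. WB *v stack_vec u v = axis j 1"
    using surj stack_vec_surj by metis
  then obtain pb pa where p: "\<And>j. WB *v stack_vec (pb j) (pa j) = axis j 1" by metis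
  have "\<forall>j. \<exists>G\<ge>0. \<forall>e>0. \<exists>f w g. hyp f w g \<and> w b = pb j \<and> w a = pa j \<and> N f < e \<and> N g \<le> G"
    using hyp_lift by blast
  then obtain G where G: "\<And>j. G j \<ge> 0"
    "\<And>j e. 0 < e \<Longrightarrow> \<exists>f w g. hyp f w g \<and> w b = pb j \<and> w a = pa j \<and> N f < e \<and> N g \<le> G j"
    by metis
  have "\<forall>i. \<exists>M. admissible_const (WC $ i) M" using admissible[OF rows] by blast
  then obtain M where M: "\<And>i. admissible_const (WC $ i) (M i)" by metis
  define k where "k i = (\<Sum>j\<in>UNIV. norm (cdot (WC $ i) (stack_vec (pb j) (pa j)))) + M i * (\<Sum>j\<in>UNIV. G j)" for i
  define c where "c = (\<Sum>i\<in>UNIV. k i) + 1"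
  have k0: "0 \<le> k i" for i
    using M[of i] G(1) unfolding k_def admissible_const_def
    by (intro add_nonneg_nonneg sum_nonneg mult_nonneg_nonneg) auto
  have c: "c > 0" unfolding c_def using k0 by (intro add_nonneg_pos sum_nonneg) auto
  have "Linf_norm t y \<le> ereal c * Linf_norm t u"
    if cs: "classical_solution a b P1 P0 H WB WC u x y" and u: "Cc_infinity u"
      and x0: "AE \<xi> in lebesgue_on {a..b}. x 0 \<xi> = 0" and t: "t > 0" for u x y t
  proof -
    have uc: "continuous_on {0..t} u" and yc: "continuous_on {0..t} y"
      using cs unfolding classical_solution_def by (auto intro: continuous_on_subset)
    show ?thesis
    proof (cases rule: Linf_norm_cases[OF uc t])
      case 1
      then show ?thesis using c by simp
    next
      case (2 A)
      have A0: "0 \<le> A" by (rule order_trans[OF norm_ge_zero 2(2)[of 0]]) (use t in simp)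
      have pos: "norm (y s) \<le> c * A" if s: "0 < s" "s \<le> t" for s
      proof -
        have "norm (y s) \<le> (\<Sum>i\<in>UNIV. norm (y s $ i))" by (rule norm_le_sum_components)
        also have "\<dots> \<le> (\<Sum>i\<in>UNIV. A * k i)"
          unfolding k_def
          by (intro sum_mono classical_output_bound[OF M p G(2) cs u x0 refl s(1)] 2(2)) (use s in auto)
        also have "\<dots> \<le> c * A" using A0 by (simp add: c_def sum_distrib_left[symmetric] algebra_simps)
        finally show ?thesis .
      qed
      \<comment> \<open>The output bound covers positive times; the single time 0 is a null set, and
        continuity of \<open>y\<close> extends the bound to it.\<close>
      have "norm (y s) \<le> c * A" if "s \<in> {0..t}" for s
      proof (rule continuous_AE_le_imp_le[OF _ _ t that])
        show "continuous_on {0..t} (\<lambda>s. norm (y s))" by (intro continuous_intros yc)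
        have "AE s in lebesgue. s \<noteq> (0::real)"
          by (rule AE_completion[OF AE_lborel_singleton])
        then have "AE s in lebesgue_on {0..t}. s \<noteq> 0"
          by (auto simp: AE_restrict_space_iff)
        then show "AE s in lebesgue_on {0..t}. norm (y s) \<le> c * A"
          using AE_space by eventually_elim (use pos in auto)
      qed
      from Linf_norm_le[OF yc this] show ?thesis using 2(1) by simp
    qed
  qed
  with c show ?thesis unfolding BIBO_stable_def by blast
qed

theorem theorem33:
  fixes a b :: real
    and P1 :: "('k::real_or_complex, 'n::{finite,linorder}) sq_mat"
    and P0 H :: "real \<Rightarrow> ('k, 'n) sq_mat"
    and WB WC :: "('k, 'n) boundary_mat"
  assumes "a < b"
    and "invertible P1" and "self_adjoint P1"
    and "ess_bounded a b P0"
    and "ess_bounded a b H"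
    and "\<exists>m0>0. \<exists>M0>0. AE \<xi> in lebesgue_on {a..b}. self_adjoint (H \<xi>) \<and>
           loewner_le (mat (of_real m0)) (H \<xi>) \<and> loewner_le (H \<xi>) (mat (of_real M0))"
    and "rank WB = CARD('n)"
    and "rank (stack_rows WB WC) = 2 * CARD('n)"
    and "\<exists>T. generates (L2_space a b) (X_norm a b H)
               (hyp_graph a b (L2_space a b) P1 P0 H WB) T"
    and "diagonalisable a b P1 H"
    and "exp_stable_L1 a b P1 P0 H WB"
  shows "BIBO_stable a b P1 P0 H WB WC"
proof -
  obtain m0 M0 where m0: "m0 > 0" and ae: "AE \<xi> in lebesgue_on {a..b}. self_adjoint (H \<xi>) \<and>
      loewner_le (mat (of_real m0)) (H \<xi>) \<and> loewner_le (H \<xi>) (mat (of_real M0))"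
    using assms(6) by blast
  have co: "AE \<xi> in lebesgue_on {a..b}. loewner_le (mat (of_real m0)) (H \<xi>)"
    using ae by eventually_elim blast
  obtain T C \<omega> where T: "generates (L1_space a b) (L1_norm a b) (hyp_graph a b (L1_space a b) P1 P0 H WB) T"
    and C: "C > 0" "\<omega> > 0" "\<And>t f. 0 \<le> t \<Longrightarrow> f \<in> L1_space a b \<Longrightarrow>
      L1_norm a b (T t f) \<le> C * exp (- \<omega> * t) * L1_norm a b f"
    using assms(11) unfolding exp_stable_L1_def by blast
  interpret stable_hyperbolic a b P1 P0 H WB T C \<omega>
    by unfold_locales (use assms(1-5) m0 co T C in blast)+
  obtain S S' \<nu> where "char_rows a b P1 H S S' \<nu>"
    using diagonalisable_imp_char_rows[OF assms(10)] by blast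
  then show ?thesis by (rule BIBO[OF _ full_row_rank_surj[OF assms(7)]])
qed

end
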